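(* Let $\Bbbk$ be a field, $d\in\mathbb{Z}_{>0}$, $R=\Bbbk[x_1,\ldots,x_d]_{(x_1,\ldots,x_d)}$ with maximal ideal $\mathfrak{m}$, and let $J,I_1,\ldots,I_r\subseteq R$ be nonzero monomial ideals with $J$ $\mathfrak{m}$-primary. Let $Q,P_1,\ldots,P_r$ be the convex hulls of the vertices of the Newton polyhedra of $J,I_1,\ldots,I_r$, respectively. For every $n_0,\ldots,n_r\in\mathbb{Z}_{\ge0}$ with $n_0+\cdots+n_r=d-1$, the mixed multiplicity $e_{(n_0,\ldots,n_r)}(J|I_1,\ldots,I_r)$ is equal to $$d!\Bigl(\operatorname{MV}_d\bigl(\operatorname{conv}(\mathbf 0,Q)[n_0+1],P_1[n_1],\ldots,P_r[n_r]\bigr)-\operatorname{MV}_d\bigl(Q[n_0+1],P_1[n_1],\ldots,P_r[n_r]\bigr)\Bigr).$$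
   Context: The Newton polyhedron of a monomial ideal $I$ is $\operatorname{conv}(\mathbf v\mid\mathbf x^{\mathbf v}\in I)\subseteq\mathbb{R}^d$. $\operatorname{conv}(\mathbf 0,Q)$ denotes $\operatorname{conv}(\{\mathbf 0\}\cup Q)$. Mixed multiplicities. For nonzero ideals $J,I_1,\ldots,I_r\subseteq R$ with $J$ $\mathfrak m$-primary, the function (Hilbert function of $\operatorname{gr}_J(\mathcal{R}(I_1,\ldots,I_r))$, where $\mathcal R(I_1,\ldots,I_r)=\bigoplus_{u_1,\ldots,u_r\ge 0} I_1^{u_1}\cdots I_r^{u_r}$) $$(u_0,\ldots,u_r)\mapsto\lambda_R\left(\frac{J^{u_0}I_1^{u_1}\cdots I_r^{u_r}}{J^{u_0+1}I_1^{u_1}\cdots I_r^{u_r}}\right)$$ ($\lambda_R$ = length) agrees for $u_0,\ldots,u_r\gg0$ with a polynomial of the form $$\sum_{n_i\ge0,\ \sum_in_i=d-1}\frac{e_{(n_0,\ldots,n_r)}(J|I_1,\ldots,I_r)}{n_0!\cdots n_r!}u_0^{n_0}\cdots u_r^{n_r}+(\text{terms of degree}<d-1).$$ The nonnegative integers $e_{(n_0,\ldots,n_r)}(J|I_1,\ldots,I_r)$ are the mixed multiplicities. Mixed volumes. For polytopes $Q_1,\ldots,Q_m\subseteq\mathbb{R}^d$ and $t_i\ge0$, $$\operatorname{Vol}_d(t_1Q_1+\cdots+t_mQ_m)=\sum_{n_i\ge0,\ \sum n_i=d}\binom{d}{n_1,\ldots,n_m}\operatorname{MV}_d(Q_1[n_1],\ldots,Q_m[n_m])\,t_1^{n_1}\cdots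 t_m^{n_m},$$ which defines the mixed volume $\operatorname{MV}_d(Q_1[n_1],\ldots,Q_m[n_m])$ (each $Q_i$ repeated $n_i$ times), normalized so that $\operatorname{MV}_d(Q[d])=\operatorname{Vol}_d(Q)$. *)

theory Defs
  imports
    "HOL-Analysis.Analysis"
    "HOL-Library.Poly_Mapping"
    "HOL-Library.Extended_Real"
    "HOL-Computational_Algebra.Fraction_Field"
    "HOL-Algebra.Module"
    "HOL-Algebra.Ideal_Product"
begin

section \<open>Polynomials and their localization at the origin\<close>

text \<open>
  Polynomials over \<open>'k\<close> in the variables indexed by \<open>'n\<close>, so \<open>d = CARD('n)\<close>. The linear order on
  \<open>'n\<close> (an ordering \<open>x\<^sub>1, \<dots>, x\<^sub>d\<close> of the variables) is used for nothing but the library's proof that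
  the polynomial ring is an integral domain, which is needed to form its field of fractions.
\<close>

type_synonym ('n, 'k) mpol = "('n \<Rightarrow>\<^sub>0 nat) \<Rightarrow>\<^sub>0 'k"

definition mono_pol :: "('n \<Rightarrow>\<^sub>0 nat) \<Rightarrow> ('n, 'k::field) mpol" where
  "mono_pol v = Poly_Mapping.single v 1"

definition var_pol :: "'n \<Rightarrow> ('n, 'k::field) mpol" where
  "var_pol i = mono_pol (Poly_Mapping.single i 1)"

text \<open>The ideal \<open>(x\<^sub>1, \<dots>, x\<^sub>d)\<close> of the polynomial ring.\<close>

definition origin_ideal :: "('n::finite, 'k::field) mpol set" where
  "origin_ideal = {\<Sum>i\<in>UNIV. h i * var_pol i | h. True}"

definition loc_ring :: "('n::{finite,linorder}, 'k::field) mpol fract ring" where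
  "loc_ring = \<lparr>carrier = {Fract f g | f g. g \<notin> origin_ideal}, mult = (*), one = 1, zero = 0, add = (+)\<rparr>"

definition loc_max :: "('n::{finite,linorder}, 'k::field) mpol fract set" where
  "loc_max = {Fract f g | f g. f \<in> origin_ideal \<and> g \<notin> origin_ideal}"

definition loc_mono :: "('n \<Rightarrow>\<^sub>0 nat) \<Rightarrow> ('n::{finite,linorder}, 'k::field) mpol fract" where
  "loc_mono v = Fract (mono_pol v) 1"

definition monomial_ideal :: "('n::{finite,linorder}, 'k::field) mpol fract set \<Rightarrow> bool" where
  "monomial_ideal I \<longleftrightarrow> (\<exists>A. I = Idl\<^bsub>loc_ring\<^esub> (loc_mono ` A))"

section \<open>Primary ideals, quotient modules, length\<close>

definition primary_ideal :: "'a set \<Rightarrow> ('a, 'b) ring_scheme \<Rightarrow> bool" where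
  "primary_ideal I R \<longleftrightarrow> ideal I R \<and> I \<noteq> carrier R \<and>
     (\<forall>a\<in>carrier R. \<forall>b\<in>carrier R. a \<otimes>\<^bsub>R\<^esub> b \<in> I \<longrightarrow> a \<in> I \<or> (\<exists>n::nat. b [^]\<^bsub>R\<^esub> n \<in> I))"

definition radical_of :: "('a, 'b) ring_scheme \<Rightarrow> 'a set \<Rightarrow> 'a set" where
  "radical_of R I = {a \<in> carrier R. \<exists>n::nat. a [^]\<^bsub>R\<^esub> n \<in> I}"

definition is_primary_to :: "'a set \<Rightarrow> 'a set \<Rightarrow> ('a, 'b) ring_scheme \<Rightarrow> bool" where
  "is_primary_to M I R \<longleftrightarrow> primary_ideal I R \<and> radical_of R I = M"

definition ideal_module :: "('a, 'b) ring_scheme \<Rightarrow> 'a set \<Rightarrow> ('a, 'a) module" where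
  "ideal_module R I = \<lparr>carrier = I, mult = mult R, one = one R, zero = zero R, add = add R, smult = mult R\<rparr>"

text \<open>
  The fields \<open>mult\<close> and \<open>one\<close>, which the record type of modules inherits from rings, play no role in
  the notion of a module.
\<close>

definition quot_module :: "('a, 'b, 'c) module_scheme \<Rightarrow> 'b set \<Rightarrow> ('a, 'b set) module" where
  "quot_module M N =
     \<lparr>carrier = a_rcosets\<^bsub>M\<^esub> N, mult = undefined, one = undefined, zero = N, add = set_add M,
      smult = (\<lambda>a X. \<Union>x\<in>X. N +>\<^bsub>M\<^esub> (a \<odot>\<^bsub>M\<^esub> x))\<rparr>"

definition module_length :: "('a, 'm) ring_scheme \<Rightarrow> ('a, 'b, 'c) module_scheme \<Rightarrow> enat" where
  "module_length R M =
     Sup {enat l | l. \<exists>C. (\<forall>i\<le>l. submodule (C i) R M) \<and> (\<forall>i<l. C i \<subset> C (Suc i))}"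

section \<open>Mixed multiplicities\<close>

text \<open>
  The tuples \<open>(n\<^sub>0, \<dots>, n\<^sub>m\<^sub>-\<^sub>1)\<close> of natural numbers of sum \<open>k\<close>, each extended by zero to a function on
  all of \<open>nat\<close>.
\<close>

definition multi_indices :: "nat \<Rightarrow> nat \<Rightarrow> (nat \<Rightarrow> nat) set" where
  "multi_indices m k = {n. (\<forall>i\<ge>m. n i = 0) \<and> (\<Sum>i<m. n i) = k}"

text \<open>\<open>J\<^sup>u\<^sup>0 I\<^sub>1\<^sup>u\<^sup>1 \<dots> I\<^sub>r\<^sup>u\<^sup>r\<close>; only the values of \<open>I\<close> at \<open>1, \<dots>, r\<close> matter.\<close>

definition ideal_power_prod ::
  "('a, 'b) ring_scheme \<Rightarrow> 'a set \<Rightarrow> (nat \<Rightarrow> 'a set) \<Rightarrow> nat \<Rightarrow> (nat \<Rightarrow> nat) \<Rightarrow> 'a set" where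
  "ideal_power_prod R J I r u =
     (J [^]\<^bsub>ideals_set R\<^esub> u 0) \<cdot>\<^bsub>R\<^esub> (\<Otimes>\<^bsub>ideals_set R\<^esub>i\<in>{1..r}. I i [^]\<^bsub>ideals_set R\<^esub> u i)"

definition mixed_hilbert ::
  "('a, 'b) ring_scheme \<Rightarrow> 'a set \<Rightarrow> (nat \<Rightarrow> 'a set) \<Rightarrow> nat \<Rightarrow> (nat \<Rightarrow> nat) \<Rightarrow> enat" where
  "mixed_hilbert R J I r u =
     module_length R (quot_module (ideal_module R (ideal_power_prod R J I r u))
                                  (ideal_power_prod R J I r (u(0 := u 0 + 1))))"

text \<open>The parameter \<open>d\<close> is the Krull dimension of \<open>R\<close>.\<close>

definition has_mixed_multiplicities ::
  "('a, 'b) ring_scheme \<Rightarrow> nat \<Rightarrow> 'a set \<Rightarrow> (nat \<Rightarrow> 'a set) \<Rightarrow> nat \<Rightarrow> ((nat \<Rightarrow> nat) \<Rightarrow> real) \<Rightarrow> bool"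
  where
  "has_mixed_multiplicities R d J I r e \<longleftrightarrow>
     (\<exists>q :: (nat \<Rightarrow> nat) \<Rightarrow> real. \<exists>U. \<forall>u. (\<forall>i\<le>r. U \<le> u i) \<longrightarrow>
        ereal_of_enat (mixed_hilbert R J I r u) =
        ereal ((\<Sum>n\<in>multi_indices (r + 1) (d - 1).
                  e n / (\<Prod>i\<le>r. fact (n i)) * (\<Prod>i\<le>r. real (u i) ^ n i))
             + (\<Sum>k<d - 1. \<Sum>n\<in>multi_indices (r + 1) k. q n * (\<Prod>i\<le>r. real (u i) ^ n i))))"

definition mixed_multiplicity ::
  "('a, 'b) ring_scheme \<Rightarrow> nat \<Rightarrow> 'a set \<Rightarrow> (nat \<Rightarrow> 'a set) \<Rightarrow> nat \<Rightarrow> (nat \<Rightarrow> nat) \<Rightarrow> real" where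
  "mixed_multiplicity R d J I r n = (THE x. \<exists>e. has_mixed_multiplicities R d J I r e \<and> e n = x)"

section \<open>Mixed volumes\<close>

text \<open>\<open>t\<^sub>0 Q\<^sub>0 + \<dots> + t\<^sub>m\<^sub>-\<^sub>1 Q\<^sub>m\<^sub>-\<^sub>1\<close>\<close>

definition minkowski_comb :: "nat \<Rightarrow> (nat \<Rightarrow> 'a::real_vector set) \<Rightarrow> (nat \<Rightarrow> real) \<Rightarrow> 'a set" where
  "minkowski_comb m Q t = {\<Sum>i<m. t i *\<^sub>R x i | x. \<forall>i<m. x i \<in> Q i}"

definition has_mixed_volumes ::
  "nat \<Rightarrow> (nat \<Rightarrow> (real ^ 'n) set) \<Rightarrow> ((nat \<Rightarrow> nat) \<Rightarrow> real) \<Rightarrow> bool" where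
  "has_mixed_volumes m Q V \<longleftrightarrow>
     (\<forall>t. (\<forall>i<m. 0 \<le> t i) \<longrightarrow>
        measure lebesgue (minkowski_comb m Q t) =
        (\<Sum>n\<in>multi_indices m CARD('n).
           fact CARD('n) / (\<Prod>i<m. fact (n i)) * V n * (\<Prod>i<m. t i ^ n i)))"

text \<open>\<open>MV\<^sub>d(Q\<^sub>0[n\<^sub>0], \<dots>, Q\<^sub>m\<^sub>-\<^sub>1[n\<^sub>m\<^sub>-\<^sub>1])\<close>\<close>

definition mixed_volume :: "nat \<Rightarrow> (nat \<Rightarrow> (real ^ 'n) set) \<Rightarrow> (nat \<Rightarrow> nat) \<Rightarrow> real" where
  "mixed_volume m Q n = (THE x. \<exists>V. has_mixed_volumes m Q V \<and> V n = x)"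

section \<open>Newton polyhedra\<close>

definition newton_polyhedron ::
  "('n::{finite,linorder}, 'k::field) mpol fract set \<Rightarrow> (real, 'n) vec set" where
  "newton_polyhedron I = convex hull {\<chi> i. real (Poly_Mapping.lookup v i) | v. loc_mono v \<in> I}"

definition newton_vertex_hull ::
  "('n::{finite,linorder}, 'k::field) mpol fract set \<Rightarrow> (real, 'n) vec set" where
  "newton_vertex_hull I = convex hull {x. x extreme_point_of newton_polyhedron I}"

end

theory Submission
  imports Defs
begin

text \<open>
  The statement is about lattice points. A monomial ideal of the local ring is determined by the
  up-closed set of its exponents (\<open>mono_ideal\<close>), a product of ideals belongs to the sum of these sets
  (\<open>ideal_power_prod_eq_staircase\<close>), and the length of a quotient is the number of monomials in the
  difference, because adding the missing monomials one at a time, the largest degrees first, is a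
  composition series (\<open>module_length_mono_ideal_quotient\<close>). So the Hilbert function at \<open>u\<close> is the number of
  exponents that occur in \<open>J\<^bsup>u 0\<^esup> I\<^sub>1\<^bsup>u 1\<^esup> \<dots> I\<^sub>r\<^bsup>u r\<^esup>\<close> but not in \<open>J\<^bsup>u 0 + 1\<^esup> I\<^sub>1\<^bsup>u 1\<^esup> \<dots> I\<^sub>r\<^bsup>u r\<^esup>\<close>.

  Such numbers are polynomial for large \<open>u\<close>. Every exponent is a sum of generators, and if one selects
  the least of its representations in a suitable order, the selected coefficient vectors form
  down-closed sets. By Dickson's lemma the points of given degree in a down-closed set are counted by
  sums of products of univariate eventually polynomial functions (\<open>sep_poly_count_sums\<close>). The same result
  applied to sumsets of vertices, thickened by a box, shows that the volume of a Minkowski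
  combination of lattice polytopes is a polynomial, hence that mixed volumes exist
  (\<open>ex_mixed_volumes_lattice_polytopes\<close>).

  It remains to find the leading form. Summing the Hilbert function over its first argument gives the
  colength of \<open>J\<^bsup>u 0\<^esup>\<close> in the module \<open>I\<^sub>1\<^bsup>u 1\<^esup> \<dots> I\<^sub>r\<^bsup>u r\<^esup>\<close>, that is, the number of lattice points between two
  staircases. Up to lower order terms, this is the volume of the region between two Newton polyhedra
  (\<open>colength_growth\<close>). Although both polyhedra are unbounded, the region is a difference of polytopes,
  \<open>(u\<^sub>0 conv(0, Q) + \<Sum> u\<^sub>i P\<^sub>i) - (u\<^sub>0 Q + \<Sum> u\<^sub>i P\<^sub>i)\<close>: a functional that separates a point of the first
  polytope from the second one has positive coordinates, as \<open>Q\<close> meets all coordinate axes, and so it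
  separates the point from the unbounded polyhedron as well (\<open>orth_diff_eq_polytope_diff\<close>). The leading form of the colength is therefore
  the difference of the two volume polynomials. The Hilbert function is the difference of the colength
  in \<open>u\<^sub>0\<close>, its leading form is the derivative in \<open>u\<^sub>0\<close>, and comparing coefficients gives the formula.
\<close>

abbreviation lookup :: "('a \<Rightarrow>\<^sub>0 'b::zero) \<Rightarrow> 'a \<Rightarrow> 'b" where "lookup \<equiv> Poly_Mapping.lookup"
abbreviation keys :: "('a \<Rightarrow>\<^sub>0 'b::zero) \<Rightarrow> 'a set" where "keys \<equiv> Poly_Mapping.keys"
abbreviation single :: "'a \<Rightarrow> 'b::zero \<Rightarrow> 'a \<Rightarrow>\<^sub>0 'b" where "single \<equiv> Poly_Mapping.single"

section \<open>Polynomial functions in several variables\<close>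

text \<open>
  Induction on the number of variables: with all variables but the last one fixed, the sum is a
  univariate polynomial with infinitely many zeros, so each of its coefficients vanishes, and these
  coefficients are sums of the same kind in one variable less. This makes all coefficients below
  (mixed volumes, mixed multiplicities) well defined.
\<close>

lemma monomial_sum_eq_0:
  assumes "finite M" and "M \<subseteq> {n. \<forall>i\<ge>m. n i = 0}"
    and "\<forall>u::nat \<Rightarrow> nat. (\<forall>i<m. U \<le> u i) \<longrightarrow> (\<Sum>n\<in>M. q n * (\<Prod>i<m. real (u i) ^ n i)) = 0"
  shows "\<forall>n\<in>M. q n = (0::real)"
  using assms
proof (induction m arbitrary: M q)
  case 0
  have sub: "n' = (\<lambda>_. 0)" if "n' \<in> M" for n'
    using "0.prems"(2) that by (intro ext) auto
  then have "M = {} \<or> M = {\<lambda>_. 0}" by blast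
  moreover have "(\<Sum>n\<in>M. q n * (\<Prod>i<0. real (0 :: nat) ^ n i)) = 0"
    using "0.prems"(3) by simp
  ultimately show ?case by auto
next
  case (Suc m)
  show ?case
  proof
    fix n assume n: "n \<in> M"
    define k where "k = n m"
    define Mk where "Mk = {n \<in> M. n m = k}"
    have fin: "finite Mk" using Suc.prems(1) by (simp add: Mk_def)
    have inj: "inj_on (\<lambda>n. n(m := 0)) Mk"
      by (rule inj_on_inverseI[where g = "\<lambda>n. n(m := k)"]) (auto simp: Mk_def)
    have restore: "(n'(m := 0))(m := k) = n'" if "n' \<in> Mk" for n'
      using that by (auto simp: Mk_def)
    have vanish: "(\<Sum>n\<in>Mk. q n * (\<Prod>i<m. real (u i) ^ n i)) = 0"
      if u: "\<And>i. i < m \<Longrightarrow> U \<le> u i" for u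
    proof -
      define p where "p = (\<Sum>n\<in>M. monom (q n * (\<Prod>i<m. real (u i) ^ n i)) (n m))"
      have "poly p (real x) = 0" if x: "U \<le> x" for x
      proof -
        have "(\<Sum>n\<in>M. q n * (\<Prod>i<Suc m. real ((u(m := x)) i) ^ n i)) = 0"
          using u x by (intro Suc.prems(3)[rule_format]) (auto simp: less_Suc_eq)
        moreover have "(\<Prod>i<Suc m. real ((u(m := x)) i) ^ n i) = (\<Prod>i<m. real (u i) ^ n i) * real x ^ n m" for n
          by (simp add: lessThan_Suc mult.commute)
        ultimately show ?thesis
          by (simp add: p_def poly_sum poly_monom algebra_simps)
      qed
      then have "real ` {U..} \<subseteq> {x. poly p x = 0}" by auto
      moreover have "infinite (real ` {U..})"
        by (simp add: finite_image_iff infinite_Ici)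
      ultimately have "p = 0"
        using poly_roots_finite finite_subset by blast
      then have "coeff p k = 0" by simp
      then show ?thesis
        using Suc.prems(1) unfolding p_def Mk_def
        by (simp add: coeff_sum coeff_monom sum.inter_filter)
    qed
    have "\<forall>n\<in>(\<lambda>n. n(m := 0)) ` Mk. (q \<circ> (\<lambda>n. n(m := k))) n = 0"
    proof (rule Suc.IH[where M = "(\<lambda>n. n(m := 0)) ` Mk" and q = "q \<circ> (\<lambda>n. n(m := k))"])
      show "finite ((\<lambda>n. n(m := 0)) ` Mk)" using fin by simp
      show "(\<lambda>n. n(m := 0)) ` Mk \<subseteq> {n. \<forall>i\<ge>m. n i = 0}"
        using Suc.prems(2) by (auto simp: Mk_def)
      show "\<forall>u. (\<forall>i<m. U \<le> u i) \<longrightarrow>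
          (\<Sum>n\<in>(\<lambda>n. n(m := 0)) ` Mk. (q \<circ> (\<lambda>n. n(m := k))) n * (\<Prod>i<m. real (u i) ^ n i)) = 0"
        using vanish restore by (simp add: sum.reindex[OF inj])
    qed
    then show "q n = 0"
      using n restore by (auto simp: Mk_def k_def)
  qed
qed


definition is_mpoly :: "nat \<Rightarrow> ((nat \<Rightarrow> real) \<Rightarrow> real) \<Rightarrow> bool" where
  "is_mpoly m F \<longleftrightarrow> (\<exists>M q. finite M \<and> M \<subseteq> {n. \<forall>i\<ge>m. n i = 0} \<and>
     (\<forall>x. F x = (\<Sum>n\<in>M. q n * (\<Prod>i<m. x i ^ n i))))"

lemma is_mpoly_const: "is_mpoly m (\<lambda>_. c)"
  unfolding is_mpoly_def
  by (rule exI[of _ "{\<lambda>_. 0}"], rule exI[of _ "\<lambda>_. c"]) auto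

lemma is_mpoly_add:
  assumes "is_mpoly m F" "is_mpoly m G"
  shows "is_mpoly m (\<lambda>x. F x + G x)"
proof -
  obtain M q where M: "finite M" "M \<subseteq> {n. \<forall>i\<ge>m. n i = 0}"
      "\<And>x. F x = (\<Sum>n\<in>M. q n * (\<Prod>i<m. x i ^ n i))"
    using assms(1) unfolding is_mpoly_def by blast
  obtain N p where N: "finite N" "N \<subseteq> {n. \<forall>i\<ge>m. n i = 0}"
      "\<And>x. G x = (\<Sum>n\<in>N. p n * (\<Prod>i<m. x i ^ n i))"
    using assms(2) unfolding is_mpoly_def by blast
  define c where "c n = (if n \<in> M then q n else 0) + (if n \<in> N then p n else 0)" for n
  have "F x + G x = (\<Sum>n\<in>M \<union> N. c n * (\<Prod>i<m. x i ^ n i))" for x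
  proof -
    have "F x = (\<Sum>n\<in>M \<union> N. (if n \<in> M then q n else 0) * (\<Prod>i<m. x i ^ n i))"
      unfolding M(3) using M(1) N(1) by (intro sum.mono_neutral_cong_left) auto
    moreover have "G x = (\<Sum>n\<in>M \<union> N. (if n \<in> N then p n else 0) * (\<Prod>i<m. x i ^ n i))"
      unfolding N(3) using M(1) N(1) by (intro sum.mono_neutral_cong_left) auto
    ultimately show ?thesis
      by (simp add: c_def distrib_right sum.distrib)
  qed
  then show ?thesis
    unfolding is_mpoly_def using M(1,2) N(1,2)
    by (intro exI[of _ "M \<union> N"] exI[of _ c]) auto
qed

lemma is_mpoly_sum: "(\<And>j. j \<in> A \<Longrightarrow> is_mpoly m (F j)) \<Longrightarrow> is_mpoly m (\<lambda>x. \<Sum>j\<in>A. F j x)"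
  by (induction A rule: infinite_finite_induct) (auto intro: is_mpoly_const is_mpoly_add)

lemma is_mpoly_mult_power:
  assumes "is_mpoly m F" and "j < m"
  shows "is_mpoly m (\<lambda>x. F x * (c * x j ^ k))"
proof -
  obtain M q where M: "finite M" "M \<subseteq> {n. \<forall>i\<ge>m. n i = 0}"
      "\<And>x. F x = (\<Sum>n\<in>M. q n * (\<Prod>i<m. x i ^ n i))"
    using assms(1) unfolding is_mpoly_def by blast
  let ?s = "\<lambda>n::nat \<Rightarrow> nat. n(j := n j + k)"
  have inj: "inj_on ?s M"
    by (rule inj_on_inverseI[where g = "\<lambda>n. n(j := n j - k)"]) simp
  have "(\<Prod>i<m. x i ^ ?s n i) = (\<Prod>i<m. x i ^ n i) * x j ^ k" for n and x :: "nat \<Rightarrow> real"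
  proof -
    have "(\<Prod>i<m. x i ^ ?s n i) = (\<Prod>i<m. x i ^ n i * (if i = j then x j ^ k else 1))"
      by (rule prod.cong) (auto simp: power_add)
    then show ?thesis using assms(2) by (simp add: prod.distrib)
  qed
  then have "F x * (c * x j ^ k) = (\<Sum>n\<in>?s ` M. (c * q (n(j := n j - k))) * (\<Prod>i<m. x i ^ n i))" for x
    by (simp add: M(3) sum.reindex[OF inj] sum_distrib_right sum_distrib_left mult_ac del: fun_upd_apply)
      (simp add: mult_ac)
  then show ?thesis
    unfolding is_mpoly_def using M(1,2) assms(2)
    by (intro exI[of _ "?s ` M"] exI[of _ "\<lambda>n. c * q (n(j := n j - k))"]) auto
qed

lemma is_mpoly_prod_poly:
  assumes "l \<le> m"
  shows "is_mpoly m (\<lambda>x. c * (\<Prod>i<l. poly (p i) (x i)))"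
  using assms
proof (induction l)
  case 0
  then show ?case by (simp add: is_mpoly_const)
next
  case (Suc l)
  have "is_mpoly m (\<lambda>x. \<Sum>k\<le>degree (p l). (c * (\<Prod>i<l. poly (p i) (x i))) * (coeff (p l) k * x l ^ k))"
    using Suc by (intro is_mpoly_sum is_mpoly_mult_power) auto
  then show ?case
    by (simp add: poly_altdef[of "p l"] sum_distrib_left mult.assoc)
qed

text \<open>
  For \<open>q = x\<^sup>n\<close>, the difference of \<open>x\<^bsup>n+1\<^esup>\<close> is \<open>(n + 1) x\<^sup>n\<close> plus lower powers, which are differences by
  induction; the general case follows by linearity.
\<close>

lemma telescoping_polynomial: "\<exists>P::real poly. \<forall>x. poly P (x + 1) - poly P x = poly q x"
proof -
  have pow: "\<exists>P::real poly. \<forall>x. poly P (x + 1) - poly P x = x ^ n" for n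
  proof (induction n rule: less_induct)
    case (less n)
    then obtain P where P: "\<And>k x. k < n \<Longrightarrow> poly (P k) (x + 1) - poly (P k) x = (x::real) ^ k"
      by metis
    define R where "R = Polynomial.smult (1 / real (Suc n)) (monom 1 (Suc n) - (\<Sum>k<n. Polynomial.smult (real (Suc n choose k)) (P k)))"
    have "poly R (x + 1) - poly R x = x ^ n" for x
    proof -
      have "(x + 1) ^ Suc n - x ^ Suc n = (\<Sum>k<Suc n. real (Suc n choose k) * x ^ k)"
        by (simp only: binomial_ring[of x 1 "Suc n"]) (simp add: lessThan_Suc_atMost[symmetric] del: binomial_Suc_Suc)
      also have "\<dots> = (\<Sum>k<n. real (Suc n choose k) * (poly (P k) (x + 1) - poly (P k) x)) + real (Suc n) * x ^ n"
        by (simp add: P del: binomial_Suc_Suc)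
      finally have "(x + 1) ^ Suc n - (\<Sum>k<n. real (Suc n choose k) * poly (P k) (x + 1))
          - (x ^ Suc n - (\<Sum>k<n. real (Suc n choose k) * poly (P k) x)) = real (Suc n) * x ^ n"
        by (simp add: sum_subtractf right_diff_distrib del: binomial_Suc_Suc)
      then show ?thesis
        unfolding R_def
        by (simp add: poly_monom poly_sum diff_divide_distrib[symmetric] nonzero_divide_eq_eq
            del: binomial_Suc_Suc power_Suc of_nat_Suc)
    qed
    then show ?case by blast
  qed
  then obtain P where P: "\<And>n x. poly (P n) (x + 1) - poly (P n) x = (x::real) ^ n"
    by metis
  show ?thesis
    by (rule exI[of _ "\<Sum>k\<le>degree q. Polynomial.smult (coeff q k) (P k)"])
      (simp add: poly_sum poly_altdef[of q] sum_subtractf[symmetric] right_diff_distrib[symmetric] P)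
qed

definition eventually_poly :: "(nat \<Rightarrow> real) \<Rightarrow> bool" where
  "eventually_poly g \<longleftrightarrow> (\<exists>p N. \<forall>x\<ge>N. g x = poly p (real x))"

lemma eventually_poly_shift:
  assumes "eventually_poly g"
  shows "eventually_poly (\<lambda>x. if k \<le> x then g (x - k) else 0)"
proof -
  obtain p N where "\<And>x. N \<le> x \<Longrightarrow> g x = poly p (real x)"
    using assms unfolding eventually_poly_def by blast
  then show ?thesis
    unfolding eventually_poly_def
    by (intro exI[of _ "pcompose p [:- real k, 1:]"] exI[of _ "N + k"])
      (auto simp: poly_pcompose of_nat_diff)
qed

lemma eventually_poly_partial_sums:
  assumes "eventually_poly g"
  shows "eventually_poly (\<lambda>x. \<Sum>j\<le>x. g j)"
proof -
  obtain p N where p: "\<And>x. N \<le> x \<Longrightarrow> g x = poly p (real x)"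
    using assms unfolding eventually_poly_def by blast
  obtain P where P: "\<And>x. poly P (x + 1) - poly P x = poly (pcompose p [:1, 1:]) x"
    using telescoping_polynomial by blast
  \<comment> \<open>the constant of summation is fixed at the place where \<open>g\<close> becomes a polynomial\<close>
  define Q where "Q = P + [:(\<Sum>j\<le>N. g j) - poly P (real N):]"
  have "(\<Sum>j\<le>x. g j) = poly Q (real x)" if "N \<le> x" for x
    using that
  proof (induction x rule: dec_induct)
    case base
    then show ?case by (simp add: Q_def)
  next
    case (step x)
    have "g (Suc x) = poly p (1 + real x)" using p[of "Suc x"] step by simp
    also have "\<dots> = poly P (real x + 1) - poly P (real x)" by (simp add: P poly_pcompose)
    finally show ?case using step by (simp add: Q_def add.commute)
  qed
  then show ?thesis unfolding eventually_poly_def by blast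
qed

text \<open>
  A multivariate function that is polynomial for large arguments says nothing about its values when
  only some of the arguments are large, and partial sums in one variable do run through small
  arguments. Sums of products of univariate eventually polynomial functions avoid this problem:
  they form a class that is closed under shifts and partial sums in each variable.
\<close>

inductive sep_poly :: "nat \<Rightarrow> ((nat \<Rightarrow> nat) \<Rightarrow> real) \<Rightarrow> bool" for m where
  prod: "(\<And>i. i < m \<Longrightarrow> eventually_poly (g i)) \<Longrightarrow> sep_poly m (\<lambda>u. c * (\<Prod>i<m. g i (u i)))"
| add: "sep_poly m f \<Longrightarrow> sep_poly m h \<Longrightarrow> sep_poly m (\<lambda>u. f u + h u)"

lemma sep_poly_0: "sep_poly m (\<lambda>u. 0)"
  using sep_poly.prod[of m "\<lambda>_ _. 0" 0] by (simp add: eventually_poly_def exI[of _ 0])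

lemma sep_poly_sum: "(\<And>j. j \<in> A \<Longrightarrow> sep_poly m (F j)) \<Longrightarrow> sep_poly m (\<lambda>u. \<Sum>j\<in>A. F j u)"
  by (induction A rule: infinite_finite_induct) (auto intro: sep_poly_0 sep_poly.add)

text \<open>
  A linear operator on sequences acts on a single factor of each product.
\<close>

lemma sep_poly_map_coordinate:
  assumes "i < m" and "sep_poly m f"
    and T: "\<And>g. eventually_poly g \<Longrightarrow> eventually_poly (T g)"
    and lin: "\<And>g h. T (\<lambda>x. g x + h x) = (\<lambda>x. T g x + T h x)" "\<And>c g. T (\<lambda>x. c * g x) = (\<lambda>x. c * T g x)"
  shows "sep_poly m (\<lambda>u. T (\<lambda>x. f (u(i := x))) (u i))"
  using assms(2)
proof induction
  case (prod g c)
  have split: "c * (\<Prod>j<m. h j (u j)) = c * (\<Prod>j\<in>{..<m} - {i}. h j (u j)) * h i (u i)"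
    for h :: "nat \<Rightarrow> nat \<Rightarrow> real" and u
    using prod.remove[of "{..<m}" i "\<lambda>j. h j (u j)"] \<open>i < m\<close> by (simp add: mult_ac)
  have "T (\<lambda>x. c * (\<Prod>j<m. g j ((u(i := x)) j))) (u i) = c * (\<Prod>j<m. (g(i := T (g i))) j (u j))" for u
  proof -
    have "(\<lambda>x. c * (\<Prod>j<m. g j ((u(i := x)) j))) = (\<lambda>x. c * (\<Prod>j\<in>{..<m} - {i}. g j (u j)) * g i x)"
      by (subst split) simp
    then show ?thesis by (subst split) (simp add: lin)
  qed
  then show ?case
    using sep_poly.prod[of m "g(i := T (g i))" c] prod T by simp
next
  case (add f h)
  then show ?case using sep_poly.add[OF add.IH] by (simp add: lin)
qed

lemma sep_poly_shift:
  assumes "sep_poly m f" "i < m"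
  shows "sep_poly m (\<lambda>u. if k \<le> u i then f (u(i := u i - k)) else 0)"
  by (rule sep_poly_map_coordinate[OF assms(2,1), of "\<lambda>g x. if k \<le> x then g (x - k) else 0"])
    (auto simp: eventually_poly_shift)

lemma sep_poly_partial_sums:
  assumes "sep_poly m f" "i < m"
  shows "sep_poly m (\<lambda>u. \<Sum>j\<le>u i. f (u(i := j)))"
  by (rule sep_poly_map_coordinate[OF assms(2,1), of "\<lambda>g x. \<Sum>j\<le>x. g j"])
    (auto simp: eventually_poly_partial_sums sum.distrib sum_distrib_left)

lemma sep_poly_eventually_polynomial:
  assumes "sep_poly m f"
  shows "\<exists>M q U. finite M \<and> M \<subseteq> {n. \<forall>i\<ge>m. n i = 0} \<and>
    (\<forall>u. (\<forall>i<m. U \<le> u i) \<longrightarrow> f u = (\<Sum>n\<in>M. q n * (\<Prod>i<m. real (u i) ^ n i)))"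
proof -
  have "\<exists>F U. is_mpoly m F \<and> (\<forall>u. (\<forall>i<m. U \<le> u i) \<longrightarrow> f u = F (\<lambda>i. real (u i)))"
    using assms
  proof induction
    case (prod g c)
    then obtain p N where pN: "\<And>i x. i < m \<Longrightarrow> N i \<le> x \<Longrightarrow> g i x = poly (p i) (real x)"
      unfolding eventually_poly_def by metis
    have "c * (\<Prod>i<m. g i (u i)) = c * (\<Prod>i<m. poly (p i) (real (u i)))" if "\<forall>i<m. Max (N ` {..<m}) \<le> u i" for u
    proof -
      have "N i \<le> u i" if "i < m" for i
        using Max_ge[of "N ` {..<m}" "N i"] that \<open>\<forall>i<m. Max (N ` {..<m}) \<le> u i\<close>
        by (meson finite_imageI finite_lessThan imageI le_trans lessThan_iff)
      then show ?thesis using pN by simp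
    qed
    then show ?case using is_mpoly_prod_poly[of m m c p] by blast
  next
    case (add f h)
    then obtain F U G V where "is_mpoly m F" "\<And>u. (\<forall>i<m. U \<le> u i) \<Longrightarrow> f u = F (\<lambda>i. real (u i))"
      "is_mpoly m G" "\<And>u. (\<forall>i<m. V \<le> u i) \<Longrightarrow> h u = G (\<lambda>i. real (u i))"
      by blast
    then show ?case
      by (intro exI[of _ "\<lambda>x. F x + G x"] exI[of _ "max U V"]) (auto intro: is_mpoly_add)
  qed
  then obtain F U where F: "is_mpoly m F" and f: "\<And>u. (\<forall>i<m. U \<le> u i) \<Longrightarrow> f u = F (\<lambda>i. real (u i))"
    by blast
  obtain M q where "finite M" "M \<subseteq> {n. \<forall>i\<ge>m. n i = 0}"
      and Fx: "\<And>x. F x = (\<Sum>n\<in>M. q n * (\<Prod>i<m. x i ^ n i))"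
    using F unfolding is_mpoly_def by blast
  then show ?thesis
    by (intro exI[of _ M] exI[of _ q] exI[of _ U] conjI allI impI) (simp_all add: f Fx)
qed

lemma poly_over_power_tendsto:
  assumes "degree (p::real poly) \<le> e"
  shows "(\<lambda>k. poly p (real k) / real k ^ e) \<longlonglongrightarrow> coeff p e"
proof -
  have "(\<lambda>k. coeff p i * (real k ^ i / real k ^ e)) \<longlonglongrightarrow> (if i = e then coeff p i else 0)" if "i \<le> e" for i
  proof (cases "i = e")
    case True
    have "\<forall>\<^sub>F k in sequentially. coeff p i * (real k ^ i / real k ^ e) = coeff p i"
      using eventually_gt_at_top[of 0] by eventually_elim (simp add: True)
    then show ?thesis using True by (simp add: tendsto_eventually)
  next
    case False
    then have "i < e" using that by simp
    have ev: "\<forall>\<^sub>F k in sequentially. coeff p i * (inverse (real k)) ^ (e - i) = coeff p i * (real k ^ i / real k ^ e)"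
      using eventually_gt_at_top[of 0]
    proof eventually_elim
      case (elim k)
      then show ?case using \<open>i < e\<close> 
        by (simp add: power_diff power_inverse field_simps)
    qed
    have "(\<lambda>k. coeff p i * (inverse (real k)) ^ (e - i)) \<longlonglongrightarrow> coeff p i * 0 ^ (e - i)"
      by (intro tendsto_intros lim_inverse_n)
    then show ?thesis using \<open>i < e\<close> False by (simp add: zero_power tendsto_cong[OF ev])
  qed
  then have "(\<lambda>k. \<Sum>i\<le>e. coeff p i * (real k ^ i / real k ^ e)) \<longlonglongrightarrow> (\<Sum>i\<le>e. if i = e then coeff p i else 0)"
    by (intro tendsto_sum) auto
  moreover have "poly p x = (\<Sum>i\<le>e. coeff p i * x ^ i)" for x
    unfolding poly_altdef using assms
    by (intro sum.mono_neutral_left) (auto simp: coeff_eq_0)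
  ultimately show ?thesis by (simp add: sum_divide_distrib)
qed

text \<open>
  If the degree \<open>e\<close> exceeded \<open>d\<close>, dividing by \<open>x\<^sup>e\<close> instead of \<open>x\<^sup>d\<close> would force the leading
  coefficient to be zero.
\<close>

lemma coeff_eq_growth_limit:
  assumes lim: "(\<lambda>k. poly (p::real poly) (real k) / real k ^ d) \<longlonglongrightarrow> L"
  shows "degree p \<le> d" "coeff p d = L"
proof -
  show deg: "degree p \<le> d"
  proof (rule ccontr)
    assume "\<not> degree p \<le> d"
    define e where "e = degree p"
    have e: "d < e" using \<open>\<not> degree p \<le> d\<close> by (simp add: e_def)
    have "(\<lambda>k. poly p (real k) / real k ^ d * (inverse (real k)) ^ (e - d)) \<longlonglongrightarrow> L * 0 ^ (e - d)"
      by (intro tendsto_intros lim lim_inverse_n)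
    moreover have "\<forall>\<^sub>F k in sequentially. poly p (real k) / real k ^ d * (inverse (real k)) ^ (e - d) = poly p (real k) / real k ^ e"
      using eventually_gt_at_top[of 0]
    proof eventually_elim
      case (elim k)
      then show ?case using e by (simp add: power_diff power_inverse field_simps)
    qed
    ultimately have "(\<lambda>k. poly p (real k) / real k ^ e) \<longlonglongrightarrow> 0"
      using e by (simp add: zero_power tendsto_cong)
    then have "coeff p e = 0"
      using poly_over_power_tendsto[of p e] LIMSEQ_unique e_def by blast
    then show False using e by (simp add: e_def)
  qed
  show "coeff p d = L"
    using poly_over_power_tendsto[OF deg] lim LIMSEQ_unique by blast
qed

text \<open>
  Along each ray \<open>k u\<close> the polynomial becomes univariate in \<open>k\<close>, with the homogeneous parts evaluated at
  \<open>u\<close> as coefficients. The growth rate therefore bounds the degree and identifies the leading form.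
\<close>

lemma leading_form_from_growth:
  assumes M: "finite M" "M \<subseteq> {n. \<forall>i\<ge>m. n i = 0}"
    and f: "\<And>u. (\<And>i. i < m \<Longrightarrow> U \<le> u i) \<Longrightarrow> f u = (\<Sum>n\<in>M. q n * (\<Prod>i<m. real (u i) ^ n i))"
    and lim: "\<And>u. (\<And>i. i < m \<Longrightarrow> 1 \<le> u i) \<Longrightarrow> (\<lambda>k. f (\<lambda>i. k * u i) / real k ^ d) \<longlonglongrightarrow> G u"
  shows "\<And>n :: nat \<Rightarrow> nat. n \<in> M \<Longrightarrow> d < (\<Sum>i<m. n i) \<Longrightarrow> q n = 0"
    and "\<And>u. (\<And>i. i < m \<Longrightarrow> 1 \<le> u i) \<Longrightarrow>
      G u = (\<Sum>n\<in>{n \<in> M. (\<Sum>i<m. n i) = d}. q n * (\<Prod>i<m. real (u i) ^ n i))"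
proof -
  define p where "p u = (\<Sum>n\<in>M. monom (q n * (\<Prod>i<m. real (u i) ^ n i)) (\<Sum>i<m. n i))" for u :: "nat \<Rightarrow> nat"
  have coeff: "coeff (p u) j = (\<Sum>n\<in>{n \<in> M. (\<Sum>i<m. n i) = j}. q n * (\<Prod>i<m. real (u i) ^ n i))" for u j
    using M(1) by (simp add: p_def coeff_sum coeff_monom sum.inter_filter)
  have "degree (p u) \<le> d \<and> coeff (p u) d = G u" if u: "\<And>i. i < m \<Longrightarrow> 1 \<le> u i" for u
  proof -
    have "f (\<lambda>i. k * u i) = poly (p u) (real k)" if "U \<le> k" for k
    proof -
      have ge: "U \<le> k * u i" if "i < m" for i
        using u[OF that] \<open>U \<le> k\<close> by (metis dual_order.trans mult.right_neutral mult_le_mono2)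
      have "(\<Prod>i<m. real (k * u i) ^ n i) = (\<Prod>i<m. real (u i) ^ n i) * real k ^ (\<Sum>i<m. n i)" for n
        by (simp add: power_mult_distrib prod.distrib power_sum)
      then show ?thesis using ge
        by (subst f) (auto simp: p_def poly_sum poly_monom mult.assoc)
    qed
    then have "\<forall>\<^sub>F k in sequentially. f (\<lambda>i. k * u i) / real k ^ d = poly (p u) (real k) / real k ^ d"
      by (auto simp: eventually_sequentially)
    then have "(\<lambda>k. poly (p u) (real k) / real k ^ d) \<longlonglongrightarrow> G u"
      using lim[of u, OF u] by (rule Lim_transform_eventually[rotated])
    then show ?thesis using coeff_eq_growth_limit by blast
  qed
  note pu = this
  show "q n = 0" if "n \<in> M" "d < (\<Sum>i<m. n i)" for n
  proof -
    let ?M = "{n' \<in> M. (\<Sum>i<m. n' i) = (\<Sum>i<m. n i)}"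
    have "finite ?M" "?M \<subseteq> {n. \<forall>i\<ge>m. n i = 0}" "n \<in> ?M" using M that by auto
    have "(\<Sum>n\<in>?M. q n * (\<Prod>i<m. real (u i) ^ n i)) = 0" if "\<And>i. i < m \<Longrightarrow> 1 \<le> u i" for u
      using pu[of u, OF that] \<open>d < _\<close> coeff[of u "\<Sum>i<m. n i"] coeff_eq_0[of "p u" "\<Sum>i<m. n i"] by linarith
    then have "\<forall>u. (\<forall>i<m. 1 \<le> u i) \<longrightarrow> (\<Sum>n\<in>?M. q n * (\<Prod>i<m. real (u i) ^ n i)) = 0" by blast
    then show ?thesis using monomial_sum_eq_0[of ?M m 1 q] M \<open>n \<in> ?M\<close> \<open>?M \<subseteq> _\<close> by simp
  qed
  show "G u = (\<Sum>n\<in>{n \<in> M. (\<Sum>i<m. n i) = d}. q n * (\<Prod>i<m. real (u i) ^ n i))"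
    if "\<And>i. i < m \<Longrightarrow> 1 \<le> u i" for u
    using pu[of u, OF that] coeff by simp
qed

section \<open>Counting sums of generators\<close>

definition supported_on :: "'a set \<Rightarrow> ('a \<Rightarrow> nat) set" where
  "supported_on A = {a. \<forall>j. j \<notin> A \<longrightarrow> a j = 0}"

definition downset :: "'a set \<Rightarrow> ('a \<Rightarrow> nat) set \<Rightarrow> bool" where
  "downset A S \<longleftrightarrow> S \<subseteq> supported_on A \<and> (\<forall>a\<in>S. \<forall>b. b \<le> a \<longrightarrow> b \<in> S)"

text \<open>
  Dickson's lemma in its sequential form: one coordinate at a time, pass to a monotone subsequence.
\<close>

lemma dickson_subsequence:
  fixes f :: "nat \<Rightarrow> 'a \<Rightarrow> nat"
  assumes "finite A"
  shows "\<exists>g :: nat \<Rightarrow> nat. strict_mono g \<and> (\<forall>j\<in>A. mono (\<lambda>n. f (g n) j))"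
  using assms
proof induction
  case empty
  then show ?case by (intro exI[of _ id]) (simp add: strict_mono_def)
next
  case (insert i A)
  then obtain g :: "nat \<Rightarrow> nat" where g: "strict_mono g" "\<And>j. j \<in> A \<Longrightarrow> mono (\<lambda>n. f (g n) j)"
    by blast
  obtain h :: "nat \<Rightarrow> nat" where h: "strict_mono h" "monoseq (\<lambda>n. f (g (h n)) i)"
    using seq_monosub[of "\<lambda>n. f (g n) i"] by blast
  have keep: "mono (\<lambda>n. f (g (h (l n))) j)" if "j \<in> A" "strict_mono l" for j l
    using g(2)[OF that(1)] strict_mono_o[OF h(1) that(2)]
    by (auto simp: mono_def o_def dest!: strict_mono_leD[of "\<lambda>x. h (l x)"])
  show ?case
  proof (cases "mono (\<lambda>n. f (g (h n)) i)")
    case True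
    then show ?thesis
      using keep[of _ id] strict_mono_o[OF g(1) h(1)]
      by (intro exI[of _ "g \<circ> h"]) (auto simp: strict_mono_def)
  next
    case False
    then have dec: "f (g (h n)) i \<le> f (g (h m)) i" if "m \<le> n" for m n
      using h(2) that unfolding monoseq_def mono_def by blast
    \<comment> \<open>a decreasing sequence of natural numbers is constant from the place where it is least\<close>
    obtain N where N: "\<And>n. f (g (h N)) i \<le> f (g (h n)) i"
      using ex_has_least_nat[of "\<lambda>_. True" _ "\<lambda>n. f (g (h n)) i"] by blast
    have const: "f (g (h (N + n))) i = f (g (h N)) i" for n
      using dec[of N "N + n"] N[of "N + n"] by simp
    have sm: "strict_mono (\<lambda>n. N + n)" by (simp add: strict_mono_def)
    show ?thesis
      using keep[OF _ sm] strict_mono_o[OF strict_mono_o[OF g(1) h(1)] sm]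
      by (intro exI[of _ "g \<circ> h \<circ> (\<lambda>n. N + n)"]) (auto simp: o_def const mono_def)
  qed
qed

text \<open>
  If the chain never became constant, there would be indices \<open>e\<^sub>0 \<le> e\<^sub>1 \<le> \<dots>\<close> and elements \<open>a\<^sub>n\<close> of \<open>S e\<^sub>n\<close>
  that are missing from \<open>S e\<^bsub>n+1\<^esub>\<close>. By Dickson's lemma \<open>a\<^sub>i \<le> a\<^sub>j\<close> for some \<open>i < j\<close>, and \<open>a\<^sub>j\<close> lies in
  \<open>S e\<^bsub>i+1\<^esub>\<close>, so \<open>a\<^sub>i\<close> does too.
\<close>

lemma downset_chain_stabilises:
  fixes S :: "nat \<Rightarrow> ('a \<Rightarrow> nat) set"
  assumes "finite A" and down: "\<And>k. downset A (S k)" and anti: "\<And>k l. k \<le> l \<Longrightarrow> S l \<subseteq> S k"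
  shows "\<exists>K. \<forall>k\<ge>K. S k = S K"
proof (rule ccontr)
  assume "\<not> ?thesis"
  then have "\<forall>K. \<exists>k. \<exists>a. K \<le> k \<and> a \<in> S K \<and> a \<notin> S k"
    using anti by blast
  then obtain h :: "nat \<Rightarrow> nat" and f where hf: "\<And>K. K \<le> h K" "\<And>K. f K \<in> S K" "\<And>K. f K \<notin> S (h K)"
    by metis
  define e where "e n = (h ^^ n) 0" for n
  have e_Suc: "e (Suc n) = h (e n)" for n by (simp add: e_def)
  have e_mono: "mono e"
    by (rule incseq_SucI) (simp add: e_Suc hf(1))
  obtain g :: "nat \<Rightarrow> nat" where g: "strict_mono g" "\<And>j. j \<in> A \<Longrightarrow> mono (\<lambda>n. f (e (g n)) j)"
    using dickson_subsequence[OF \<open>finite A\<close>, of "\<lambda>n. f (e n)"] by blast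
  have "f (e (g 0)) \<le> f (e (g 1))"
  proof (rule le_funI)
    fix j
    show "f (e (g 0)) j \<le> f (e (g 1)) j"
    proof (cases "j \<in> A")
      case True
      then show ?thesis using g(2) by (simp add: mono_def)
    next
      case False
      then show ?thesis
        using down[of "e (g 0)"] hf(2)[of "e (g 0)"] by (auto simp: downset_def supported_on_def)
    qed
  qed
  moreover have "Suc (g 0) \<le> g 1" using g(1) by (simp add: Suc_leI strict_mono_less)
  then have "S (e (g 1)) \<subseteq> S (h (e (g 0)))"
    using anti e_mono by (metis e_Suc monoD)
  then have "f (e (g 1)) \<in> S (h (e (g 0)))" using hf(2) by blast
  ultimately have "f (e (g 0)) \<in> S (h (e (g 0)))"
    using down unfolding downset_def by blast
  then show False using hf(3) by blast
qed

text \<open>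
  The multidegree of the exponent vector \<open>a\<close> when the generator \<open>j\<close> has degree \<open>e\<^bsub>c j\<^esub>\<close>.
\<close>

definition multideg :: "'a set \<Rightarrow> ('a \<Rightarrow> nat) \<Rightarrow> ('a \<Rightarrow> nat) \<Rightarrow> nat \<Rightarrow> nat" where
  "multideg A c a i = (\<Sum>j\<in>{j\<in>A. c j = i}. a j)"

lemma finite_multideg_fibre:
  assumes "finite A" and "c ` A \<subseteq> {..<m}"
  shows "finite {a \<in> supported_on A. \<forall>i<m. multideg A c a i = u i}"
proof (rule finite_subset)
  show "{a \<in> supported_on A. \<forall>i<m. multideg A c a i = u i}
      \<subseteq> {a. \<forall>j. (j \<in> A \<longrightarrow> a j \<in> {.. Max (u ` {..<m})}) \<and> (j \<notin> A \<longrightarrow> a j = 0)}"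
  proof (safe)
    fix a j assume a: "a \<in> supported_on A" "\<forall>i<m. multideg A c a i = u i" and j: "j \<in> A"
    have "c j < m" using assms(2) j by blast
    have "a j \<le> multideg A c a (c j)"
      unfolding multideg_def using assms(1) j by (intro member_le_sum) auto
    also have "\<dots> \<le> Max (u ` {..<m})"
      using a(2) \<open>c j < m\<close> by simp
    finally show "a j \<le> Max (u ` {..<m})" .
  qed (auto simp: supported_on_def)
  show "finite {a. \<forall>j. (j \<in> A \<longrightarrow> a j \<in> {.. Max (u ` {..<m})}) \<and> (j \<notin> A \<longrightarrow> a j = (0::nat))}"
    using assms(1) by (intro finite_set_of_finite_funs) auto
qed

text \<open>
  This is the combinatorial form of the Hilbert--Serre theorem. Cutting a down-closed set along one
  coordinate gives a decreasing chain of down-closed sets in one coordinate less, which is constant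
  from some \<open>K\<close> on. The slices below \<open>K\<close> contribute shifts of their counting functions, and those from
  \<open>K\<close> on contribute a shifted partial sum of one counting function.
\<close>

lemma sep_poly_count_downset:
  assumes "finite A" and "c ` A \<subseteq> {..<m}" and "downset A S"
  shows "sep_poly m (\<lambda>u. real (card {a \<in> S. \<forall>i<m. multideg A c a i = u i}))"
  using assms
proof (induction A arbitrary: S rule: finite_induct)
  case empty
  then have "S \<subseteq> {\<lambda>_. 0}" by (auto simp: downset_def supported_on_def)
  \<comment> \<open>without generators, the only exponent vector is zero, and it has degree zero\<close>
  then have S: "S = {} \<or> S = {\<lambda>_. 0}" by blast
  have "real (card {a \<in> S. \<forall>i<m. multideg {} c a i = u i})
      = of_bool (S \<noteq> {}) * (\<Prod>i<m. if u i = 0 then 1 else 0)" for u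
  proof -
    have "{a \<in> S. \<forall>i<m. multideg {} c a i = u i} = (if \<forall>i<m. u i = 0 then S else {})"
      by (auto simp: multideg_def)
    moreover have "(\<Prod>i<m. if u i = 0 then 1 else 0) = (if \<forall>i<m. u i = 0 then 1 else (0::real))"
      by (auto intro: prod_zero)
    ultimately show ?thesis using S by auto
  qed
  moreover have "eventually_poly (\<lambda>x. if x = 0 then 1 else 0)"
    unfolding eventually_poly_def by (rule exI[of _ 0], rule exI[of _ 1]) auto
  ultimately show ?case
    using sep_poly.prod[of m "\<lambda>i x. if x = 0 then 1 else 0" "of_bool (S \<noteq> {})"] by simp
next
  case (insert j A)
  define i where "i = c j"
  have i: "i < m" and cA: "c ` A \<subseteq> {..<m}" using insert.prems(1) by (auto simp: i_def)
  define T where "T k = {a \<in> supported_on A. a(j := k) \<in> S}" for k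
  have T_down: "downset A (T k)" for k
  proof -
    have "b \<in> T k" if "a \<in> T k" "b \<le> a" for a b
    proof -
      have "b \<in> supported_on A" using that by (auto simp: T_def supported_on_def le_fun_def) (metis le_zero_eq)
      moreover have "b(j := k) \<le> a(j := k)" using that(2) by (auto simp: le_fun_def)
      ultimately show ?thesis using that(1) insert.prems(2) by (auto simp: T_def downset_def)
    qed
    moreover have "T k \<subseteq> supported_on A" by (auto simp: T_def)
    ultimately show ?thesis unfolding downset_def by blast
  qed
  have T_anti: "T l \<subseteq> T k" if "k \<le> l" for k l
  proof
    fix a assume "a \<in> T l"
    moreover have "a(j := k) \<le> a(j := l)" using that by (auto simp: le_fun_def)
    ultimately show "a \<in> T k" using insert.prems(2) by (auto simp: T_def downset_def)
  qed
  obtain K where K: "\<And>k. K \<le> k \<Longrightarrow> T k = T K"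
    using downset_chain_stabilises[of A T, OF insert.hyps(1) T_down T_anti] by blast
  define N where "N k u = real (card {a \<in> T k. \<forall>i<m. multideg A c a i = u i})" for k u
  have N: "sep_poly m (N k)" for k
    unfolding N_def by (rule insert.IH[OF cA T_down])
  have deg: "multideg (insert j A) c (a(j := k)) i' = multideg A c a i' + (if i' = i then k else 0)" for a k i'
  proof -
    have "(\<Sum>l\<in>{l\<in>A. c l = i'}. (a(j := k)) l) = (\<Sum>l\<in>{l\<in>A. c l = i'}. a l)"
      using insert.hyps(2) by (intro sum.cong) auto
    moreover have "{l \<in> insert j A. c l = i'} = (if i' = i then insert j {l\<in>A. c l = i'} else {l\<in>A. c l = i'})"
      by (auto simp: i_def)
    ultimately show ?thesis
      using insert.hyps by (cases "i' = i") (simp_all add: multideg_def)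
  qed
  have count: "real (card {a \<in> S. \<forall>i<m. multideg (insert j A) c a i = u i}) = (\<Sum>k\<le>u i. N k (u(i := u i - k)))" for u
  proof -
    define F where "F k = {a \<in> T k. \<forall>i'<m. multideg A c a i' = (u(i := u i - k)) i'}" for k
    have fin: "finite (F k)" for k
      by (rule finite_subset[OF _ finite_multideg_fibre[OF insert.hyps(1) cA, of "u(i := u i - k)"]])
        (auto simp: F_def T_def)
    have "{a \<in> S. \<forall>i<m. multideg (insert j A) c a i = u i} = (\<lambda>(k, a). a(j := k)) ` Sigma {..u i} F"
    proof (intro equalityI subsetI)
      fix a assume a: "a \<in> {a \<in> S. \<forall>i<m. multideg (insert j A) c a i = u i}"
      define b where "b = a(j := 0)"
      have ab: "b(j := a j) = a" by (simp add: b_def)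
      have degb: "multideg A c b i' + (if i' = i then a j else 0) = u i'" if "i' < m" for i'
        using a that deg[of b "a j" i'] unfolding ab by simp
      have "a j \<le> u i" using degb[OF i] by simp
      moreover have "b \<in> T (a j)"
        using a insert.prems(2) ab by (auto simp: T_def b_def downset_def supported_on_def)
      moreover have "multideg A c b i' = (u(i := u i - a j)) i'" if "i' < m" for i'
        using degb[OF that] by auto
      ultimately have "(a j, b) \<in> Sigma {..u i} F" by (auto simp: F_def)
      then show "a \<in> (\<lambda>(k, a). a(j := k)) ` Sigma {..u i} F"
        using ab by (intro image_eqI[of _ _ "(a j, b)"]) auto
    next
      fix a assume "a \<in> (\<lambda>(k, a). a(j := k)) ` Sigma {..u i} F"
      then show "a \<in> {a \<in> S. \<forall>i<m. multideg (insert j A) c a i = u i}"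
        by (auto simp: F_def T_def deg)
    qed
    moreover have "inj_on (\<lambda>(k, a). a(j := k)) (Sigma {..u i} F)"
    proof (rule inj_on_inverseI[where g = "\<lambda>a. (a j, a(j := 0))"])
      fix x assume "x \<in> Sigma {..u i} F"
      then show "(\<lambda>a. (a j, a(j := 0))) ((\<lambda>(k, a). a(j := k)) x) = x"
        using insert.hyps(2) by (auto simp: F_def T_def supported_on_def fun_upd_idem)
    qed
    ultimately show ?thesis
      using fin by (simp add: card_image N_def F_def)
  qed
  have tail: "(\<Sum>k\<le>u i. N k (u(i := u i - k)))
      = (\<Sum>k<K. if k \<le> u i then N k (u(i := u i - k)) else 0)
        + (if K \<le> u i then (\<Sum>l\<le>(u(i := u i - K)) i. N K ((u(i := u i - K))(i := l))) else 0)" for u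
  proof -
    have "{..u i} = {k. k < K \<and> k \<le> u i} \<union> {K..u i}" by auto
    then have "(\<Sum>k\<le>u i. N k (u(i := u i - k)))
        = (\<Sum>k\<in>{k. k < K \<and> k \<le> u i}. N k (u(i := u i - k))) + (\<Sum>k=K..u i. N k (u(i := u i - k)))"
      by (simp add: sum.union_disjoint[symmetric] disjoint_iff)
    also have "(\<Sum>k\<in>{k. k < K \<and> k \<le> u i}. N k (u(i := u i - k))) = (\<Sum>k<K. if k \<le> u i then N k (u(i := u i - k)) else 0)"
      by (rule sum.mono_neutral_cong_left) auto
    also have "(\<Sum>k=K..u i. N k (u(i := u i - k))) = (\<Sum>k=K..u i. N K (u(i := u i - k)))"
    proof (rule sum.cong[OF refl])
      fix k assume "k \<in> {K..u i}"
      then have "T k = T K" by (intro K) simp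
      then show "N k (u(i := u i - k)) = N K (u(i := u i - k))" by (simp only: N_def)
    qed
    also have "\<dots> = (if K \<le> u i then (\<Sum>l\<le>u i - K. N K (u(i := l))) else 0)"
    proof (cases "K \<le> u i")
      case True
      have "(\<Sum>k=K..u i. N K (u(i := u i - k))) = (\<Sum>l\<le>u i - K. N K (u(i := l)))"
        by (rule sum.reindex_bij_witness[of _ "\<lambda>l. u i - l" "\<lambda>k. u i - k"]) (use True in auto)
      then show ?thesis using True by simp
    qed simp
    finally show ?thesis by (simp only: fun_upd_same fun_upd_upd)
  qed
  have "sep_poly m (\<lambda>u. \<Sum>k<K. if k \<le> u i then N k (u(i := u i - k)) else 0)"
    by (rule sep_poly_sum) (rule sep_poly_shift[OF N i])
  from sep_poly.add[OF this sep_poly_shift[OF sep_poly_partial_sums[OF N[of K] i] i]]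
  show ?case unfolding count tail .
qed


lemma multideg_add: "multideg A c (\<lambda>j. a j + b j) i = multideg A c a i + multideg A c b i"
  by (simp add: multideg_def sum.distrib)

text \<open>
  The lexicographic order on exponent vectors, imported from finitely supported functions on the
  natural numbers, where it is compatible with addition.
\<close>

lemma additive_linear_order_on_supported:
  assumes "finite A"
  obtains \<psi> :: "('a \<Rightarrow> nat) \<Rightarrow> (nat \<Rightarrow>\<^sub>0 nat)"
  where "\<And>a b. \<psi> (\<lambda>j. a j + b j) = \<psi> a + \<psi> b" and "inj_on \<psi> (supported_on A)"
proof -
  obtain idx :: "'a \<Rightarrow> nat" where idx: "inj_on idx A"
    using finite_imp_inj_to_nat_seg[OF assms] by blast
  define \<psi> where "\<psi> a = (\<Sum>j\<in>A. single (idx j) (a j))" for a :: "'a \<Rightarrow> nat"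
  have lookup: "lookup (\<psi> a) (idx j) = a j" if "j \<in> A" for a j
  proof -
    have "lookup (\<psi> a) (idx j) = (\<Sum>l\<in>A. if l = j then a l else 0)"
      unfolding \<psi>_def lookup_sum using idx that
      by (intro sum.cong) (auto simp: lookup_single when_def inj_on_eq_iff)
    then show ?thesis using assms that by simp
  qed
  show ?thesis
  proof
    show "\<psi> (\<lambda>j. a j + b j) = \<psi> a + \<psi> b" for a b
      by (simp add: \<psi>_def single_add sum.distrib)
    show "inj_on \<psi> (supported_on A)"
    proof (rule inj_onI)
      fix a b assume ab: "a \<in> supported_on A" "b \<in> supported_on A" "\<psi> a = \<psi> b"
      show "a = b"
      proof
        fix j
        show "a j = b j"
          using ab lookup[of j a] lookup[of j b] by (cases "j \<in> A") (auto simp: supported_on_def)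
      qed
    qed
  qed
qed

text \<open>
  Khovanskii's theorem on the growth of sumsets, in the proof of Nathanson and Ruzsa, with an
  additional exceptional set \<open>bad\<close> that is stable under adding generators. Among all representations
  of a point choose the least one, first by \<open>w\<close> and then lexicographically by \<open>a\<close>. For fixed \<open>w\<close> the
  chosen \<open>a\<close> form a down-closed set: a smaller representation of a part would give a smaller
  representation of the whole. The points are thus counted by finitely many down-closed sets.
\<close>

lemma sep_poly_count_sums:
  fixes \<phi> :: "('a \<Rightarrow> nat) \<Rightarrow> 'g::comm_monoid_add"
  assumes A: "finite A" "c ` A \<subseteq> {..<m}" and W: "finite W"
    and add: "\<And>a b. \<phi> (\<lambda>j. a j + b j) = \<phi> a + \<phi> b"
    and bad: "\<And>u x b. bad u x \<Longrightarrow> b \<in> supported_on A \<Longrightarrow> bad (\<lambda>i. u i + multideg A c b i) (x + \<phi> b)"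
  shows "sep_poly m (\<lambda>u. real (card {w + \<phi> a | w a. w \<in> W \<and> a \<in> supported_on A \<and>
    (\<forall>i<m. multideg A c a i = u i) \<and> \<not> bad (multideg A c a) (w + \<phi> a)}))"
proof -
  obtain \<psi> :: "('a \<Rightarrow> nat) \<Rightarrow> (nat \<Rightarrow>\<^sub>0 nat)"
    where \<psi>_add: "\<And>a b. \<psi> (\<lambda>j. a j + b j) = \<psi> a + \<psi> b" and \<psi>_inj: "inj_on \<psi> (supported_on A)"
    using additive_linear_order_on_supported[OF A(1)] by blast
  obtain \<rho> :: "'g \<Rightarrow> nat" where \<rho>: "inj_on \<rho> W"
    using finite_imp_inj_to_nat_seg[OF W] by blast
  define same where "same w a w' a' \<longleftrightarrow> w' \<in> W \<and> a' \<in> supported_on A \<and>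
    multideg A c a' = multideg A c a \<and> w' + \<phi> a' = w + \<phi> a" for w a w' a'
  define S where "S w = {a \<in> supported_on A. \<not> bad (multideg A c a) (w + \<phi> a) \<and>
    (\<forall>w' a'. same w a w' a' \<longrightarrow> \<rho> w < \<rho> w' \<or> w' = w \<and> \<psi> a \<le> \<psi> a')}" for w
  have S_down: "downset A (S w)" for w
  proof -
    have "b \<in> S w" if a: "a \<in> S w" and le: "b \<le> a" for a b
    proof -
      define e where "e j = a j - b j" for j
      have a_eq: "(\<lambda>j. b j + e j) = a" using le by (auto simp: e_def le_fun_def)
      have e: "e \<in> supported_on A" and b: "b \<in> supported_on A"
        using a le by (auto simp: S_def supported_on_def e_def le_fun_def) (metis le_zero_eq)
      have deg: "multideg A c a = (\<lambda>i. multideg A c b i + multideg A c e i)"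
        unfolding a_eq[symmetric] by (rule ext) (rule multideg_add)
      have phi: "w + \<phi> a = w + \<phi> b + \<phi> e"
        unfolding a_eq[symmetric] by (simp add: add add.assoc)
      have "\<not> bad (multideg A c b) (w + \<phi> b)"
        using a bad[OF _ e, of "multideg A c b" "w + \<phi> b"] deg phi by (auto simp: S_def)
      moreover have "\<rho> w < \<rho> w' \<or> w' = w \<and> \<psi> b \<le> \<psi> b'" if s: "same w b w' b'" for w' b'
      proof -
        have b': "w' \<in> W" "b' \<in> supported_on A" "multideg A c b' = multideg A c b" "w' + \<phi> b' = w + \<phi> b"
          using s by (auto simp: same_def)
        have "multideg A c (\<lambda>j. b' j + e j) = multideg A c a"
          unfolding deg by (rule ext) (simp add: multideg_add b'(3))
        moreover have "w' + \<phi> (\<lambda>j. b' j + e j) = w + \<phi> a"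
          by (simp add: phi add add.assoc[symmetric] b'(4))
        moreover have "(\<lambda>j. b' j + e j) \<in> supported_on A"
          using b'(2) e by (auto simp: supported_on_def)
        ultimately have "same w a w' (\<lambda>j. b' j + e j)" using b'(1) by (simp add: same_def)
        then have "\<rho> w < \<rho> w' \<or> w' = w \<and> \<psi> a \<le> \<psi> (\<lambda>j. b' j + e j)"
          using a unfolding S_def by blast
        then show ?thesis unfolding a_eq[symmetric] \<psi>_add by simp
      qed
      ultimately show ?thesis using b by (simp add: S_def)
    qed
    then show ?thesis unfolding downset_def S_def by blast
  qed
  define F where "F u w = {a \<in> S w. \<forall>i<m. multideg A c a i = u i}" for u w
  have finF: "finite (F u w)" for u w
    by (rule finite_subset[OF _ finite_multideg_fibre[OF A, of u]]) (auto simp: F_def S_def)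
  have deg_eq: "multideg A c a = multideg A c a'"
    if "\<forall>i<m. multideg A c a i = u i" "\<forall>i<m. multideg A c a' i = u i" for a a' u
  proof
    fix i
    show "multideg A c a i = multideg A c a' i"
    proof (cases "i < m")
      case False
      then have none: "{j \<in> A. c j = i} = {}" using A(2) by auto
      show ?thesis by (simp only: multideg_def none sum.empty)
    qed (use that in simp)
  qed
  have "{w + \<phi> a | w a. w \<in> W \<and> a \<in> supported_on A \<and> (\<forall>i<m. multideg A c a i = u i) \<and>
      \<not> bad (multideg A c a) (w + \<phi> a)} = (\<lambda>(w, a). w + \<phi> a) ` Sigma W (F u)" (is "?L = ?R") for u
  proof (intro equalityI subsetI)
    fix x assume "x \<in> ?L"
    then obtain w0 a0 where 0: "x = w0 + \<phi> a0" "w0 \<in> W" "a0 \<in> supported_on A"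
      "\<forall>i<m. multideg A c a0 i = u i" "\<not> bad (multideg A c a0) x" by blast
    \<comment> \<open>the least representation: first minimise \<open>w\<close>, then \<open>a\<close> among the representations with that \<open>w\<close>\<close>
    define W' where "W' = {w. \<exists>a. same w0 a0 w a}"
    have "W' \<subseteq> W" by (auto simp: W'_def same_def)
    then have "finite W'" using W finite_subset by blast
    moreover have "w0 \<in> W'" using 0 by (auto simp: W'_def same_def)
    ultimately obtain w where w: "w \<in> W'" "\<And>w'. w' \<in> W' \<Longrightarrow> \<rho> w \<le> \<rho> w'"
      using arg_min_if_finite(1)[of W' \<rho>] arg_min_if_finite(2)[of W' \<rho>] by (metis empty_iff not_le)
    define B where "B = {a. same w0 a0 w a}"
    have "finite B"
      by (rule finite_subset[OF _ finite_multideg_fibre[OF A, of u]]) (use 0 in \<open>auto simp: B_def same_def\<close>)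
    moreover have "B \<noteq> {}" using w(1) by (auto simp: B_def W'_def)
    ultimately obtain a where a: "a \<in> B" "\<And>a'. a' \<in> B \<Longrightarrow> \<psi> a \<le> \<psi> a'"
      using arg_min_if_finite(1)[of B \<psi>] arg_min_if_finite(2)[of B \<psi>] by (metis not_le)
    have wa: "w \<in> W" "a \<in> supported_on A" "multideg A c a = multideg A c a0" "w + \<phi> a = x"
      using a(1) 0(1) by (auto simp: B_def same_def)
    have "\<rho> w < \<rho> w' \<or> w' = w \<and> \<psi> a \<le> \<psi> a'" if "same w a w' a'" for w' a'
    proof -
      have s: "same w0 a0 w' a'" using that wa 0(1) by (simp add: same_def)
      then have "\<rho> w \<le> \<rho> w'" using w(2) by (auto simp: W'_def)
      moreover have "w' \<in> W" using s by (simp add: same_def)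
      moreover have "\<psi> a \<le> \<psi> a'" if "w' = w"
        using a(2) s that by (simp add: B_def)
      ultimately show ?thesis using inj_onD[OF \<rho>, of w w'] wa(1) by (cases "\<rho> w = \<rho> w'") auto
    qed
    then have "a \<in> F u w" using 0 wa by (auto simp: F_def S_def)
    then show "x \<in> ?R" using wa by (intro image_eqI[of _ _ "(w, a)"]) auto
  next
    fix x assume "x \<in> ?R"
    then obtain w a where "x = w + \<phi> a" "w \<in> W" "a \<in> F u w" by auto
    then show "x \<in> ?L" unfolding F_def S_def by blast
  qed
  moreover have "inj_on (\<lambda>(w, a). w + \<phi> a) (Sigma W (F u))" for u
  proof (rule inj_onI, safe)
    fix w a w' a' assume *: "w \<in> W" "a \<in> F u w" "w' \<in> W" "a' \<in> F u w'" "w + \<phi> a = w' + \<phi> a'"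
    have "multideg A c a = multideg A c a'" using * by (intro deg_eq[of _ u]) (auto simp: F_def)
    then have "same w a w' a'" "same w' a' w a" using * by (auto simp: same_def F_def S_def)
    then have "\<rho> w < \<rho> w' \<or> w' = w \<and> \<psi> a \<le> \<psi> a'" "\<rho> w' < \<rho> w \<or> w = w' \<and> \<psi> a' \<le> \<psi> a"
      using *(2,4) unfolding F_def S_def by blast+
    then have "w = w' \<and> \<psi> a = \<psi> a'" by auto
    then show "w = w'" "a = a'"
      using inj_onD[OF \<psi>_inj, of a a'] *(2,4) by (auto simp: F_def S_def)
  qed
  ultimately have "real (card {w + \<phi> a | w a. w \<in> W \<and> a \<in> supported_on A \<and> (\<forall>i<m. multideg A c a i = u i) \<and>
      \<not> bad (multideg A c a) (w + \<phi> a)}) = (\<Sum>w\<in>W. real (card (F u w)))" for u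
    using W finF by (simp add: card_image)
  moreover have "sep_poly m (\<lambda>u. \<Sum>w\<in>W. real (card (F u w)))"
    unfolding F_def by (intro sep_poly_sum sep_poly_count_downset[OF A] S_down)
  ultimately show ?thesis by simp
qed

section \<open>Minkowski combinations\<close>

lemma minkowski_comb_0: "minkowski_comb 0 Q t = {0}"
  by (auto simp: minkowski_comb_def)

lemma minkowski_comb_Suc:
  "minkowski_comb (Suc m) Q t = {x + y | x y. x \<in> minkowski_comb m Q t \<and> y \<in> (*\<^sub>R) (t m) ` Q m}"
proof (intro equalityI subsetI)
  fix z assume "z \<in> minkowski_comb (Suc m) Q t"
  then obtain x where "\<forall>i<Suc m. x i \<in> Q i" "z = (\<Sum>i<Suc m. t i *\<^sub>R x i)"
    unfolding minkowski_comb_def by blast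
  then show "z \<in> {x + y | x y. x \<in> minkowski_comb m Q t \<and> y \<in> (*\<^sub>R) (t m) ` Q m}"
    unfolding minkowski_comb_def by fastforce
next
  fix z assume "z \<in> {x + y | x y. x \<in> minkowski_comb m Q t \<and> y \<in> (*\<^sub>R) (t m) ` Q m}"
  then obtain x y where z: "\<forall>i<m. x i \<in> Q i" "y \<in> Q m" "z = (\<Sum>i<m. t i *\<^sub>R x i) + t m *\<^sub>R y"
    unfolding minkowski_comb_def by blast
  have "z = (\<Sum>i<Suc m. t i *\<^sub>R (x(m := y)) i)" using z(3) by simp
  moreover have "\<forall>i<Suc m. (x(m := y)) i \<in> Q i" using z by (simp add: less_Suc_eq)
  ultimately show "z \<in> minkowski_comb (Suc m) Q t"
    unfolding minkowski_comb_def by blast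
qed

lemma minkowski_comb_cong:
  assumes "\<And>i. i < m \<Longrightarrow> Q i = Q' i" and "\<And>i. i < m \<Longrightarrow> t i = t' i"
  shows "minkowski_comb m Q t = minkowski_comb m Q' t'"
proof -
  have "(\<Sum>i<m. t i *\<^sub>R x i) = (\<Sum>i<m. t' i *\<^sub>R x i)" for x :: "nat \<Rightarrow> 'a"
    using assms(2) by (intro sum.cong) auto
  moreover have "(\<forall>i<m. x i \<in> Q i) \<longleftrightarrow> (\<forall>i<m. x i \<in> Q' i)" for x using assms(1) by auto
  ultimately show ?thesis unfolding minkowski_comb_def by simp
qed

lemma minkowski_comb_scale:
  "minkowski_comb m Q (\<lambda>i. k * t i) = (*\<^sub>R) k ` minkowski_comb m Q t"
proof -
  have "(\<Sum>i<m. (k * t i) *\<^sub>R x i) = k *\<^sub>R (\<Sum>i<m. t i *\<^sub>R x i)" for x :: "nat \<Rightarrow> 'a"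
    by (simp add: scaleR_sum_right)
  then show ?thesis unfolding minkowski_comb_def image_def by auto
qed

lemma compact_minkowski_comb:
  fixes Q :: "nat \<Rightarrow> 'a::real_normed_vector set"
  assumes "\<And>i. i < m \<Longrightarrow> compact (Q i)"
  shows "compact (minkowski_comb m Q t)"
  using assms
proof (induction m)
  case (Suc m)
  then have "compact ((*\<^sub>R) (t m) ` Q m)" using compact_scaling[of "Q m" "t m"] by simp
  then show ?case unfolding minkowski_comb_Suc using Suc by (intro compact_sums) auto
qed (simp add: minkowski_comb_0)

lemma convex_minkowski_comb:
  assumes "\<And>i. i < m \<Longrightarrow> convex (Q i)"
  shows "convex (minkowski_comb m Q t)"
  using assms
proof (induction m)
  case (Suc m)
  have "{x + y | x y. x \<in> minkowski_comb m Q t \<and> y \<in> (*\<^sub>R) (t m) ` Q m}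
      = (\<Union>x\<in>minkowski_comb m Q t. \<Union>y\<in>(*\<^sub>R) (t m) ` Q m. {x + y})" by blast
  then show ?case unfolding minkowski_comb_Suc using Suc
    by (simp only:) (intro convex_sums convex_scaling, auto)
qed (simp add: minkowski_comb_0)

lemma measure_minkowski_comb_scale:
  fixes Q :: "nat \<Rightarrow> (real ^ 'n) set"
  shows "measure lebesgue (minkowski_comb m Q (\<lambda>i. k * t i))
    = \<bar>k\<bar> ^ CARD('n) * measure lebesgue (minkowski_comb m Q t)"
  using measure_lebesgue_affine[of k 0 "minkowski_comb m Q t"]
  by (simp add: minkowski_comb_scale)

text \<open>
  With \<open>q\<^sub>i \<in> Q\<^sub>i\<close>, convexity gives \<open>t\<^sub>i Q\<^sub>i + (s\<^sub>i - t\<^sub>i) q\<^sub>i \<subseteq> s\<^sub>i Q\<^sub>i\<close>, so a translate of the smaller combination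
  lies in the larger one.
\<close>

lemma measure_minkowski_comb_mono:
  fixes Q :: "nat \<Rightarrow> (real ^ 'n) set"
  assumes Q: "\<And>i. i < m \<Longrightarrow> compact (Q i) \<and> convex (Q i) \<and> Q i \<noteq> {}"
    and t: "\<And>i. i < m \<Longrightarrow> 0 \<le> t i \<and> t i \<le> s i"
  shows "measure lebesgue (minkowski_comb m Q t) \<le> measure lebesgue (minkowski_comb m Q s)"
proof -
  define q where "q i = (SOME x. x \<in> Q i)" for i
  have q: "q i \<in> Q i" if "i < m" for i using Q[OF that] by (simp add: q_def some_in_eq)
  define a where "a = (\<Sum>i<m. (s i - t i) *\<^sub>R q i)"
  have "(+) a ` minkowski_comb m Q t \<subseteq> minkowski_comb m Q s"
  proof (rule image_subsetI)
    fix z assume "z \<in> minkowski_comb m Q t"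
    then obtain x where x: "\<forall>i<m. x i \<in> Q i" "z = (\<Sum>i<m. t i *\<^sub>R x i)"
      unfolding minkowski_comb_def by blast
    have "\<exists>y\<in>Q i. t i *\<^sub>R x i + (s i - t i) *\<^sub>R q i = s i *\<^sub>R y" if i: "i < m" for i
    proof (cases "s i = 0")
      case True
      then show ?thesis using t[OF i] q[OF i] by auto
    next
      case False
      then have s: "s i > 0" using t[OF i] by linarith
      define y where "y = (t i / s i) *\<^sub>R x i + ((s i - t i) / s i) *\<^sub>R q i"
      have "y \<in> Q i"
        unfolding y_def using Q[OF i] x(1) i q[OF i] t[OF i] s
        by (intro convexD) (auto simp: diff_divide_distrib)
      moreover have "t i *\<^sub>R x i + (s i - t i) *\<^sub>R q i = s i *\<^sub>R y"
        using s by (simp add: y_def scaleR_add_right)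
      ultimately show ?thesis by blast
    qed
    then obtain y where y: "\<And>i. i < m \<Longrightarrow> y i \<in> Q i \<and> t i *\<^sub>R x i + (s i - t i) *\<^sub>R q i = s i *\<^sub>R y i"
      by metis
    have "a + z = (\<Sum>i<m. s i *\<^sub>R y i)"
      unfolding a_def x(2) sum.distrib[symmetric] using y by (intro sum.cong) (auto simp: add.commute)
    then show "a + z \<in> minkowski_comb m Q s"
      using y unfolding minkowski_comb_def by blast
  qed
  moreover have "compact (minkowski_comb m Q s)" "compact (minkowski_comb m Q t)"
    using Q by (auto intro: compact_minkowski_comb)
  then have "minkowski_comb m Q s \<in> lmeasurable" "(+) a ` minkowski_comb m Q t \<in> lmeasurable"
    by (auto intro: lmeasurable_compact compact_translation)
  ultimately have "measure lebesgue ((+) a ` minkowski_comb m Q t) \<le> measure lebesgue (minkowski_comb m Q s)"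
    by (intro measure_mono_fmeasurable) auto
  then show ?thesis by (simp only: measure_translation)
qed

text \<open>
  Continuity from above is all that is needed. The bodies stay within a vanishing distance of the
  limit body, whose frontier is negligible, so their volumes are eventually not much larger; by
  monotonicity they are never smaller.
\<close>

lemma measure_minkowski_comb_tendsto:
  fixes Q :: "nat \<Rightarrow> (real ^ 'n) set"
  assumes Q: "\<And>i. i < m \<Longrightarrow> compact (Q i) \<and> convex (Q i) \<and> Q i \<noteq> {}"
    and t: "\<And>i k. i < m \<Longrightarrow> 0 \<le> t i \<and> t i \<le> s k i"
    and lim: "\<And>i. i < m \<Longrightarrow> (\<lambda>k. s k i) \<longlonglongrightarrow> t i"
  shows "(\<lambda>k. measure lebesgue (minkowski_comb m Q (s k))) \<longlonglongrightarrow> measure lebesgue (minkowski_comb m Q t)"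
proof (rule tendstoI)
  fix e :: real assume "e > 0"
  let ?K = "minkowski_comb m Q t"
  have cK: "compact ?K" "convex ?K" using Q by (auto intro: compact_minkowski_comb convex_minkowski_comb)
  obtain d where d: "d > 0" "\<And>T. \<lbrakk>T \<in> lmeasurable; \<And>y. y \<in> T \<Longrightarrow> \<exists>x. x \<in> ?K \<and> dist x y < d\<rbrakk>
      \<Longrightarrow> measure lebesgue T < measure lebesgue ?K + e"
    using measure_semicontinuous_with_hausdist_explicit[OF compact_imp_bounded[OF cK(1)]
        negligible_convex_frontier[OF cK(2)] \<open>e > 0\<close>] by blast
  have "bounded (\<Union>i<m. Q i)" using Q by (intro bounded_UN) (auto intro: compact_imp_bounded)
  then obtain B where B: "\<And>x i. i < m \<Longrightarrow> x \<in> Q i \<Longrightarrow> norm x \<le> B"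
    unfolding bounded_iff by blast
  have "(\<lambda>k. \<Sum>i<m. (s k i - t i) * B) \<longlonglongrightarrow> (\<Sum>i<m. (t i - t i) * B)"
    using lim by (intro tendsto_intros) auto
  then have "\<forall>\<^sub>F k in sequentially. (\<Sum>i<m. (s k i - t i) * B) < d"
    using d(1) by (intro order_tendstoD(2)) auto
  then show "\<forall>\<^sub>F k in sequentially. dist (measure lebesgue (minkowski_comb m Q (s k))) (measure lebesgue ?K) < e"
  proof eventually_elim
    case (elim k)
    have "\<exists>x. x \<in> ?K \<and> dist x y < d" if "y \<in> minkowski_comb m Q (s k)" for y
    proof -
      obtain x where x: "\<forall>i<m. x i \<in> Q i" "y = (\<Sum>i<m. s k i *\<^sub>R x i)"
        using \<open>y \<in> minkowski_comb m Q (s k)\<close> unfolding minkowski_comb_def by blast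
      have "dist (\<Sum>i<m. t i *\<^sub>R x i) y = norm (\<Sum>i<m. (s k i - t i) *\<^sub>R x i)"
        by (simp add: x(2) dist_norm norm_minus_commute sum_subtractf scaleR_diff_left)
      also have "\<dots> \<le> (\<Sum>i<m. norm ((s k i - t i) *\<^sub>R x i))" by (rule norm_sum)
      also have "\<dots> \<le> (\<Sum>i<m. (s k i - t i) * B)"
        using t B x(1) by (intro sum_mono) (auto intro!: mult_mono)
      also have "\<dots> < d" by (rule elim)
      finally show ?thesis using x(1) unfolding minkowski_comb_def by blast
    qed
    moreover have "minkowski_comb m Q (s k) \<in> lmeasurable"
      using Q by (intro lmeasurable_compact compact_minkowski_comb) auto
    ultimately have "measure lebesgue (minkowski_comb m Q (s k)) < measure lebesgue ?K + e"
      using d(2) by blast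
    moreover have "measure lebesgue ?K \<le> measure lebesgue (minkowski_comb m Q (s k))"
      using Q t by (intro measure_minkowski_comb_mono) auto
    ultimately show ?case by (simp add: dist_real_def)
  qed
qed

section \<open>Lattice points and unit cubes\<close>

definition vec_of :: "('n::finite \<Rightarrow>\<^sub>0 nat) \<Rightarrow> real ^ 'n" where
  "vec_of v = (\<chi> i. real (lookup v i))"

lemma vec_of_nth [simp]: "vec_of v $ i = real (lookup v i)"
  by (simp add: vec_of_def)

lemma inj_vec_of: "inj vec_of"
  by (rule injI) (auto intro!: poly_mapping_eqI simp: vec_eq_iff)

lemma vec_of_add: "vec_of (v + w) = vec_of v + vec_of w"
  by (simp add: vec_eq_iff lookup_add)

definition unit_cubes :: "('n::finite \<Rightarrow>\<^sub>0 nat) set \<Rightarrow> (real ^ 'n) set" where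
  "unit_cubes X = {z. \<exists>x\<in>X. \<forall>l. real (lookup x l) \<le> z $ l \<and> z $ l < real (lookup x l) + 1}"

lemma unit_cubes_unique:
  fixes z :: "real ^ 'n"
  assumes "\<forall>l. real (lookup x l) \<le> z $ l \<and> z $ l < real (lookup x l) + 1"
    and "\<forall>l. real (lookup y l) \<le> z $ l \<and> z $ l < real (lookup y l) + 1"
  shows "x = y"
proof (rule poly_mapping_eqI)
  fix l
  have "real (lookup x l) < real (lookup y l) + 1"
       "real (lookup y l) < real (lookup x l) + 1"
    using assms by (meson le_less_trans)+
  then show "lookup x l = lookup y l" by linarith
qed

lemma measure_unit_cube:
  fixes x :: "'n::finite \<Rightarrow>\<^sub>0 nat"
  shows "unit_cubes {x} \<in> lmeasurable" "measure lebesgue (unit_cubes {x}) = 1"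
proof -
  let ?a = "vec_of x" and ?b = "vec_of x + (\<chi> i. 1)"
  have "box ?a ?b \<subseteq> unit_cubes {x}" "unit_cubes {x} \<subseteq> cbox ?a ?b"
    by (auto simp: unit_cubes_def mem_box_cart less_imp_le)
  then have neg: "negligible (sym_diff (cbox ?a ?b) (unit_cubes {x}))"
    by (intro negligible_subset[OF negligible_frontier_interval[of ?a ?b]]) auto
  show "unit_cubes {x} \<in> lmeasurable"
    using lmeasurable_negligible_symdiff[OF _ neg] lmeasurable_cbox by blast
  have "cbox ?a ?b \<noteq> {}" by (auto simp: interval_ne_empty_cart)
  then have "measure lebesgue (cbox ?a ?b) = 1"
    by (subst measure_completion) (auto simp: content_cbox_cart)
  then show "measure lebesgue (unit_cubes {x}) = 1"
    using measure_negligible_symdiff[OF lmeasurable_cbox neg] by simp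
qed

lemma measure_unit_cubes:
  assumes "finite X"
  shows "unit_cubes X \<in> lmeasurable \<and> measure lebesgue (unit_cubes X) = real (card X)"
  using assms
proof induction
  case empty
  then show ?case by (simp add: unit_cubes_def)
next
  case (insert x X)
  have eq: "unit_cubes (insert x X) = unit_cubes {x} \<union> unit_cubes X"
    by (auto simp: unit_cubes_def)
  have disj: "unit_cubes {x} \<inter> unit_cubes X = {}"
  proof (rule ccontr)
    assume "unit_cubes {x} \<inter> unit_cubes X \<noteq> {}"
    then obtain z y where "y \<in> X"
      and "\<forall>l. real (lookup x l) \<le> z $ l \<and> z $ l < real (lookup x l) + 1"
      and "\<forall>l. real (lookup y l) \<le> z $ l \<and> z $ l < real (lookup y l) + 1"
      unfolding unit_cubes_def by blast
    then show False using unit_cubes_unique[of x z y] insert.hyps(2) by simp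
  qed
  have "measure lebesgue (unit_cubes {x} \<union> unit_cubes X) = 1 + real (card X)"
    using insert.IH measure_unit_cube[of x] disj
    by (subst measure_Union) (auto simp: fmeasurable_def)
  then show ?case
    using insert measure_unit_cube[of x] by (simp add: eq fmeasurable.Un)
qed

section \<open>Integer combinations of generators\<close>

definition nat_scale :: "nat \<Rightarrow> 'a::comm_monoid_add \<Rightarrow> 'a" where
  "nat_scale k v = (\<Sum>_<k. v)"

lemma nat_scale_add: "nat_scale (k + l) v = nat_scale k v + nat_scale l v"
  by (induction l) (simp_all add: nat_scale_def add.assoc)

lemma lookup_nat_scale: "lookup (nat_scale k v) l = k * (lookup v l :: nat)"
  by (simp add: nat_scale_def lookup_sum)

definition comb :: "nat \<Rightarrow> (nat \<Rightarrow> 'a set) \<Rightarrow> (nat \<times> 'a \<Rightarrow> nat) \<Rightarrow> 'a::comm_monoid_add" where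
  "comb m F a = (\<Sum>p\<in>Sigma {..<m} F. nat_scale (a p) (snd p))"

text \<open>
  The sums of \<open>u\<^sub>i\<close> elements of \<open>F\<^sub>i\<close>, with repetition, over all \<open>i < m\<close>.
\<close>

definition combs :: "nat \<Rightarrow> (nat \<Rightarrow> 'a set) \<Rightarrow> (nat \<Rightarrow> nat) \<Rightarrow> 'a::comm_monoid_add set" where
  "combs m F u = {comb m F a | a. a \<in> supported_on (Sigma {..<m} F) \<and> (\<forall>i<m. multideg (Sigma {..<m} F) fst a i = u i)}"

lemma comb_add: "comb m F (\<lambda>p. a p + b p) = comb m F a + comb m F b"
  by (simp add: comb_def nat_scale_add sum.distrib)

lemma multideg_Sigma:
  assumes "i < m"
  shows "multideg (Sigma {..<m} F) fst a i = (\<Sum>v\<in>F i. a (i, v))"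
proof -
  have "{p \<in> Sigma {..<m} F. fst p = i} = Pair i ` F i" using assms by auto
  then show ?thesis by (simp add: multideg_def sum.reindex inj_on_def)
qed

lemma vec_of_comb:
  assumes "\<And>i. i < m \<Longrightarrow> finite (F i)"
  shows "vec_of (comb m F a) = (\<Sum>i<m. \<Sum>v\<in>F i. real (a (i, v)) *\<^sub>R vec_of v)"
proof -
  have "vec_of (comb m F a) = (\<Sum>p\<in>Sigma {..<m} F. real (a p) *\<^sub>R vec_of (snd p))"
    by (simp add: vec_eq_iff comb_def lookup_sum lookup_nat_scale)
  then show ?thesis using assms by (simp add: sum.Sigma split_def)
qed

lemma finite_combs:
  assumes "\<And>i. i < m \<Longrightarrow> finite (F i)"
  shows "finite (combs m F u)"
proof -
  have "finite {a \<in> supported_on (Sigma {..<m} F). \<forall>i<m. multideg (Sigma {..<m} F) fst a i = u i}"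
    using assms by (intro finite_multideg_fibre) auto
  then have "finite (comb m F ` {a \<in> supported_on (Sigma {..<m} F). \<forall>i<m. multideg (Sigma {..<m} F) fst a i = u i})"
    by (rule finite_imageI)
  moreover have "combs m F u \<subseteq> comb m F ` {a \<in> supported_on (Sigma {..<m} F). \<forall>i<m. multideg (Sigma {..<m} F) fst a i = u i}"
    unfolding combs_def by blast
  ultimately show ?thesis by (rule finite_subset[rotated])
qed

lemma vec_of_combs_subset:
  assumes F: "\<And>i. i < m \<Longrightarrow> finite (F i) \<and> F i \<noteq> {}" and x: "x \<in> combs m F u"
  shows "vec_of x \<in> minkowski_comb m (\<lambda>i. convex hull (vec_of ` F i)) (\<lambda>i. real (u i))"
proof -
  obtain a where a: "x = comb m F a" "\<And>i. i < m \<Longrightarrow> (\<Sum>v\<in>F i. a (i, v)) = u i"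
    using x unfolding combs_def by (auto simp: multideg_Sigma)
  have "\<exists>y\<in>convex hull (vec_of ` F i). (\<Sum>v\<in>F i. real (a (i, v)) *\<^sub>R vec_of v) = real (u i) *\<^sub>R y" if i: "i < m" for i
  proof (cases "u i = 0")
    case True
    then have "\<forall>v\<in>F i. a (i, v) = 0" using a(2)[OF i] F[OF i] by simp
    moreover obtain v where "v \<in> F i" using F[OF i] by blast
    then have "vec_of v \<in> convex hull (vec_of ` F i)" by (simp add: hull_inc)
    ultimately show ?thesis using True by auto
  next
    case False
    have "(\<Sum>v\<in>F i. (real (a (i, v)) / real (u i)) *\<^sub>R vec_of v) \<in> convex hull (vec_of ` F i)"
    proof (rule convex_sum)
      have "(\<Sum>v\<in>F i. real (a (i, v))) = real (u i)" using a(2)[OF i] by (metis of_nat_sum)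
      then show "(\<Sum>v\<in>F i. real (a (i, v)) / real (u i)) = 1"
        using False by (simp add: sum_divide_distrib[symmetric])
    qed (use F[OF i] in \<open>auto intro: hull_inc\<close>)
    moreover have "(\<Sum>v\<in>F i. real (a (i, v)) *\<^sub>R vec_of v)
        = real (u i) *\<^sub>R (\<Sum>v\<in>F i. (real (a (i, v)) / real (u i)) *\<^sub>R vec_of v)"
      using False by (simp add: scaleR_sum_right)
    ultimately show ?thesis by blast
  qed
  then have "\<forall>i. \<exists>y. i < m \<longrightarrow> y \<in> convex hull (vec_of ` F i) \<and>
      (\<Sum>v\<in>F i. real (a (i, v)) *\<^sub>R vec_of v) = real (u i) *\<^sub>R y"
    by blast
  from choice[OF this] obtain y where y: "\<And>i. i < m \<Longrightarrow> y i \<in> convex hull (vec_of ` F i) \<and>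
      (\<Sum>v\<in>F i. real (a (i, v)) *\<^sub>R vec_of v) = real (u i) *\<^sub>R y i"
    by blast
  have "vec_of x = (\<Sum>i<m. real (u i) *\<^sub>R y i)"
  proof -
    have "vec_of x = (\<Sum>i<m. \<Sum>v\<in>F i. real (a (i, v)) *\<^sub>R vec_of v)"
      unfolding a(1) by (rule vec_of_comb) (use F in blast)
    also have "\<dots> = (\<Sum>i<m. real (u i) *\<^sub>R y i)"
      by (rule sum.cong[OF refl]) (use y in blast)
    finally show ?thesis .
  qed
  then show ?thesis unfolding minkowski_comb_def using y by blast
qed

text \<open>
  Round every weight down and give the missing amount, at most the number of weights, to one of
  them.
\<close>

lemma round_weights:
  fixes t :: "'a \<Rightarrow> real"
  assumes "finite F" "F \<noteq> {}" and t: "\<And>v. v \<in> F \<Longrightarrow> 0 \<le> t v" and sum: "(\<Sum>v\<in>F. t v) = real u"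
  obtains b :: "'a \<Rightarrow> nat" where "(\<Sum>v\<in>F. b v) = u" "\<And>v. v \<in> F \<Longrightarrow> \<bar>t v - real (b v)\<bar> \<le> real (card F)"
proof -
  obtain v0 where v0: "v0 \<in> F" using assms(2) by blast
  define s where "s v = nat \<lfloor>t v\<rfloor>" for v
  have s: "real (s v) \<le> t v" "t v \<le> real (s v) + 1" if "v \<in> F" for v
    using t[OF that] by (simp_all add: s_def of_nat_nat)
  have le: "(\<Sum>v\<in>F. real (s v)) \<le> real u" unfolding sum[symmetric] using s by (intro sum_mono) auto
  have "real u \<le> (\<Sum>v\<in>F. real (s v) + 1)" unfolding sum[symmetric] using s by (intro sum_mono) auto
  then have ge: "real u \<le> (\<Sum>v\<in>F. real (s v)) + real (card F)" by (simp add: sum.distrib)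
  define rest where "rest = u - (\<Sum>v\<in>F. s v)"
  have le': "(\<Sum>v\<in>F. s v) \<le> u" using le by (metis of_nat_le_iff of_nat_sum)
  have rest: "real rest \<le> real (card F)"
    using ge le' by (simp add: rest_def of_nat_diff)
  have card: "1 \<le> real (card F)" using assms(1,2) by (simp add: Suc_leI card_gt_0_iff)
  define b where "b v = s v + (if v = v0 then rest else 0)" for v
  show ?thesis
  proof
    show "(\<Sum>v\<in>F. b v) = u"
      using v0 assms(1) le' by (simp add: b_def sum.distrib rest_def)
    show "\<bar>t v - real (b v)\<bar> \<le> real (card F)" if "v \<in> F" for v
      using s[OF that] rest card by (auto simp: b_def abs_le_iff)
  qed
qed

definition rounding_bound :: "nat \<Rightarrow> (nat \<Rightarrow> ('n::finite \<Rightarrow>\<^sub>0 nat) set) \<Rightarrow> nat" where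
  "rounding_bound m F = (\<Sum>i<m. \<Sum>v\<in>F i. card (F i) * (\<Sum>l\<in>UNIV. lookup v l))"

text \<open>
  The lattice points of the sumset are within a bounded distance of the Minkowski combination, with
  a bound that does not depend on \<open>u\<close>: round the coefficients of a convex combination.
\<close>

lemma combs_approximate:
  fixes z :: "real ^ 'n"
  assumes F: "\<And>i. i < m \<Longrightarrow> finite (F i) \<and> F i \<noteq> {}"
    and z: "z \<in> minkowski_comb m (\<lambda>i. convex hull (vec_of ` F i)) (\<lambda>i. real (u i))"
  shows "\<exists>x\<in>combs m F u. \<forall>l. \<bar>z $ l - vec_of x $ l\<bar> \<le> real (rounding_bound m F)"
proof -
  obtain y where y: "\<And>i. i < m \<Longrightarrow> y i \<in> convex hull (vec_of ` F i)" "z = (\<Sum>i<m. real (u i) *\<^sub>R y i)"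
    using z unfolding minkowski_comb_def by blast
  have "\<exists>c. (\<forall>v\<in>F i. 0 \<le> c v) \<and> (\<Sum>v\<in>F i. c v) = 1 \<and> (\<Sum>v\<in>F i. c v *\<^sub>R vec_of v) = y i" if i: "i < m" for i
  proof -
    obtain c where c: "\<forall>x\<in>vec_of ` F i. 0 \<le> c x" "sum c (vec_of ` F i) = 1" "(\<Sum>x\<in>vec_of ` F i. c x *\<^sub>R x) = y i"
      using y(1)[OF i] F[OF i] by (auto simp: convex_hull_finite)
    have inj: "inj_on vec_of (F i)" using inj_vec_of inj_on_subset by blast
    show ?thesis
      using c by (intro exI[of _ "\<lambda>v. c (vec_of v)"]) (simp add: sum.reindex[OF inj] o_def)
  qed
  then obtain c where c: "\<And>i v. i < m \<Longrightarrow> v \<in> F i \<Longrightarrow> 0 \<le> c i v" "\<And>i. i < m \<Longrightarrow> (\<Sum>v\<in>F i. c i v) = 1"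
      "\<And>i. i < m \<Longrightarrow> (\<Sum>v\<in>F i. c i v *\<^sub>R vec_of v) = y i"
    by metis
  have "\<exists>b :: ('n \<Rightarrow>\<^sub>0 nat) \<Rightarrow> nat. (\<Sum>v\<in>F i. b v) = u i \<and> (\<forall>v\<in>F i. \<bar>real (u i) * c i v - real (b v)\<bar> \<le> real (card (F i)))"
    if i: "i < m" for i
  proof -
    have "(\<Sum>v\<in>F i. real (u i) * c i v) = real (u i)"
      using c(2)[OF i] by (simp add: sum_distrib_left[symmetric])
    then show ?thesis
      using round_weights[of "F i" "\<lambda>v. real (u i) * c i v" "u i"] F[OF i] c(1)[OF i] by (metis mult_nonneg_nonneg of_nat_0_le_iff)
  qed
  then obtain b :: "nat \<Rightarrow> ('n \<Rightarrow>\<^sub>0 nat) \<Rightarrow> nat" where b: "\<And>i. i < m \<Longrightarrow> (\<Sum>v\<in>F i. b i v) = u i"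
      "\<And>i v. i < m \<Longrightarrow> v \<in> F i \<Longrightarrow> \<bar>real (u i) * c i v - real (b i v)\<bar> \<le> real (card (F i))"
    by metis
  define a where "a p = (if p \<in> Sigma {..<m} F then b (fst p) (snd p) else 0)" for p
  have a_eq: "a (i, v) = b i v" if "i < m" "v \<in> F i" for i v using that by (simp add: a_def)
  have "comb m F a \<in> combs m F u"
    unfolding combs_def
    by (rule CollectI, rule exI[of _ a]) (auto simp: supported_on_def multideg_Sigma a_eq b(1) a_def[of "_"])
  moreover have "\<bar>z $ l - vec_of (comb m F a) $ l\<bar> \<le> real (rounding_bound m F)" for l
  proof -
    have "z = (\<Sum>i<m. \<Sum>v\<in>F i. (real (u i) * c i v) *\<^sub>R vec_of v)"
      unfolding y(2) by (intro sum.cong refl) (simp add: c(3)[symmetric] scaleR_sum_right)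
    moreover have "vec_of (comb m F a) = (\<Sum>i<m. \<Sum>v\<in>F i. real (b i v) *\<^sub>R vec_of v)"
      using F by (simp add: vec_of_comb a_eq)
    ultimately have "z $ l - vec_of (comb m F a) $ l
        = (\<Sum>i<m. \<Sum>v\<in>F i. (real (u i) * c i v - real (b i v)) * real (lookup v l))"
      by (simp add: sum_subtractf left_diff_distrib)
    also have "\<bar>\<dots>\<bar> \<le> (\<Sum>i<m. \<Sum>v\<in>F i. \<bar>(real (u i) * c i v - real (b i v)) * real (lookup v l)\<bar>)"
      by (intro order_trans[OF sum_abs] sum_mono sum_abs)
    also have "\<dots> \<le> (\<Sum>i<m. \<Sum>v\<in>F i. real (card (F i)) * real (\<Sum>l\<in>UNIV. lookup v l))"
    proof (intro sum_mono)
      fix i v assume "i \<in> {..<m}" "v \<in> F i"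
      then have "\<bar>real (u i) * c i v - real (b i v)\<bar> \<le> real (card (F i))" using b(2) by simp
      moreover have "lookup v l \<le> (\<Sum>l\<in>UNIV. lookup v l)"
        by (intro member_le_sum) auto
      then have "real (lookup v l) \<le> real (\<Sum>l\<in>UNIV. lookup v l)"
        by (simp only: of_nat_le_iff)
      ultimately show "\<bar>(real (u i) * c i v - real (b i v)) * real (lookup v l)\<bar>
          \<le> real (card (F i)) * real (\<Sum>l\<in>UNIV. lookup v l)"
        unfolding abs_mult by (intro mult_mono) auto
    qed
    also have "\<dots> = real (rounding_bound m F)" by (simp add: rounding_bound_def)
    finally show ?thesis .
  qed
  ultimately show ?thesis by blast
qed

section \<open>Mixed volumes of lattice polytopes\<close>

lemma finite_multi_indices: "finite (multi_indices m k)"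
proof (rule finite_subset)
  show "multi_indices m k \<subseteq> {n. \<forall>i. (i \<in> {..<m} \<longrightarrow> n i \<in> {..k}) \<and> (i \<notin> {..<m} \<longrightarrow> n i = 0)}"
  proof (intro subsetI CollectI allI conjI impI)
    fix n i assume n: "n \<in> multi_indices m k" "i \<in> {..<m}"
    then have "n i \<le> (\<Sum>i<m. n i)" by (intro member_le_sum) auto
    then show "n i \<in> {..k}" using n by (simp add: multi_indices_def)
  next
    fix n i assume "n \<in> multi_indices m k" "i \<notin> {..<m}"
    then show "n i = 0" by (simp add: multi_indices_def)
  qed
  show "finite {n. \<forall>i. (i \<in> {..<m} \<longrightarrow> n i \<in> {..k}) \<and> (i \<notin> {..<m} \<longrightarrow> n i = (0::nat))}"
    by (intro finite_set_of_finite_funs) auto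
qed

lemma mixed_volumes_unique:
  fixes Q :: "nat \<Rightarrow> (real ^ 'n) set"
  assumes "has_mixed_volumes m Q V" "has_mixed_volumes m Q V'" and n: "n \<in> multi_indices m CARD('n)"
  shows "V n = V' n"
proof -
  let ?M = "multi_indices m CARD('n)"
  have "(\<Sum>n\<in>?M. (fact CARD('n) / (\<Prod>i<m. fact (n i)) * (V n - V' n)) * (\<Prod>i<m. real (u i) ^ n i)) = 0" for u :: "nat \<Rightarrow> nat"
  proof -
    have "(\<Sum>n\<in>?M. fact CARD('n) / (\<Prod>i<m. fact (n i)) * V n * (\<Prod>i<m. real (u i) ^ n i))
        = (\<Sum>n\<in>?M. fact CARD('n) / (\<Prod>i<m. fact (n i)) * V' n * (\<Prod>i<m. real (u i) ^ n i))"
      using assms(1,2)[unfolded has_mixed_volumes_def, rule_format, of "\<lambda>i. real (u i)"] by simp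
    then show ?thesis by (simp add: sum_subtractf right_diff_distrib left_diff_distrib)
  qed
  then have "\<forall>n\<in>?M. fact CARD('n) / (\<Prod>i<m. fact (n i)) * (V n - V' n) = 0"
    using finite_multi_indices[of m "CARD('n)"]
    by (intro monomial_sum_eq_0[where U = 0 and m = m]) (auto simp: multi_indices_def)
  then have "fact CARD('n) / (\<Prod>i<m. fact (n i)) * (V n - V' n) = 0" using n by blast
  then show ?thesis by simp
qed

lemma mixed_volume_eqI:
  fixes Q :: "nat \<Rightarrow> (real ^ 'n) set"
  assumes "has_mixed_volumes m Q V" and "n \<in> multi_indices m CARD('n)"
  shows "mixed_volume m Q n = V n"
  unfolding mixed_volume_def using assms mixed_volumes_unique by (intro the_equality) blast+

section \<open>Counting lattice points in thickened sumsets\<close>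

lemma finite_bounded_exponents: "finite {w :: 'n::finite \<Rightarrow>\<^sub>0 nat. \<forall>l. lookup w l \<le> K l}"
proof (rule finite_imageD)
  have "lookup ` {w :: 'n \<Rightarrow>\<^sub>0 nat. \<forall>l. lookup w l \<le> K l}
      \<subseteq> {f. \<forall>l. (l \<in> UNIV \<longrightarrow> f l \<in> {..Max (range K)}) \<and> (l \<notin> UNIV \<longrightarrow> f l = 0)}"
  proof (rule image_subsetI)
    fix w :: "'n \<Rightarrow>\<^sub>0 nat" assume "w \<in> {w. \<forall>l. lookup w l \<le> K l}"
    then have *: "lookup w l \<le> K l" for l by simp
    have "lookup w l \<le> Max (range K)" for l
      by (rule order_trans[OF *]) (rule Max_ge, auto)
    then show "lookup w
        \<in> {f. \<forall>l. (l \<in> UNIV \<longrightarrow> f l \<in> {..Max (range K)}) \<and> (l \<notin> UNIV \<longrightarrow> f l = 0)}" by simp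
  qed
  moreover have "finite {f :: 'n \<Rightarrow> nat. \<forall>l. (l \<in> UNIV \<longrightarrow> f l \<in> {..Max (range K)}) \<and> (l \<notin> UNIV \<longrightarrow> f l = 0)}"
    by (rule finite_set_of_finite_funs) auto
  ultimately show "finite (lookup ` {w :: 'n \<Rightarrow>\<^sub>0 nat. \<forall>l. lookup w l \<le> K l})"
    by (rule finite_subset)
  show "inj_on lookup {w :: 'n \<Rightarrow>\<^sub>0 nat. \<forall>l. lookup w l \<le> K l}"
    by (rule inj_onI) (simp only: poly_mapping_eq_iff)
qed

lemma floor_exponent:
  fixes z :: "real ^ 'n::finite"
  assumes "\<And>l. 0 \<le> z $ l"
  obtains w :: "'n \<Rightarrow>\<^sub>0 nat" where "\<And>l. real (lookup w l) \<le> z $ l" "\<And>l. z $ l < real (lookup w l) + 1"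
proof
  have "lookup (Abs_poly_mapping (\<lambda>l. nat \<lfloor>z $ l\<rfloor>)) l = nat \<lfloor>z $ l\<rfloor>" for l
    by simp
  then show "real (lookup (Abs_poly_mapping (\<lambda>l. nat \<lfloor>z $ l\<rfloor>)) l) \<le> z $ l"
    "z $ l < real (lookup (Abs_poly_mapping (\<lambda>l. nat \<lfloor>z $ l\<rfloor>)) l) + 1" for l
    using assms[of l] by (simp_all add: of_nat_nat)
qed

definition thick_combs :: "nat \<Rightarrow> (nat \<Rightarrow> ('n::finite \<Rightarrow>\<^sub>0 nat) set) \<Rightarrow> nat \<Rightarrow> (nat \<Rightarrow> nat) \<Rightarrow> ('n \<Rightarrow>\<^sub>0 nat) set" where
  "thick_combs m F K u = {w + x | w x. (\<forall>l. lookup w l \<le> K) \<and> x \<in> combs m F u}"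

lemma finite_thick_combs:
  assumes "\<And>i. i < m \<Longrightarrow> finite (F i)"
  shows "finite (thick_combs m F K u)"
proof -
  have "thick_combs m F K u \<subseteq> (\<lambda>(w, x). w + x) ` ({w. \<forall>l. lookup w l \<le> K} \<times> combs m F u)"
    by (auto simp: thick_combs_def)
  moreover have "finite (combs m F u)" using assms by (rule finite_combs)
  then have "finite ((\<lambda>(w, x). w + x) ` ({w. \<forall>l. lookup w l \<le> K} \<times> combs m F u))"
    using finite_bounded_exponents[of "\<lambda>_. K"] by (intro finite_imageI finite_SigmaI)
  ultimately show ?thesis by (rule finite_subset)
qed

lemma sep_poly_card_thick_combs:
  assumes "\<And>i. i < m \<Longrightarrow> finite (F i)"
  shows "sep_poly m (\<lambda>u. real (card (thick_combs m F K u)))"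
proof -
  have "finite (Sigma {..<m} F)" using assms by auto
  moreover have "fst ` Sigma {..<m} F \<subseteq> {..<m}" by auto
  ultimately have "sep_poly m (\<lambda>u. real (card {w + comb m F a | w a. w \<in> {w. \<forall>l. lookup w l \<le> K} \<and>
      a \<in> supported_on (Sigma {..<m} F) \<and> (\<forall>i<m. multideg (Sigma {..<m} F) fst a i = u i) \<and> \<not> False}))"
    by (rule sep_poly_count_sums[where bad = "\<lambda>_ _. False"])
      (use finite_bounded_exponents[of "\<lambda>_. K"] in \<open>auto simp: comb_add\<close>)
  moreover have "{w + comb m F a | w a. w \<in> {w. \<forall>l. lookup w l \<le> K} \<and>
      a \<in> supported_on (Sigma {..<m} F) \<and> (\<forall>i<m. multideg (Sigma {..<m} F) fst a i = u i) \<and> \<not> False}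
      = thick_combs m F K u" for u
    unfolding thick_combs_def combs_def by blast
  ultimately show ?thesis by simp
qed

abbreviation unit_box :: "(real ^ 'n::finite) set" where
  "unit_box \<equiv> cbox 0 (\<chi> i. 1)"

text \<open>
  Thicken the sumset by a box of integer points whose side exceeds twice the rounding error. The
  unit cubes at the resulting points cover a translate of the Minkowski combination, and they are
  contained in its sum with a multiple of the unit cube.
\<close>

lemma card_thick_combs_bounds:
  fixes F :: "nat \<Rightarrow> ('n::finite \<Rightarrow>\<^sub>0 nat) set"
  assumes F: "\<And>i. i < m \<Longrightarrow> finite (F i) \<and> F i \<noteq> {}"
  defines "P \<equiv> \<lambda>i. convex hull (vec_of ` F i)" and "K \<equiv> 2 * rounding_bound m F"
  shows "measure lebesgue (minkowski_comb m P (\<lambda>i. real (u i))) \<le> real (card (thick_combs m F K u))"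
    and "real (card (thick_combs m F K u))
      \<le> measure lebesgue (minkowski_comb (Suc m) (P(m := unit_box)) ((\<lambda>i. real (u i))(m := real K + 1)))"
proof -
  let ?C = "rounding_bound m F"
  have fin: "finite (thick_combs m F K u)" using F by (intro finite_thick_combs) auto
  note cubes = measure_unit_cubes[OF fin]
  have cP: "compact (P i)" if "i < m" for i
    using F[OF that] by (simp add: P_def finite_imp_compact_convex_hull)
  define c :: "real ^ 'n" where "c = (\<chi> i. real ?C)"
  have "(+) c ` minkowski_comb m P (\<lambda>i. real (u i)) \<subseteq> unit_cubes (thick_combs m F K u)"
  proof (rule image_subsetI)
    fix z assume "z \<in> minkowski_comb m P (\<lambda>i. real (u i))"
    then obtain x where x: "x \<in> combs m F u" "\<And>l. \<bar>z $ l - vec_of x $ l\<bar> \<le> real ?C"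
      using combs_approximate[of m F z u, OF F] unfolding P_def by blast
    have pos: "0 \<le> (c + z - vec_of x) $ l" "(c + z - vec_of x) $ l \<le> real K" for l
      using x(2)[of l] by (simp_all add: c_def K_def abs_le_iff)
    then obtain w where w: "\<And>l. real (lookup w l) \<le> (c + z - vec_of x) $ l"
        "\<And>l. (c + z - vec_of x) $ l < real (lookup w l) + 1"
      using floor_exponent by metis
    have "lookup w l \<le> K" for l
      using order_trans[OF w(1)[of l] pos(2)[of l]] by simp
    then have "w + x \<in> thick_combs m F K u" using x(1) unfolding thick_combs_def by blast
    moreover have "real (lookup (w + x) l) \<le> (c + z) $ l \<and> (c + z) $ l < real (lookup (w + x) l) + 1" for l
      using w(1)[of l] w(2)[of l] by (simp add: lookup_add)
    ultimately show "c + z \<in> unit_cubes (thick_combs m F K u)" unfolding unit_cubes_def by blast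
  qed
  moreover have "compact ((+) c ` minkowski_comb m P (\<lambda>i. real (u i)))"
    using cP by (intro compact_translation compact_minkowski_comb)
  ultimately have "measure lebesgue ((+) c ` minkowski_comb m P (\<lambda>i. real (u i))) \<le> measure lebesgue (unit_cubes (thick_combs m F K u))"
    using cubes by (intro measure_mono_fmeasurable) (auto intro: lmeasurable_compact fmeasurableD)
  then show "measure lebesgue (minkowski_comb m P (\<lambda>i. real (u i))) \<le> real (card (thick_combs m F K u))"
    using cubes by (simp only: measure_translation)
  have "unit_cubes (thick_combs m F K u) \<subseteq> minkowski_comb (Suc m) (P(m := unit_box)) ((\<lambda>i. real (u i))(m := real K + 1))"
  proof
    fix z assume "z \<in> unit_cubes (thick_combs m F K u)"
    then obtain w x where w: "\<And>l. lookup w l \<le> K" and x: "x \<in> combs m F u"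
      and z: "\<And>l. real (lookup (w + x) l) \<le> z $ l" "\<And>l. z $ l < real (lookup (w + x) l) + 1"
      unfolding unit_cubes_def thick_combs_def by blast
    have "vec_of x \<in> minkowski_comb m P (\<lambda>i. real (u i))"
      unfolding P_def by (rule vec_of_combs_subset[of m F x u, OF F x])
    moreover have "minkowski_comb m P (\<lambda>i. real (u i))
        = minkowski_comb m (P(m := unit_box)) ((\<lambda>i. real (u i))(m := real K + 1))"
      by (rule minkowski_comb_cong) auto
    moreover have "(1 / (real K + 1)) *\<^sub>R (z - vec_of x) \<in> unit_box"
    proof -
      have "0 \<le> z $ l - vec_of x $ l" "z $ l - vec_of x $ l \<le> real K + 1" for l
        using z(1)[of l] z(2)[of l] w[of l] by (simp_all add: lookup_add)
      then show ?thesis by (simp add: mem_box_cart divide_le_eq)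
    qed
    moreover have "z = vec_of x + (real K + 1) *\<^sub>R ((1 / (real K + 1)) *\<^sub>R (z - vec_of x))" by simp
    ultimately show "z \<in> minkowski_comb (Suc m) (P(m := unit_box)) ((\<lambda>i. real (u i))(m := real K + 1))"
      unfolding minkowski_comb_Suc fun_upd_same by blast
  qed
  moreover have "compact (minkowski_comb (Suc m) (P(m := unit_box)) ((\<lambda>i. real (u i))(m := real K + 1)))"
    using cP by (intro compact_minkowski_comb) (auto simp: less_Suc_eq)
  ultimately have "measure lebesgue (unit_cubes (thick_combs m F K u))
      \<le> measure lebesgue (minkowski_comb (Suc m) (P(m := unit_box)) ((\<lambda>i. real (u i))(m := real K + 1)))"
    using cubes by (intro measure_mono_fmeasurable) (auto intro: lmeasurable_compact fmeasurableD)
  then show "real (card (thick_combs m F K u))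
      \<le> measure lebesgue (minkowski_comb (Suc m) (P(m := unit_box)) ((\<lambda>i. real (u i))(m := real K + 1)))"
    using cubes by simp
qed

text \<open>
  After rescaling by \<open>k\<close>, the two bounds differ by a summand \<open>((K + 1) / k) [0,1]\<^sup>d\<close>, which disappears in the
  limit.
\<close>

lemma card_thick_combs_growth:
  fixes F :: "nat \<Rightarrow> ('n::finite \<Rightarrow>\<^sub>0 nat) set"
  assumes F: "\<And>i. i < m \<Longrightarrow> finite (F i) \<and> F i \<noteq> {}"
  defines "P \<equiv> \<lambda>i. convex hull (vec_of ` F i)" and "K \<equiv> 2 * rounding_bound m F"
  shows "(\<lambda>k. real (card (thick_combs m F K (\<lambda>i. k * u i))) / real k ^ CARD('n))
    \<longlonglongrightarrow> measure lebesgue (minkowski_comb m P (\<lambda>i. real (u i)))"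
proof (rule tendsto_sandwich)
  let ?P = "P(m := unit_box)" and ?t = "(\<lambda>i. real (u i))(m := 0)"
  let ?s = "\<lambda>k. (\<lambda>i. real (u i))(m := (real K + 1) / real k)"
  have P: "compact (P i) \<and> convex (P i) \<and> P i \<noteq> {}" if "i < m" for i
    using F[OF that] by (simp add: P_def finite_imp_compact_convex_hull)
  have lower: "measure lebesgue (minkowski_comb m P (\<lambda>i. real (u i)))
      \<le> real (card (thick_combs m F K (\<lambda>i. k * u i))) / real k ^ CARD('n)" if "k > 0" for k
  proof -
    have "real k ^ CARD('n) * measure lebesgue (minkowski_comb m P (\<lambda>i. real (u i)))
        \<le> real (card (thick_combs m F K (\<lambda>i. k * u i)))"
      using card_thick_combs_bounds(1)[of m F "\<lambda>i. k * u i", OF F] measure_minkowski_comb_scale[of m P "real k" "\<lambda>i. real (u i)"]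
      by (simp add: P_def K_def)
    then show ?thesis using that by (simp add: field_simps)
  qed
  have upper: "real (card (thick_combs m F K (\<lambda>i. k * u i))) / real k ^ CARD('n)
      \<le> measure lebesgue (minkowski_comb (Suc m) ?P (?s k))" if "k > 0" for k
  proof -
    have "(\<lambda>i. real k * ?s k i) = (\<lambda>i. real (k * u i))(m := real K + 1)" using that by auto
    then have "real (card (thick_combs m F K (\<lambda>i. k * u i))) \<le> real k ^ CARD('n) * measure lebesgue (minkowski_comb (Suc m) ?P (?s k))"
      using card_thick_combs_bounds(2)[of m F "\<lambda>i. k * u i", OF F] measure_minkowski_comb_scale[of "Suc m" ?P "real k" "?s k"]
      by (simp add: P_def K_def)
    then show ?thesis using that by (simp add: field_simps)
  qed
  show "\<forall>\<^sub>F k in sequentially. measure lebesgue (minkowski_comb m P (\<lambda>i. real (u i)))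
      \<le> real (card (thick_combs m F K (\<lambda>i. k * u i))) / real k ^ CARD('n)"
    using eventually_gt_at_top[of 0] by eventually_elim (rule lower)
  show "\<forall>\<^sub>F k in sequentially. real (card (thick_combs m F K (\<lambda>i. k * u i))) / real k ^ CARD('n)
      \<le> measure lebesgue (minkowski_comb (Suc m) ?P (?s k))"
    using eventually_gt_at_top[of 0] by eventually_elim (rule upper)
  show "(\<lambda>k. measure lebesgue (minkowski_comb m P (\<lambda>i. real (u i)))) \<longlonglongrightarrow> measure lebesgue (minkowski_comb m P (\<lambda>i. real (u i)))"
    by simp
  have "(\<lambda>k. measure lebesgue (minkowski_comb (Suc m) ?P (?s k))) \<longlonglongrightarrow> measure lebesgue (minkowski_comb (Suc m) ?P ?t)"
  proof (rule measure_minkowski_comb_tendsto)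
    show "compact (?P i) \<and> convex (?P i) \<and> ?P i \<noteq> {}" if "i < Suc m" for i
      using that P by (auto simp: less_Suc_eq interval_ne_empty_cart)
    have "(\<lambda>k. (real K + 1) / real k) \<longlonglongrightarrow> 0" by (rule lim_const_over_n)
    then show "(\<lambda>k. ?s k i) \<longlonglongrightarrow> ?t i" for i by simp
  qed auto
  moreover have "minkowski_comb (Suc m) ?P ?t = minkowski_comb m P (\<lambda>i. real (u i))"
  proof -
    have "minkowski_comb m ?P ?t = minkowski_comb m P (\<lambda>i. real (u i))"
      by (rule minkowski_comb_cong) auto
    moreover have "(*\<^sub>R) 0 ` (unit_box :: (real ^ 'n) set) = {0}"
      by (auto simp: image_def interval_ne_empty_cart intro!: exI[of _ "0 :: real ^ 'n"]) (auto simp: mem_box_cart)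
    ultimately show ?thesis by (simp add: minkowski_comb_Suc)
  qed
  ultimately show "(\<lambda>k. measure lebesgue (minkowski_comb (Suc m) ?P (?s k)))
      \<longlonglongrightarrow> measure lebesgue (minkowski_comb m P (\<lambda>i. real (u i)))" by simp
qed

section \<open>Existence of mixed volumes\<close>

text \<open>
  Minkowski's theorem for lattice polytopes. The number of points of the thickened sumset is
  eventually polynomial and grows like the volume, so the volume at integer points is its leading
  form. Homogeneity extends this to rational points and continuity from above to all \<open>t \<ge> 0\<close>.
\<close>

theorem ex_mixed_volumes_lattice_polytopes:
  fixes F :: "nat \<Rightarrow> ('n::finite \<Rightarrow>\<^sub>0 nat) set"
  assumes F: "\<And>i. i < m \<Longrightarrow> finite (F i) \<and> F i \<noteq> {}"
  shows "\<exists>V. has_mixed_volumes m (\<lambda>i. convex hull (vec_of ` F i)) V"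
proof -
  let ?P = "\<lambda>i. convex hull (vec_of ` F i)" and ?d = "CARD('n)"
  let ?vol = "\<lambda>t. measure lebesgue (minkowski_comb m ?P t)"
  let ?f = "\<lambda>u. real (card (thick_combs m F (2 * rounding_bound m F) u))"
  have P: "compact (?P i) \<and> convex (?P i) \<and> ?P i \<noteq> {}" if "i < m" for i
    using F[OF that] by (simp add: finite_imp_compact_convex_hull)
  have "sep_poly m ?f" using F by (intro sep_poly_card_thick_combs) auto
  from sep_poly_eventually_polynomial[OF this] obtain M q U where MqU:
    "finite M \<and> M \<subseteq> {n. \<forall>i\<ge>m. n i = 0} \<and>
      (\<forall>u. (\<forall>i<m. U \<le> u i) \<longrightarrow> ?f u = (\<Sum>n\<in>M. q n * (\<Prod>i<m. real (u i) ^ n i)))"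
    by (elim exE) (rule that)
  then have M: "finite M" "M \<subseteq> {n. \<forall>i\<ge>m. n i = 0}"
    and f: "\<forall>u. (\<forall>i<m. U \<le> u i) \<longrightarrow> ?f u = (\<Sum>n\<in>M. q n * (\<Prod>i<m. real (u i) ^ n i))"
    by blast+
  define N where "N = {n \<in> M. (\<Sum>i<m. n i) = ?d}"
  define h where "h t = (\<Sum>n\<in>N. q n * (\<Prod>i<m. t i ^ n i))" for t :: "nat \<Rightarrow> real"
  have int: "?vol (\<lambda>i. real (u i)) = h (\<lambda>i. real (u i))" if "\<And>i. i < m \<Longrightarrow> 1 \<le> u i" for u
    unfolding h_def N_def
    by (rule leading_form_from_growth(2)[OF M, of U ?f q ?d]) (use f card_thick_combs_growth[of m F, OF F] that in auto)
  have hom: "h (\<lambda>i. c * t i) = c ^ ?d * h t" for c t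
    unfolding h_def sum_distrib_left
    by (intro sum.cong refl) (simp add: N_def power_mult_distrib prod.distrib power_sum[symmetric])
  have vol: "?vol t = h t" if t: "\<forall>i<m. 0 \<le> t i" for t
  proof -
    \<comment> \<open>approximate \<open>t\<close> from above by positive rational points \<open>s k = u k / (k + 1)\<close>\<close>
    define u where "u k i = nat \<lfloor>real (Suc k) * t i\<rfloor> + 1" for k i
    define s where "s k i = (1 / real (Suc k)) * real (u k i)" for k i
    have s: "t i \<le> s k i" "s k i \<le> t i + 1 / real (Suc k)" if "i < m" for i k
    proof -
      have "0 \<le> real (Suc k) * t i" using t that by simp
      then have "real (Suc k) * t i \<le> real (u k i)" "real (u k i) \<le> real (Suc k) * t i + 1"
        by (simp_all add: u_def of_nat_nat del: of_nat_Suc) linarith+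
      then show "t i \<le> s k i" "s k i \<le> t i + 1 / real (Suc k)"
        by (simp_all add: s_def field_simps del: of_nat_Suc)
    qed
    have lim: "(\<lambda>k. s k i) \<longlonglongrightarrow> t i" if "i < m" for i
    proof (rule tendsto_sandwich[of "\<lambda>_. t i" _ _ "\<lambda>k. t i + 1 / real (Suc k)"])
      have "(\<lambda>k. t i + 1 / real (Suc k)) \<longlonglongrightarrow> t i + 0"
        using LIMSEQ_inverse_real_of_nat by (intro tendsto_add) (auto simp: inverse_eq_divide)
      then show "(\<lambda>k. t i + 1 / real (Suc k)) \<longlonglongrightarrow> t i" by simp
    qed (use s[OF that] in auto)
    have "?vol (s k) = h (s k)" for k
    proof -
      have "?vol (s k) = (1 / real (Suc k)) ^ ?d * ?vol (\<lambda>i. real (u k i))"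
        using measure_minkowski_comb_scale[of m ?P "1 / real (Suc k)" "\<lambda>i. real (u k i)"] by (simp add: s_def[abs_def])
      also have "?vol (\<lambda>i. real (u k i)) = h (\<lambda>i. real (u k i))" by (rule int) (simp add: u_def)
      also have "(1 / real (Suc k)) ^ ?d * \<dots> = h (s k)"
        unfolding hom[symmetric] s_def[abs_def] ..
      finally show ?thesis .
    qed
    then have "(\<lambda>k. h (s k)) \<longlonglongrightarrow> ?vol t"
      using measure_minkowski_comb_tendsto[of m ?P t s] P t s lim by simp
    moreover have "(\<lambda>k. h (s k)) \<longlonglongrightarrow> h t"
      unfolding h_def using lim by (intro tendsto_intros) auto
    ultimately show ?thesis using LIMSEQ_unique by blast
  qed
  define V where "V n = (if n \<in> N then q n * (\<Prod>i<m. fact (n i)) / fact ?d else 0)" for n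
  have "h t = (\<Sum>n\<in>multi_indices m ?d. fact ?d / (\<Prod>i<m. fact (n i)) * V n * (\<Prod>i<m. t i ^ n i))" for t
    unfolding h_def
  proof (rule sum.mono_neutral_cong_left)
    show "finite (multi_indices m ?d)" by (rule finite_multi_indices)
    show "N \<subseteq> multi_indices m ?d" using M(2) by (auto simp: N_def multi_indices_def)
  qed (auto simp: V_def)
  then show ?thesis unfolding has_mixed_volumes_def using vol by auto
qed

section \<open>Newton polyhedra\<close>

definition total_degree :: "('n::finite \<Rightarrow>\<^sub>0 nat) \<Rightarrow> nat" where
  "total_degree v = (\<Sum>l\<in>UNIV. lookup v l)"

lemma total_degree_add: "total_degree (v + w) = total_degree v + total_degree w"
  by (simp add: total_degree_def lookup_add sum.distrib)

lemma total_degree_eq_0_iff: "total_degree v = 0 \<longleftrightarrow> v = 0"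
proof
  assume "total_degree v = 0"
  then show "v = 0" by (intro poly_mapping_eqI) (simp add: total_degree_def)
qed (simp add: total_degree_def)

text \<open>
  The minimal elements generate; an infinite set of them would contain two comparable ones by
  Dickson's lemma.
\<close>

lemma finite_generating_exponents:
  fixes A :: "('n::finite \<Rightarrow>\<^sub>0 nat) set"
  obtains V where "finite V" "V \<subseteq> A" "\<And>a. a \<in> A \<Longrightarrow> \<exists>v\<in>V. \<exists>w. a = v + w"
proof
  define below where "below v a \<longleftrightarrow> (\<forall>l. lookup v l \<le> lookup a l)" for v a :: "'n \<Rightarrow>\<^sub>0 nat"
  define V where "V = {a \<in> A. \<forall>b\<in>A. below b a \<longrightarrow> b = a}"
  show "V \<subseteq> A" by (auto simp: V_def)
  show "finite V"
  proof (rule ccontr)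
    assume "infinite V"
    then obtain f :: "nat \<Rightarrow> ('n \<Rightarrow>\<^sub>0 nat)" where f: "inj f" "range f \<subseteq> V"
      using infinite_countable_subset by blast
    obtain g :: "nat \<Rightarrow> nat" where g: "strict_mono g" "\<forall>l\<in>UNIV. mono (\<lambda>n. lookup (f (g n)) l)"
      using dickson_subsequence[of "UNIV :: 'n set" "\<lambda>n. lookup (f n)"] by auto
    have "below (f (g 0)) (f (g 1))" using g(2) by (simp add: below_def mono_def)
    moreover have "f (g 0) \<in> V" "f (g 1) \<in> V" using f(2) by auto
    ultimately have "f (g 0) = f (g 1)" unfolding V_def by blast
    then have "g 0 = g 1" using f(1) by (simp add: inj_eq)
    moreover have "g 0 < g 1" using g(1) by (simp add: strict_mono_less)
    ultimately show False by simp
  qed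
  fix a assume "a \<in> A"
  obtain v where v: "v \<in> A \<and> below v a" "\<And>b. b \<in> A \<and> below b a \<Longrightarrow> total_degree v \<le> total_degree b"
    using ex_has_least_nat[of "\<lambda>b. b \<in> A \<and> below b a" a total_degree] \<open>a \<in> A\<close> by (auto simp: below_def)
  have "b = v" if b: "b \<in> A" "below b v" for b
  proof (rule poly_mapping_eqI, rule ccontr)
    fix l assume ne: "lookup b l \<noteq> lookup v l"
    have "below b a" using b(2) v(1) unfolding below_def by (meson order_trans)
    then have "total_degree v \<le> total_degree b" using v(2) b(1) by blast
    moreover have "total_degree b < total_degree v" unfolding total_degree_def
    proof (rule sum_strict_mono_ex1)
      show "\<exists>l\<in>UNIV. lookup b l < lookup v l"
        using b(2) ne unfolding below_def by (metis UNIV_I le_neq_implies_less)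
    qed (use b(2) in \<open>auto simp: below_def\<close>)
    ultimately show False by simp
  qed
  then have "v \<in> V" using v(1) by (auto simp: V_def)
  moreover have "a = v + (a - v)"
    using v(1) by (intro poly_mapping_eqI) (simp add: below_def lookup_add lookup_minus)
  ultimately show "\<exists>v\<in>V. \<exists>w. a = v + w" by blast
qed

text \<open>
  The sum with the nonnegative orthant, which turns the compact polytope spanned by the vertices
  into the Newton polyhedron.
\<close>

definition orth :: "(real ^ 'n) set \<Rightarrow> (real ^ 'n::finite) set" where
  "orth S = {y + w | y w. y \<in> S \<and> (\<forall>l. 0 \<le> w $ l)}"

lemma orthI: "y \<in> S \<Longrightarrow> (\<And>l. 0 \<le> w $ l) \<Longrightarrow> y + w \<in> orth S"
  unfolding orth_def by blast

lemma subset_orth: "S \<subseteq> orth S"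
  using orthI[of _ S 0] by auto

lemma orth_mono: "S \<subseteq> T \<Longrightarrow> orth S \<subseteq> orth T"
  unfolding orth_def by blast

lemma orth_add: "z \<in> orth S \<Longrightarrow> (\<And>l. 0 \<le> w $ l) \<Longrightarrow> z + w \<in> orth S"
  unfolding orth_def by (auto simp: add.assoc) (metis add_nonneg_nonneg vector_add_component)

lemma orth_orth: "orth (orth S) \<subseteq> orth S"
  using orth_add unfolding orth_def[of "orth S"] by blast

lemma convex_orth:
  assumes "convex S"
  shows "convex (orth S)"
proof (rule convexI)
  fix x y and s t :: real assume xy: "x \<in> orth S" "y \<in> orth S" and st: "0 \<le> s" "0 \<le> t" "s + t = 1"
  obtain a v where x: "x = a + v" "a \<in> S" "\<And>l. 0 \<le> v $ l" using xy(1) unfolding orth_def by blast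
  obtain b w where y: "y = b + w" "b \<in> S" "\<And>l. 0 \<le> w $ l" using xy(2) unfolding orth_def by blast
  have "(s *\<^sub>R a + t *\<^sub>R b) + (s *\<^sub>R v + t *\<^sub>R w) \<in> orth S"
    using x y st assms by (intro orthI convexD) auto
  then show "s *\<^sub>R x + t *\<^sub>R y \<in> orth S" by (simp add: x(1) y(1) algebra_simps)
qed

lemma orth_scale:
  assumes "k > 0"
  shows "orth ((*\<^sub>R) k ` S) = (*\<^sub>R) k ` orth S"
proof (intro equalityI subsetI)
  fix z assume "z \<in> orth ((*\<^sub>R) k ` S)"
  then obtain y w where "y \<in> S" "\<And>l. 0 \<le> w $ l" "z = k *\<^sub>R y + w" unfolding orth_def by blast
  then have "z = k *\<^sub>R (y + (1 / k) *\<^sub>R w)" "y + (1 / k) *\<^sub>R w \<in> orth S"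
    using assms by (auto simp: scaleR_add_right intro!: orthI)
  then show "z \<in> (*\<^sub>R) k ` orth S" by blast
next
  fix z assume "z \<in> (*\<^sub>R) k ` orth S"
  then obtain y w where "y \<in> S" "\<forall>l. 0 \<le> w $ l" "z = k *\<^sub>R (y + w)"
    unfolding orth_def by blast
  then have "k *\<^sub>R y \<in> (*\<^sub>R) k ` S" "\<forall>l. 0 \<le> (k *\<^sub>R w) $ l" "z = k *\<^sub>R y + k *\<^sub>R w"
    using assms by (auto simp: scaleR_add_right)
  then show "z \<in> orth ((*\<^sub>R) k ` S)" unfolding orth_def by blast
qed

lemma convex_hull_vec_of_subset_orth:
  assumes "\<And>v. v \<in> V \<Longrightarrow> vec_of v \<in> orth (convex hull S)"
  shows "convex hull (vec_of ` {v + w | v w. v \<in> V}) \<subseteq> orth (convex hull S)"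
proof (rule hull_minimal)
  show "vec_of ` {v + w | v w. v \<in> V} \<subseteq> orth (convex hull S)"
    using assms by (auto simp: vec_of_add intro!: orth_add)
  show "convex (orth (convex hull S))" by (intro convex_orth convex_convex_hull)
qed

text \<open>
  A finitely generated polyhedron is the sum of the convex hull of its extreme points and its
  recession cone, here the orthant. An extreme point is a generator, since \<open>v + w\<close> with \<open>w \<noteq> 0\<close> is the midpoint
  of \<open>v\<close> and \<open>v + 2 w\<close>. Conversely, take a set \<open>G\<close> of generators, as small as possible, whose hull still
  spans the polyhedron together with the orthant. If some \<open>v \<in> G\<close> were inside a segment, then solving the
  resulting equation for \<open>v\<close> would express it by the other elements of \<open>G\<close>, so it could be
  removed.
\<close>

lemma extreme_points_of_newton_polyhedron:
  fixes V :: "('n::finite \<Rightarrow>\<^sub>0 nat) set"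
  assumes V: "finite V" "V \<noteq> {}"
  defines "N \<equiv> convex hull (vec_of ` {v + w | v w. v \<in> V})"
  obtains F where "F \<subseteq> V" "F \<noteq> {}" "{x. x extreme_point_of N} = vec_of ` F"
    "\<And>v. v \<in> V \<Longrightarrow> vec_of v \<in> orth (convex hull (vec_of ` F))"
proof -
  have inN: "vec_of (v + w) \<in> N" if "v \<in> V" for v w
    unfolding N_def by (rule hull_inc) (use that in blast)
  have ext_V: "x \<in> vec_of ` V" if x: "x extreme_point_of N" for x
  proof -
    have "x \<in> vec_of ` {v + w | v w. v \<in> V}"
      using x unfolding N_def by (rule extreme_point_of_convex_hull)
    then obtain v w where vw: "v \<in> V" "x = vec_of (v + w)" by blast
    have "w = 0"
    proof (rule ccontr)
      assume "w \<noteq> 0"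
      then have "vec_of w \<noteq> 0"
        using inj_eq[OF inj_vec_of, of w 0] by (simp add: vec_eq_iff)
      then have "vec_of v \<noteq> vec_of (v + w + w)"
        by (simp add: vec_of_add scaleR_2[symmetric] add.assoc)
      moreover have "x = (1 - 1/2) *\<^sub>R vec_of v + (1/2) *\<^sub>R vec_of (v + w + w)"
        unfolding vw(2) by (simp add: vec_of_add vec_eq_iff field_simps)
      ultimately have "x \<in> open_segment (vec_of v) (vec_of (v + w + w))"
        unfolding in_segment by (intro conjI exI[of _ "1/2"]) auto
      moreover have "vec_of v \<in> N" "vec_of (v + w + w) \<in> N"
        using inN[OF vw(1), of 0] inN[OF vw(1), of "w + w"] by (simp_all add: add.assoc)
      ultimately show False using x unfolding extreme_point_of_def by blast
    qed
    then show ?thesis using vw by simp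
  qed
  define good where "good G \<longleftrightarrow> G \<subseteq> V \<and> (\<forall>v\<in>V. vec_of v \<in> orth (convex hull (vec_of ` G)))" for G
  have "good V" unfolding good_def by (auto intro!: subsetD[OF subset_orth] hull_inc)
  then obtain G where G: "good G" and least: "\<And>G'. good G' \<Longrightarrow> card G \<le> card G'"
    using ex_has_least_nat[of good V card] by blast
  have finG: "finite G" using G V(1) unfolding good_def by (meson finite_subset)
  have NG: "N \<subseteq> orth (convex hull (vec_of ` G))"
    unfolding N_def using G unfolding good_def by (intro convex_hull_vec_of_subset_orth) auto
  have "vec_of v extreme_point_of N" if v: "v \<in> G" for v
    unfolding extreme_point_of_def
  proof (intro conjI ballI notI)
    show "vec_of v \<in> N" using inN[of v 0] v G by (auto simp: good_def)
    fix a b assume ab: "a \<in> N" "b \<in> N" "vec_of v \<in> open_segment a b"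
    define G0 where "G0 = G - {v}"
    have not: "vec_of v \<notin> orth (convex hull (vec_of ` G0))"
    proof
      assume v0: "vec_of v \<in> orth (convex hull (vec_of ` G0))"
      have "vec_of ` G \<subseteq> orth (convex hull (vec_of ` G0))"
      proof (rule image_subsetI)
        fix v' assume "v' \<in> G"
        then show "vec_of v' \<in> orth (convex hull (vec_of ` G0))"
          using v0 subset_orth[of "convex hull (vec_of ` G0)"] hull_inc[of "vec_of v'" "vec_of ` G0" convex]
          by (cases "v' = v") (auto simp: G0_def)
      qed
      then have "convex hull (vec_of ` G) \<subseteq> orth (convex hull (vec_of ` G0))"
        by (intro hull_minimal convex_orth convex_convex_hull)
      then have "orth (convex hull (vec_of ` G)) \<subseteq> orth (convex hull (vec_of ` G0))"
        using orth_mono orth_orth by blast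
      then have "good G0" using G unfolding good_def G0_def by blast
      then have "card G \<le> card G0" by (rule least)
      moreover have "card G0 < card G" unfolding G0_def using finG v by (intro card_Diff1_less)
      ultimately show False by simp
    qed
    have decomp: "\<exists>\<alpha> y w. x = \<alpha> *\<^sub>R vec_of v + (1 - \<alpha>) *\<^sub>R y + w \<and> 0 \<le> \<alpha> \<and> \<alpha> \<le> 1 \<and>
        (\<alpha> = 1 \<or> y \<in> convex hull (vec_of ` G0)) \<and> (\<forall>l. 0 \<le> w $ l)" if "x \<in> N" for x
    proof -
      obtain y w where yw: "x = y + w" "y \<in> convex hull (vec_of ` G)" "\<forall>l. 0 \<le> w $ l"
        using \<open>x \<in> N\<close> NG unfolding orth_def by blast
      have ins: "vec_of ` G = insert (vec_of v) (vec_of ` G0)" using v by (auto simp: G0_def)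
      show ?thesis
      proof (cases "G0 = {}")
        case True
        then have "y = vec_of v" using yw(2) ins by simp
        then show ?thesis using yw by (intro exI[of _ 1] exI[of _ 0] exI[of _ w]) auto
      next
        case False
        then obtain s t b where "y = s *\<^sub>R vec_of v + t *\<^sub>R b" "0 \<le> s" "0 \<le> t" "s + t = 1" "b \<in> convex hull (vec_of ` G0)"
          using yw(2) convex_hull_insert[of "vec_of ` G0" "vec_of v"] unfolding ins by auto
        then show ?thesis using yw
          by (intro exI[of _ s] exI[of _ b] exI[of _ w]) (auto simp: eq_diff_eq[symmetric])
      qed
    qed
    obtain \<alpha> y w where a: "a = \<alpha> *\<^sub>R vec_of v + (1 - \<alpha>) *\<^sub>R y + w" "0 \<le> \<alpha>" "\<alpha> \<le> 1"
      "\<alpha> = 1 \<or> y \<in> convex hull (vec_of ` G0)" "\<forall>l. 0 \<le> w $ l" using decomp[OF ab(1)] by blast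
    obtain \<beta> y' w' where b: "b = \<beta> *\<^sub>R vec_of v + (1 - \<beta>) *\<^sub>R y' + w'" "0 \<le> \<beta>" "\<beta> \<le> 1"
      "\<beta> = 1 \<or> y' \<in> convex hull (vec_of ` G0)" "\<forall>l. 0 \<le> w' $ l" using decomp[OF ab(2)] by blast
    obtain t where t: "0 < t" "t < 1" "vec_of v = (1 - t) *\<^sub>R a + t *\<^sub>R b" and ne: "a \<noteq> b"
      using ab(3) unfolding in_segment by blast
    define \<gamma> where "\<gamma> = (1 - t) * \<alpha> + t * \<beta>"
    define W where "W = (1 - t) *\<^sub>R w + t *\<^sub>R w'"
    have W: "0 \<le> W $ l" for l using t a(5) b(5) by (simp add: W_def)
    have \<gamma>1: "1 - \<gamma> = (1 - t) * (1 - \<alpha>) + t * (1 - \<beta>)" by (simp add: \<gamma>_def algebra_simps)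
    have v_eq: "(1 - \<gamma>) *\<^sub>R vec_of v = ((1 - t) * (1 - \<alpha>)) *\<^sub>R y + (t * (1 - \<beta>)) *\<^sub>R y' + W"
      using t(3) unfolding a(1) b(1) W_def \<gamma>_def by (simp add: algebra_simps)
    have nn: "0 \<le> (1 - t) * (1 - \<alpha>)" "0 \<le> t * (1 - \<beta>)" using t a b by auto
    show False
    proof (cases "\<gamma> = 1")
      case True
      then have "(1 - t) * (1 - \<alpha>) = 0" "t * (1 - \<beta>) = 0" using nn \<gamma>1 by linarith+
      then have \<alpha>\<beta>: "\<alpha> = 1" "\<beta> = 1" using t by auto
      then have "W = 0" using v_eq True by simp
      have "w = 0" "w' = 0"
      proof -
        have "(1 - t) * w $ l + t * w' $ l = 0" for l using \<open>W = 0\<close> unfolding W_def by (metis scaleR_conv_of_real vector_add_component vector_scaleR_component real_scaleR_def zero_index)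
        moreover have "0 \<le> (1 - t) * w $ l" "0 \<le> t * w' $ l" for l using t a(5) b(5) by auto
        ultimately have "(1 - t) * w $ l = 0 \<and> t * w' $ l = 0" for l by (smt (verit))
        then show "w = 0" "w' = 0" using t by (auto simp: vec_eq_iff)
      qed
      then show False using ne a(1) b(1) \<alpha>\<beta> by simp
    next
      case False
      then have g: "1 - \<gamma> > 0" using nn \<gamma>1 by linarith
      \<comment> \<open>divide by \<open>1 - \<gamma>\<close> to solve for \<open>v\<close>\<close>
      define p where "p = ((1 - t) * (1 - \<alpha>) / (1 - \<gamma>)) *\<^sub>R y + (t * (1 - \<beta>) / (1 - \<gamma>)) *\<^sub>R y'"
      have sum1: "(1 - t) * (1 - \<alpha>) / (1 - \<gamma>) + t * (1 - \<beta>) / (1 - \<gamma>) = 1"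
        using g \<gamma>1 by (simp add: add_divide_distrib[symmetric])
      have "p \<in> convex hull (vec_of ` G0)"
      proof (cases "\<alpha> = 1 \<or> \<beta> = 1")
        case True
        then show ?thesis
        proof
          assume "\<alpha> = 1"
          moreover from this have "\<beta> \<noteq> 1" using False by (auto simp: \<gamma>_def)
          ultimately show ?thesis using sum1 b(4) by (auto simp: p_def)
        next
          assume "\<beta> = 1"
          moreover from this have "\<alpha> \<noteq> 1" using False by (auto simp: \<gamma>_def)
          ultimately show ?thesis using sum1 a(4) by (auto simp: p_def)
        qed
      next
        case False
        then show ?thesis unfolding p_def using a(4) b(4) nn g sum1
          by (intro convexD convex_convex_hull) auto
      qed
      moreover have "vec_of v = p + (1 / (1 - \<gamma>)) *\<^sub>R W"
      proof -
        have "(1 - \<gamma>) *\<^sub>R (p + (1 / (1 - \<gamma>)) *\<^sub>R W) = (1 - \<gamma>) *\<^sub>R vec_of v"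
          using g unfolding v_eq p_def by (simp add: scaleR_add_right)
        then show ?thesis using g by (metis less_numeral_extra(3) scaleR_left_imp_eq)
      qed
      ultimately have "vec_of v \<in> orth (convex hull (vec_of ` G0))"
        using W g by (auto intro!: orthI)
      then show False using not by blast
    qed
  qed
  then have G_ext: "vec_of ` G \<subseteq> {x. x extreme_point_of N}" by blast
  define F where "F = {v \<in> V. vec_of v extreme_point_of N}"
  have F_eq: "{x. x extreme_point_of N} = vec_of ` F" using ext_V by (auto simp: F_def)
  have GF: "G \<subseteq> F" using G G_ext by (auto simp: F_def good_def)
  show ?thesis
  proof (rule that[of F])
    show "F \<subseteq> V" by (auto simp: F_def)
    have "G \<noteq> {}" using G V(2) by (auto simp: good_def orth_def)
    then show "F \<noteq> {}" using GF by blast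
    show "{x. x extreme_point_of N} = vec_of ` F" by (rule F_eq)
    show "vec_of v \<in> orth (convex hull (vec_of ` F))" if "v \<in> V" for v
      using G that orth_mono[OF hull_mono[OF image_mono[OF GF]]] unfolding good_def by blast
  qed
qed

section \<open>The region between two Newton polyhedra\<close>

text \<open>
  A point of \<open>S\<close> that leaves \<open>S\<close> under a translation by a short vector is close to the frontier of
  \<open>S\<close>, which is negligible.
\<close>

lemma convex_boundary_layer:
  fixes S :: "(real ^ 'n) set"
  assumes S: "convex S" and B: "bounded B" and e: "e > 0"
  obtains \<delta> where "\<delta> > 0" and "\<And>T a. \<lbrakk>T \<in> lmeasurable; T \<subseteq> B \<inter> S; norm a < \<delta>; \<And>y. y \<in> T \<Longrightarrow> y - a \<notin> S\<rbrakk>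
    \<Longrightarrow> measure lebesgue T < e"
proof -
  obtain R where R: "\<And>x. x \<in> B \<Longrightarrow> norm x \<le> R" using B unfolding bounded_iff by blast
  \<comment> \<open>the radius leaves room for translations of length at most 1\<close>
  define K where "K = frontier S \<inter> cball 0 (R + 1)"
  have negK: "negligible K"
    unfolding K_def by (rule negligible_subset[OF negligible_convex_frontier[OF S]]) auto
  have "closed K" by (simp add: K_def closed_Int)
  then have "frontier K \<subseteq> K" by (simp add: frontier_subset_eq)
  then have negF: "negligible (frontier K)" using negK negligible_subset by blast
  have "bounded K" unfolding K_def by (simp add: bounded_Int)
  obtain d where d: "d > 0" "\<And>T. \<lbrakk>T \<in> lmeasurable; \<And>y. y \<in> T \<Longrightarrow> \<exists>x. x \<in> K \<and> dist x y < d\<rbrakk>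
      \<Longrightarrow> measure lebesgue T < measure lebesgue K + e"
    using measure_semicontinuous_with_hausdist_explicit[OF \<open>bounded K\<close> negF e] by blast
  show ?thesis
  proof
    show "min d 1 > 0" using d(1) by simp
    fix T and a :: "real ^ 'n"
    assume T: "T \<in> lmeasurable" "T \<subseteq> B \<inter> S" "norm a < min d 1" "\<And>y. y \<in> T \<Longrightarrow> y - a \<notin> S"
    have "\<exists>x. x \<in> K \<and> dist x y < d" if y: "y \<in> T" for y
    proof -
      have "closed_segment (y - a) y \<inter> frontier S \<noteq> {}"
        using y T(2) T(4)[OF y] by (intro connected_Int_frontier) auto
      then obtain x where x: "x \<in> closed_segment (y - a) y" "x \<in> frontier S" by blast
      have "dist x y \<le> dist (y - a) y" using dist_in_closed_segment[OF x(1)] by simp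
      then have xy: "dist x y \<le> norm a" by (simp add: dist_norm)
      have "norm x \<le> norm y + dist x y" by (metis dist_norm norm_triangle_sub)
      also have "\<dots> \<le> R + 1" using R[of y] y T(2,3) xy by auto
      finally show ?thesis using x(2) xy T(3) by (auto simp: K_def)
    qed
    then have "measure lebesgue T < measure lebesgue K + e" using d(2) T(1) by blast
    then show "measure lebesgue T < e" using negligible_imp_measure0[OF negK] by simp
  qed
qed

lemma inner_nonneg_coords:
  fixes a w :: "real ^ 'n"
  assumes "\<And>l. 0 \<le> a $ l" "\<And>l. 0 \<le> w $ l"
  shows "0 \<le> a \<bullet> w"
  using assms by (simp add: inner_vec_def sum_nonneg)

text \<open>
  The ray through \<open>w\<close> meets the simplex spanned by the axis points in \<open>(1 / \<sigma>) w\<close>. If \<open>\<sigma> \<le> 1\<close>, then \<open>w\<close> lies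
  between the origin and this point; otherwise it lies beyond it, and \<open>w = (1 / \<sigma>) w + (1 - 1 / \<sigma>) w\<close>.
\<close>

lemma orthant_subset_cone_or_orth:
  fixes Q :: "(real ^ 'n::finite) set"
  assumes Q: "convex Q" and axes: "\<And>l. \<exists>\<alpha>\<ge>0. axis l \<alpha> \<in> Q" and w: "\<And>l. 0 \<le> w $ l"
  shows "w \<in> convex hull ({0} \<union> Q) \<or> w \<in> orth Q"
proof -
  obtain \<alpha> where \<alpha>: "\<And>l. \<alpha> l \<ge> 0" "\<And>l. axis l (\<alpha> l) \<in> Q" using axes by metis
  show ?thesis
  proof (cases "\<exists>l. \<alpha> l = 0")
    case True
    then have "0 \<in> Q" using \<alpha>(2) by (metis axis_eq_0_iff)
    then show ?thesis using orthI[of 0 Q w] w by simp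
  next
    case False
    then have pos: "\<alpha> l > 0" for l using \<alpha>(1)[of l] by (metis order_le_less)
    define \<sigma> where "\<sigma> = (\<Sum>l\<in>UNIV. w $ l / \<alpha> l)"
    have w_eq: "(\<Sum>l\<in>UNIV. (w $ l / \<alpha> l) *\<^sub>R axis l (\<alpha> l)) = w"
      using pos by (simp add: vec_eq_iff axis_def if_distrib[of "(*) _"] less_imp_neq[symmetric] cong: if_cong)
    have nonneg: "0 \<le> w $ l / \<alpha> l" for l using w pos[of l] by simp
    then have "0 \<le> \<sigma>" unfolding \<sigma>_def by (simp add: sum_nonneg)
    show ?thesis
    proof (cases "\<sigma> \<le> 1")
      case True
      have "(\<Sum>l\<in>UNIV. (w $ l / \<alpha> l) *\<^sub>R axis l (\<alpha> l)) + (1 - \<sigma>) *\<^sub>R 0 \<in> convex hull ({0} \<union> Q)"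
      proof (cases "\<sigma> = 0")
        case True
        then have "w $ l / \<alpha> l = 0" for l using nonneg unfolding \<sigma>_def by (simp add: sum_nonneg_eq_0_iff)
        then have "(\<Sum>l\<in>UNIV. (w $ l / \<alpha> l) *\<^sub>R axis l (\<alpha> l)) + (1 - \<sigma>) *\<^sub>R 0 = 0"
          by (simp only: scaleR_zero_left sum.neutral_const scaleR_zero_right add_0)
        then show ?thesis by (simp add: hull_inc)
      next
        case False
        then have "\<sigma> > 0" using \<open>0 \<le> \<sigma>\<close> by simp
        have "(\<Sum>l\<in>UNIV. (w $ l / \<alpha> l / \<sigma>) *\<^sub>R axis l (\<alpha> l)) \<in> convex hull ({0} \<union> Q)"
        proof (rule convex_sum)
          show "(\<Sum>l\<in>UNIV. w $ l / \<alpha> l / \<sigma>) = 1"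
            unfolding sum_divide_distrib[symmetric] \<sigma>_def[symmetric] using \<open>\<sigma> > 0\<close> by simp
        qed (use divide_nonneg_pos[OF nonneg \<open>\<sigma> > 0\<close>] \<alpha>(2) in \<open>auto intro: hull_inc simp del: divide_divide_eq_left\<close>)
        then have "\<sigma> *\<^sub>R (\<Sum>l\<in>UNIV. (w $ l / \<alpha> l / \<sigma>) *\<^sub>R axis l (\<alpha> l)) + (1 - \<sigma>) *\<^sub>R 0 \<in> convex hull ({0} \<union> Q)"
          using \<open>\<sigma> > 0\<close> \<open>\<sigma> \<le> 1\<close> by (intro convexD convex_convex_hull) (auto intro: hull_inc)
        then show ?thesis using \<open>\<sigma> > 0\<close> by (simp add: scaleR_sum_right)
      qed
      then show ?thesis using w_eq by simp
    next
      case False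
      then have \<sigma>: "\<sigma> > 1" by simp
      have "(\<Sum>l\<in>UNIV. (w $ l / \<alpha> l / \<sigma>) *\<^sub>R axis l (\<alpha> l)) \<in> Q"
      proof (rule convex_sum)
        show "(\<Sum>l\<in>UNIV. w $ l / \<alpha> l / \<sigma>) = 1"
          unfolding sum_divide_distrib[symmetric] \<sigma>_def[symmetric] using \<sigma> by simp
      qed (use divide_nonneg_pos[OF nonneg, of \<sigma>] \<sigma> \<alpha>(2) Q in \<open>auto simp del: divide_divide_eq_left\<close>)
      moreover have "(\<Sum>l\<in>UNIV. (w $ l / \<alpha> l / \<sigma>) *\<^sub>R axis l (\<alpha> l)) = (1 / \<sigma>) *\<^sub>R w"
      proof -
        have "(\<Sum>l\<in>UNIV. (w $ l / \<alpha> l / \<sigma>) *\<^sub>R axis l (\<alpha> l))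
            = (1 / \<sigma>) *\<^sub>R (\<Sum>l\<in>UNIV. (w $ l / \<alpha> l) *\<^sub>R axis l (\<alpha> l))"
          unfolding scaleR_sum_right by (intro sum.cong refl) simp
        then show ?thesis by (simp only: w_eq)
      qed
      ultimately have "(1 / \<sigma>) *\<^sub>R w + (1 - 1 / \<sigma>) *\<^sub>R w \<in> orth Q"
        using w \<sigma> by (intro orthI) auto
      then show ?thesis by (simp add: scaleR_add_left[symmetric])
    qed
  qed
qed

text \<open>
  This identity is where \<open>conv(0, Q)\<close> enters: the unbounded polyhedra may be replaced by polytopes. The
  inclusion from left to right is the preceding lemma. For the other one, let \<open>z = s c q + y\<close> with
  \<open>0 \<le> c \<le> 1\<close> be outside of \<open>S\<close> and separate it strictly from \<open>S\<close> by a functional \<open>a\<close>. Comparison with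
  \<open>s q + y\<close> shows \<open>a \<bullet> q > 0\<close>, and then comparison with the points \<open>s \<alpha> e\<^sub>l + y\<close> shows that all coordinates
  of \<open>a\<close> are positive. So \<open>a\<close> separates \<open>z\<close> from all of \<open>orth S\<close> as well.
\<close>

lemma orth_diff_eq_polytope_diff:
  fixes Q Y :: "(real ^ 'n::finite) set"
  assumes Q: "convex Q" "compact Q" and Y: "convex Y" "compact Y"
    and Q_nonneg: "\<And>q l. q \<in> Q \<Longrightarrow> 0 \<le> q $ l"
    and axes: "\<And>l. \<exists>\<alpha>\<ge>0. axis l \<alpha> \<in> Q" and s: "s > 0"
  defines "S \<equiv> {s *\<^sub>R q + y | q y. q \<in> Q \<and> y \<in> Y}"
    and "S0 \<equiv> {s *\<^sub>R q + y | q y. q \<in> convex hull ({0} \<union> Q) \<and> y \<in> Y}"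
  shows "orth Y - orth S = S0 - S"
proof (intro equalityI subsetI)
  fix z assume z: "z \<in> orth Y - orth S"
  then obtain y w where yw: "z = y + w" "y \<in> Y" "\<forall>l. 0 \<le> w $ l" unfolding orth_def by blast
  have "(1 / s) *\<^sub>R w \<in> convex hull ({0} \<union> Q) \<or> (1 / s) *\<^sub>R w \<in> orth Q"
    using yw(3) s by (intro orthant_subset_cone_or_orth[OF Q(1) axes]) auto
  moreover have "(1 / s) *\<^sub>R w \<notin> orth Q"
  proof
    assume "(1 / s) *\<^sub>R w \<in> orth Q"
    then obtain q w' where q: "(1 / s) *\<^sub>R w = q + w'" "q \<in> Q" "\<forall>l. 0 \<le> w' $ l" unfolding orth_def by blast
    have "w = s *\<^sub>R ((1 / s) *\<^sub>R w)" using s by simp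
    then have "z = (s *\<^sub>R q + y) + s *\<^sub>R w'" unfolding q(1) yw(1) by (simp add: algebra_simps)
    moreover have "s *\<^sub>R q + y \<in> S" unfolding S_def using q yw by blast
    ultimately have "z \<in> orth S" using q(3) s by (auto intro!: orthI)
    then show False using z by blast
  qed
  moreover have "z = s *\<^sub>R ((1 / s) *\<^sub>R w) + y" using s yw(1) by simp
  ultimately have "z \<in> S0" unfolding S0_def using yw(2) by blast
  moreover have "z \<notin> S" using z subset_orth by blast
  ultimately show "z \<in> S0 - S" by blast
next
  fix z assume z: "z \<in> S0 - S"
  have "Q \<noteq> {}" using axes by blast
  obtain p y where p: "z = s *\<^sub>R p + y" "p \<in> convex hull ({0} \<union> Q)" "y \<in> Y"
    using z unfolding S0_def by blast
  obtain q c where q: "p = c *\<^sub>R q" "0 \<le> c" "c \<le> 1" "q \<in> Q"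
    using p(2) \<open>Q \<noteq> {}\<close> convex_hull_insert_alt[of "0 :: real ^ 'n" Q] Q(1)
    by (auto simp: hull_same)
  have "z = y + (s * c) *\<^sub>R q" using p(1) q(1) by simp
  then have "z \<in> orth Y" using p(3) q s Q_nonneg by (auto intro!: orthI)
  moreover have "z \<notin> orth S"
  proof
    assume "z \<in> orth S"
    then obtain b w where b: "z = b + w" "b \<in> S" "\<forall>l. 0 \<le> w $ l" unfolding orth_def by blast
    have S_eq: "S = {x + y |x y. x \<in> (*\<^sub>R) s ` Q \<and> y \<in> Y}" unfolding S_def by blast
    have "compact ((*\<^sub>R) s ` Q)" using Q(2) compact_scaling by blast
    then have "compact S" using compact_sums Y(2) S_eq by simp
    have "{x + y |x y. x \<in> (*\<^sub>R) s ` Q \<and> y \<in> Y} = (\<Union>x\<in>(*\<^sub>R) s ` Q. \<Union>y\<in>Y. {x + y})" by blast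
    then have "convex S"
      using convex_sums[OF convex_scaling[OF Q(1), of s] Y(1)] S_eq by simp
    obtain a \<beta> where a: "a \<bullet> z < \<beta>" "\<And>x. x \<in> S \<Longrightarrow> \<beta> < a \<bullet> x"
      using separating_hyperplane_closed_point[OF \<open>convex S\<close> compact_imp_closed[OF \<open>compact S\<close>], of z] z by blast
    have "\<beta> < a \<bullet> (s *\<^sub>R q + y)" using q(4) p(3) by (intro a(2)) (auto simp: S_def)
    then have "a \<bullet> (s *\<^sub>R (c *\<^sub>R q) + y) < a \<bullet> (s *\<^sub>R q + y)" using a(1) p(1) q(1) by simp
    then have "s * (c * (a \<bullet> q)) < s * (a \<bullet> q)" by (simp add: inner_add_right)
    then have "c * (a \<bullet> q) < a \<bullet> q" using s by simp
    then have aq: "0 < a \<bullet> q" using q(2,3) by (smt (verit) mult_left_le_one_le mult_le_cancel_right1 mult_nonneg_nonpos mult_right_le_one_le)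
    have "0 \<le> a $ l" for l
    proof -
      obtain \<alpha> where \<alpha>: "\<alpha> \<ge> 0" "axis l \<alpha> \<in> Q" using axes by blast
      have "\<beta> < a \<bullet> (s *\<^sub>R axis l \<alpha> + y)" using \<alpha>(2) p(3) by (intro a(2)) (auto simp: S_def)
      then have "a \<bullet> (s *\<^sub>R (c *\<^sub>R q) + y) < a \<bullet> (s *\<^sub>R axis l \<alpha> + y)" using a(1) p(1) q(1) by simp
      then have "s * (c * (a \<bullet> q)) < s * (a $ l * \<alpha>)" by (simp add: inner_add_right inner_axis)
      then have "c * (a \<bullet> q) < a $ l * \<alpha>" using s by simp
      moreover have "0 \<le> c * (a \<bullet> q)" using aq q(2) by simp
      ultimately have "0 < a $ l * \<alpha>" by linarith
      then show ?thesis using \<alpha>(1) by (simp add: zero_less_mult_iff)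
    qed
    then have "0 \<le> a \<bullet> w" using b(3) by (intro inner_nonneg_coords) auto
    then have "a \<bullet> b \<le> a \<bullet> z" using b(1) by (simp add: inner_add_right)
    then show False using a(1) a(2)[OF b(2)] by linarith
  qed
  ultimately show "z \<in> orth Y - orth S" by blast
qed

section \<open>The Hilbert function of a staircase\<close>

lemma combs_cong:
  assumes "\<And>i. i < m \<Longrightarrow> u i = u' i"
  shows "combs m F u = combs m F u'"
  using assms unfolding combs_def by auto

lemma combs_add:
  assumes "x \<in> combs m F u" "y \<in> combs m F u'"
  shows "x + y \<in> combs m F (\<lambda>i. u i + u' i)"
proof -
  obtain a where a: "x = comb m F a" "a \<in> supported_on (Sigma {..<m} F)"
    "\<forall>i<m. multideg (Sigma {..<m} F) fst a i = u i" using assms(1) unfolding combs_def by blast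
  obtain b where b: "y = comb m F b" "b \<in> supported_on (Sigma {..<m} F)"
    "\<forall>i<m. multideg (Sigma {..<m} F) fst b i = u' i" using assms(2) unfolding combs_def by blast
  have "(\<lambda>p. a p + b p) \<in> supported_on (Sigma {..<m} F)"
    using a(2) b(2) by (simp add: supported_on_def)
  moreover have "\<forall>i<m. multideg (Sigma {..<m} F) fst (\<lambda>p. a p + b p) i = u i + u' i"
    using a(3) b(3) by (simp add: multideg_add)
  ultimately show ?thesis unfolding combs_def a(1) b(1) comb_add[symmetric] by blast
qed

lemma combs_0:
  assumes "\<forall>i<m. finite (F i)" and "\<forall>i<m. u i = 0"
  shows "combs m F u = {0}"
proof -
  have "a = (\<lambda>_. 0)" if "a \<in> supported_on (Sigma {..<m} F)" "\<forall>i<m. multideg (Sigma {..<m} F) fst a i = u i" for a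
  proof
    fix p
    show "a p = 0"
    proof (cases "p \<in> Sigma {..<m} F")
      case True
      then obtain i v where p: "p = (i, v)" "i < m" "v \<in> F i" by auto
      then have "(\<Sum>v\<in>F i. a (i, v)) = 0" using that(2) assms(2) by (simp add: multideg_Sigma)
      then show ?thesis using p assms(1) by simp
    next
      case False
      then show ?thesis using that(1) unfolding supported_on_def by blast
    qed
  qed
  note zero = this
  have "(\<lambda>_. 0) \<in> supported_on (Sigma {..<m} F)" "\<forall>i<m. multideg (Sigma {..<m} F) fst (\<lambda>_. 0) i = u i"
    using assms(2) by (simp_all add: supported_on_def multideg_def)
  then have "combs m F u = {comb m F (\<lambda>_. 0)}" unfolding combs_def using zero by blast
  then show ?thesis by (simp add: comb_def nat_scale_def)
qed

lemma comb_indicator: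
  assumes "finite (Sigma {..<m} F)" "i < m" "v \<in> F i"
  shows "comb m F (\<lambda>p. if p = (i, v) then 1 else 0) = v"
proof -
  have "comb m F (\<lambda>p. if p = (i, v) then 1 else 0) = (\<Sum>p\<in>Sigma {..<m} F. if p = (i, v) then snd p else 0)"
    unfolding comb_def by (intro sum.cong) (auto simp: nat_scale_def)
  then show ?thesis using assms by (simp add: sum.delta)
qed

lemma multideg_indicator:
  assumes "i' < m" "finite (F i')" "v \<in> F i"
  shows "multideg (Sigma {..<m} F) fst (\<lambda>p. if p = (i, v) then 1 else 0) i' = (if i' = i then 1 else 0)"
  using assms by (auto simp: multideg_Sigma sum.delta)

lemma combs_Suc:
  assumes fin: "\<forall>i<m. finite (F i)" and i: "i < m"
  shows "combs m F (u(i := Suc k)) = {x + v | x v. x \<in> combs m F (u(i := k)) \<and> v \<in> F i}"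
proof (intro equalityI subsetI)
  have finS: "finite (Sigma {..<m} F)" using fin by auto
  let ?\<delta> = "\<lambda>v p. if p = (i, v) then 1 else (0::nat)"
  fix x assume "x \<in> combs m F (u(i := Suc k))"
  then obtain a where a: "x = comb m F a" "a \<in> supported_on (Sigma {..<m} F)"
    "\<forall>i'<m. multideg (Sigma {..<m} F) fst a i' = (u(i := Suc k)) i'" unfolding combs_def by blast
  then have "(\<Sum>v\<in>F i. a (i, v)) = Suc k" using i by (simp add: multideg_Sigma)
  then obtain v where v: "v \<in> F i" "a (i, v) \<noteq> 0" by (metis sum.neutral Zero_not_Suc)
  define b where "b = a((i, v) := a (i, v) - 1)"
  have ab: "(\<lambda>p. b p + ?\<delta> v p) = a" using v(2) by (auto simp: b_def)
  have "comb m F (\<lambda>p. b p + ?\<delta> v p) = comb m F b + v"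
    unfolding comb_add using comb_indicator[where F = F, OF finS i v(1)] by simp
  then have x: "x = comb m F b + v" unfolding ab a(1) .
  have "multideg (Sigma {..<m} F) fst b i' = (u(i := k)) i'" if "i' < m" for i'
  proof -
    have "multideg (Sigma {..<m} F) fst (\<lambda>p. b p + ?\<delta> v p) i' = (u(i := Suc k)) i'"
      unfolding ab using a(3) that by blast
    then show ?thesis
      unfolding multideg_add using multideg_indicator[where F = F and i = i, OF that fin[rule_format, OF that] v(1)]
      by (auto split: if_splits)
  qed
  moreover have "b \<in> supported_on (Sigma {..<m} F)" using a(2) v i by (auto simp: supported_on_def b_def)
  ultimately have "comb m F b \<in> combs m F (u(i := k))" unfolding combs_def by blast
  then show "x \<in> {x + v | x v. x \<in> combs m F (u(i := k)) \<and> v \<in> F i}" using x v(1) by blast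
next
  have finS: "finite (Sigma {..<m} F)" using fin by auto
  let ?\<delta> = "\<lambda>v p. if p = (i, v) then 1 else (0::nat)"
  fix z assume "z \<in> {x + v | x v. x \<in> combs m F (u(i := k)) \<and> v \<in> F i}"
  then obtain x v where z: "z = x + v" and x: "x \<in> combs m F (u(i := k))" and v: "v \<in> F i" by blast
  have "comb m F (?\<delta> v) \<in> combs m F (\<lambda>i'. if i' = i then 1 else 0)"
    unfolding combs_def using v i fin
    by (intro CollectI exI[of _ "?\<delta> v"] conjI refl allI impI) (auto simp: supported_on_def multideg_indicator)
  then have "x + v \<in> combs m F (\<lambda>i'. (u(i := k)) i' + (if i' = i then 1 else 0))"
    using combs_add[OF x] comb_indicator[where F = F, OF finS i v] by metis
  moreover have "(\<lambda>i'. (u(i := k)) i' + (if i' = i then 1 else 0)) = u(i := Suc k)" by auto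
  ultimately show "z \<in> combs m F (u(i := Suc k))" using z by simp
qed

text \<open>
  The exponents of the monomials in \<open>I\<^sub>0\<^bsup>u 0\<^esup> \<dots> I\<^sub>m\<^sub>-\<^sub>1\<^bsup>u (m - 1)\<^esup>\<close>, where \<open>V i\<close> generates \<open>I\<^sub>i\<close>.
\<close>

definition staircase :: "nat \<Rightarrow> (nat \<Rightarrow> ('n \<Rightarrow>\<^sub>0 nat) set) \<Rightarrow> (nat \<Rightarrow> nat) \<Rightarrow> ('n \<Rightarrow>\<^sub>0 nat) set" where
  "staircase m V u = {x + w | x w. x \<in> combs m V u}"

lemma staircase_add:
  assumes "x \<in> staircase m V u" "y \<in> staircase m V u'"
  shows "x + y \<in> staircase m V (\<lambda>i. u i + u' i)"
proof -
  obtain a w b w' where "x = a + w" "a \<in> combs m V u" "y = b + w'" "b \<in> combs m V u'"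
    using assms unfolding staircase_def by blast
  moreover have "x + y = (a + b) + (w + w')" if "x = a + w" "y = b + w'" using that by (simp add: ac_simps)
  ultimately show ?thesis unfolding staircase_def using combs_add by blast
qed

lemma staircase_add_exponent: "x \<in> staircase m V u \<Longrightarrow> x + w \<in> staircase m V u"
  unfolding staircase_def using add.assoc by blast

lemma staircase_cong: "(\<And>i. i < m \<Longrightarrow> u i = u' i) \<Longrightarrow> staircase m V u = staircase m V u'"
  unfolding staircase_def using combs_cong[of m u u' V] by simp

lemma staircase_Suc:
  assumes fin: "\<forall>i<m. finite (V i)" and i: "i < m"
  shows "staircase m V (u(i := Suc k)) = {x + v | x v. x \<in> staircase m V (u(i := k)) \<and> v \<in> V i}"
proof (intro equalityI subsetI)
  fix z assume "z \<in> staircase m V (u(i := Suc k))"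
  then obtain x v w where "z = x + v + w" "x \<in> combs m V (u(i := k))" "v \<in> V i"
    unfolding staircase_def combs_Suc[where F = V, OF fin i] by blast
  moreover from this have "z = (x + w) + v" by (simp add: ac_simps)
  ultimately show "z \<in> {x + v | x v. x \<in> staircase m V (u(i := k)) \<and> v \<in> V i}"
    unfolding staircase_def by blast
next
  fix z assume "z \<in> {x + v | x v. x \<in> staircase m V (u(i := k)) \<and> v \<in> V i}"
  then obtain x v w where "z = x + w + v" "x \<in> combs m V (u(i := k))" "v \<in> V i"
    unfolding staircase_def by blast
  moreover from this have "z = (x + v) + w" by (simp add: ac_simps)
  ultimately show "z \<in> staircase m V (u(i := Suc k))"
    unfolding staircase_def combs_Suc[where F = V, OF fin i] by blast
qed

lemma staircase_antimono_0:
  assumes fin: "\<forall>i<m. finite (V i)" and i: "i < m" and "j \<le> k"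
  shows "staircase m V (u(i := k)) \<subseteq> staircase m V (u(i := j))"
  using \<open>j \<le> k\<close>
proof (induction rule: dec_induct)
  case (step k)
  have "staircase m V (u(i := Suc k)) \<subseteq> staircase m V (u(i := k))"
    unfolding staircase_Suc[where V = V, OF fin i] using staircase_add_exponent[where m = m and V = V] by blast
  then show ?case using step.IH by blast
qed simp

text \<open>
  Exponents \<open>V i\<close> generating monomial ideals \<open>I\<^sub>0, \<dots>, I\<^sub>m\<^sub>-\<^sub>1\<close>, and subsets \<open>F i\<close> that span the same Newton
  polyhedra; in the application these are the vertices. The last assumption, a pure power of every
  variable in \<open>I\<^sub>0\<close>, is what remains of \<open>I\<^sub>0\<close> being primary to the maximal ideal.
\<close>

locale newton_system =
  fixes m :: nat and V F :: "nat \<Rightarrow> ('n::finite \<Rightarrow>\<^sub>0 nat) set"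
  assumes m: "0 < m"
    and finV: "\<forall>i<m. finite (V i)"
    and FV: "\<And>i. i < m \<Longrightarrow> F i \<subseteq> V i" and F_ne: "\<And>i. i < m \<Longrightarrow> F i \<noteq> {}"
    and cover: "\<And>i v. i < m \<Longrightarrow> v \<in> V i \<Longrightarrow> vec_of v \<in> orth (convex hull (vec_of ` F i))"
    and pure: "\<And>l. \<exists>v\<in>V 0. \<forall>l'. l' \<noteq> l \<longrightarrow> lookup v l' = 0"
begin

definition P :: "nat \<Rightarrow> (real ^ 'n) set" where
  "P i = convex hull (vec_of ` F i)"

definition axis_bound :: "'n \<Rightarrow> nat" where
  "axis_bound l = (SOME k. single l k \<in> V 0)"

lemma axis_bound: "single l (axis_bound l) \<in> V 0"
proof -
  obtain v where v: "v \<in> V 0" "\<forall>l'. l' \<noteq> l \<longrightarrow> lookup v l' = 0" using pure by blast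
  then have "v = single l (lookup v l)"
    by (intro poly_mapping_eqI) (auto simp: lookup_single when_def)
  then show ?thesis unfolding axis_bound_def using v(1) by (metis someI)
qed

lemma combs_single:
  "single l (k * axis_bound l) \<in> combs m V (\<lambda>i. if i = 0 then k else 0)"
proof (induction k)
  case 0
  then show ?case using combs_0[OF finV, of "\<lambda>i. 0"] by simp
next
  case (Suc k)
  have upd: "(\<lambda>i. if i = 0 then k else 0) = (\<lambda>_. 0)(0 := k)" "(\<lambda>i. if i = 0 then Suc k else 0) = (\<lambda>_. 0)(0 := Suc k)"
    for k :: nat by auto
  have "single l (k * axis_bound l) + single l (axis_bound l) \<in> combs m V (\<lambda>i. if i = 0 then Suc k else 0)"
    unfolding upd(2) combs_Suc[where F = V, OF finV m] using Suc axis_bound[of l] unfolding upd(1) by blast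
  then show ?case by (simp add: single_add[symmetric] add.commute)
qed

text \<open>
  A large exponent of one variable in \<open>w\<close> could be split off as a power of the pure power in \<open>I\<^sub>0\<close>.
  This bound makes all the differences of staircases below finite.
\<close>

lemma lookup_less_of_not_in_staircase:
  assumes x: "x \<in> combs m V (u(0 := j))" and nin: "x + w \<notin> staircase m V (u(0 := j + k))"
  shows "lookup w l < k * axis_bound l"
proof (rule ccontr)
  assume ge: "\<not> ?thesis"
  define s where "s = single l (k * axis_bound l)"
  have w: "w = s + (w - s)"
    using ge by (intro poly_mapping_eqI) (auto simp: s_def lookup_add lookup_minus lookup_single when_def)
  have "x + s \<in> combs m V (\<lambda>i. (u(0 := j)) i + (if i = 0 then k else 0))"
    unfolding s_def by (intro combs_add x combs_single)
  moreover have "(\<lambda>i. (u(0 := j)) i + (if i = 0 then k else 0)) = u(0 := j + k)" by auto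
  ultimately have "x + s + (w - s) \<in> staircase m V (u(0 := j + k))" unfolding staircase_def by auto
  then show False using nin w by (metis add.assoc)
qed

text \<open>
  The length of \<open>I\<^sub>0\<^bsup>u 0\<^esup> M / I\<^sub>0\<^bsup>u 0 + 1\<^esup> M\<close>, where \<open>M = I\<^sub>1\<^bsup>u 1\<^esup> \<dots> I\<^sub>m\<^sub>-\<^sub>1\<^bsup>u (m - 1)\<^esup>\<close>.
\<close>

definition hilbert :: "(nat \<Rightarrow> nat) \<Rightarrow> nat" where
  "hilbert u = card (staircase m V u - staircase m V (u(0 := u 0 + 1)))"

text \<open>
  The length of \<open>M / I\<^sub>0\<^bsup>u 0\<^esup> M\<close> for the same \<open>M\<close>. Unlike the Hilbert function it is asymptotic to a
  volume, and the Hilbert function is its difference in the first variable.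
\<close>

definition colength :: "(nat \<Rightarrow> nat) \<Rightarrow> nat" where
  "colength u = card (staircase m V (u(0 := 0)) - staircase m V u)"

lemma staircase_step_bounded:
  "staircase m V u - staircase m V (u(0 := u 0 + 1)) \<subseteq>
    {x + w | x w. x \<in> combs m V u \<and> (\<forall>l. lookup w l \<le> axis_bound l)}"
proof
  fix z assume z: "z \<in> staircase m V u - staircase m V (u(0 := u 0 + 1))"
  then obtain x w where xw: "z = x + w" "x \<in> combs m V u" unfolding staircase_def by blast
  have "lookup w l < 1 * axis_bound l" for l
    using xw z by (intro lookup_less_of_not_in_staircase[of x u "u 0"]) auto
  then show "z \<in> {x + w | x w. x \<in> combs m V u \<and> (\<forall>l. lookup w l \<le> axis_bound l)}"
    using xw by (auto intro: less_imp_le)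
qed

lemma finite_staircase_step: "finite (staircase m V u - staircase m V (u(0 := u 0 + 1)))"
proof (rule finite_subset[OF staircase_step_bounded])
  have "{x + w | x w. x \<in> combs m V u \<and> (\<forall>l. lookup w l \<le> axis_bound l)}
      = (\<lambda>(x, w). x + w) ` (combs m V u \<times> {w. \<forall>l. lookup w l \<le> axis_bound l})" by auto
  moreover have "finite (combs m V u)" using finV by (intro finite_combs) blast
  ultimately show "finite {x + w | x w. x \<in> combs m V u \<and> (\<forall>l. lookup w l \<le> axis_bound l)}"
    using finite_bounded_exponents[of axis_bound] by simp
qed

text \<open>
  Counting sums of generators applies: the exceptional set is the next staircase, and the elements
  \<open>w\<close> range over a box because of the pure powers.
\<close>

lemma sep_poly_hilbert: "sep_poly m (\<lambda>u. real (hilbert u))"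
proof -
  let ?G = "Sigma {..<m} V" and ?W = "{w. \<forall>l. lookup w l \<le> axis_bound l}"
  let ?bad = "\<lambda>u x. x \<in> staircase m V (u(0 := u 0 + 1))"
  have finG: "finite ?G" using finV by auto
  have bad: "?bad (\<lambda>i. u i + multideg ?G fst b i) (x + comb m V b)"
    if "?bad u x" "b \<in> supported_on ?G" for u x b
  proof -
    have "comb m V b \<in> combs m V (multideg ?G fst b)" using that(2) unfolding combs_def by blast
    then have "comb m V b + 0 \<in> staircase m V (multideg ?G fst b)" unfolding staircase_def by blast
    then have "x + comb m V b \<in> staircase m V (\<lambda>i. (u(0 := u 0 + 1)) i + multideg ?G fst b i)"
      using staircase_add[OF that(1)] by simp
    moreover have "(\<lambda>i. (u(0 := u 0 + 1)) i + multideg ?G fst b i)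
        = (\<lambda>i. u i + multideg ?G fst b i)(0 := u 0 + multideg ?G fst b 0 + 1)" by auto
    ultimately show ?thesis by simp
  qed
  have "sep_poly m (\<lambda>u. real (card {w + comb m V a | w a. w \<in> ?W \<and> a \<in> supported_on ?G \<and>
    (\<forall>i<m. multideg ?G fst a i = u i) \<and> \<not> ?bad (multideg ?G fst a) (w + comb m V a)}))"
    using finG finite_bounded_exponents[of axis_bound] bad
    by (intro sep_poly_count_sums) (auto simp: comb_add simp del: fun_upd_apply)
  moreover have "{w + comb m V a | w a. w \<in> ?W \<and> a \<in> supported_on ?G \<and>
      (\<forall>i<m. multideg ?G fst a i = u i) \<and> \<not> ?bad (multideg ?G fst a) (w + comb m V a)}
      = staircase m V u - staircase m V (u(0 := u 0 + 1))" (is "?A = ?B") for u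
  proof -
    have same: "staircase m V ((multideg ?G fst a)(0 := multideg ?G fst a 0 + 1)) = staircase m V (u(0 := u 0 + 1))"
      if "\<forall>i<m. multideg ?G fst a i = u i" for a
      using that m by (intro staircase_cong) auto
    show ?thesis
    proof (intro equalityI subsetI)
      fix z assume "z \<in> ?A"
      then obtain w a where z: "z = w + comb m V a" "a \<in> supported_on ?G" "\<forall>i<m. multideg ?G fst a i = u i"
        "\<not> ?bad (multideg ?G fst a) (w + comb m V a)" by blast
      then have "z \<notin> staircase m V (u(0 := u 0 + 1))" using same by simp
      moreover have "comb m V a \<in> combs m V u" using z unfolding combs_def by blast
      then have "z \<in> staircase m V u" unfolding staircase_def using z(1) add.commute by blast
      ultimately show "z \<in> ?B" by blast
    next
      fix z assume z: "z \<in> ?B"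
      then obtain x w where xw: "z = x + w" "x \<in> combs m V u" "w \<in> ?W"
        using staircase_step_bounded by blast
      then obtain a where a: "x = comb m V a" "a \<in> supported_on ?G" "\<forall>i<m. multideg ?G fst a i = u i"
        unfolding combs_def by blast
      have "z = w + comb m V a" using xw(1) a(1) by (simp add: add.commute)
      moreover have "\<not> ?bad (multideg ?G fst a) z" using z same[OF a(3)] by simp
      ultimately show "z \<in> ?A" using xw(3) a by blast
    qed
  qed
  ultimately show ?thesis unfolding hilbert_def by simp
qed

lemma staircase_difference:
  "finite (staircase m V (u(0 := 0)) - staircase m V (u(0 := k))) \<and>
   card (staircase m V (u(0 := 0)) - staircase m V (u(0 := k))) = (\<Sum>j<k. hilbert (u(0 := j)))"
proof (induction k)
  case (Suc k)
  let ?X = "\<lambda>k. staircase m V (u(0 := k))"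
  have "?X (Suc k) \<subseteq> ?X k" "?X k \<subseteq> ?X 0"
    using staircase_antimono_0[where V = V, OF finV m] by auto
  then have eq: "?X 0 - ?X (Suc k) = (?X 0 - ?X k) \<union> (?X k - ?X (Suc k))" by blast
  have fin: "finite (?X k - ?X (Suc k))" and "card (?X k - ?X (Suc k)) = hilbert (u(0 := k))"
    using finite_staircase_step[of "u(0 := k)"] by (simp_all add: hilbert_def)
  moreover have "(?X 0 - ?X k) \<inter> (?X k - ?X (Suc k)) = {}" by blast
  ultimately show ?case using Suc unfolding eq by (simp add: card_Un_disjoint del: fun_upd_apply)
qed simp

lemma colength_eq_sum_hilbert: "colength u = (\<Sum>j<u 0. hilbert (u(0 := j)))"
  using staircase_difference[of u "u 0"] by (simp add: colength_def)

lemma hilbert_eq_difference_colength: "real (hilbert u) = real (colength (u(0 := u 0 + 1))) - real (colength u)"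
  by (simp add: colength_eq_sum_hilbert)

lemma sep_poly_colength: "sep_poly m (\<lambda>u. real (colength u))"
proof -
  have "real (colength u) = (if 1 \<le> u 0 then (\<Sum>j\<le>(u(0 := u 0 - 1)) 0. real (hilbert ((u(0 := u 0 - 1))(0 := j)))) else 0)" for u
    by (cases "u 0") (simp_all add: colength_eq_sum_hilbert lessThan_Suc_atMost)
  then show ?thesis
    using sep_poly_shift[OF sep_poly_partial_sums[OF sep_poly_hilbert m] m, of 1] by (simp only:)
qed

end

section \<open>Asymptotics of the colength\<close>

lemma minkowski_comb_subset_orth:
  fixes Q P :: "nat \<Rightarrow> (real ^ 'n::finite) set"
  assumes QP: "\<forall>i<m. Q i \<subseteq> orth (P i)" and t: "\<forall>i<m. 0 \<le> t i"
  shows "minkowski_comb m Q t \<subseteq> orth (minkowski_comb m P t)"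
proof
  fix z assume "z \<in> minkowski_comb m Q t"
  then obtain x where x: "\<forall>i<m. x i \<in> Q i" "z = (\<Sum>i<m. t i *\<^sub>R x i)" unfolding minkowski_comb_def by blast
  have "\<forall>i. \<exists>y w. i < m \<longrightarrow> x i = y + w \<and> y \<in> P i \<and> (\<forall>l. 0 \<le> w $ l)"
    using x(1) QP unfolding orth_def by blast
  then obtain y w where yw: "\<forall>i<m. x i = y i + w i \<and> y i \<in> P i \<and> (\<forall>l. 0 \<le> w i $ l)" by metis
  have "z = (\<Sum>i<m. t i *\<^sub>R y i) + (\<Sum>i<m. t i *\<^sub>R w i)"
    unfolding x(2) sum.distrib[symmetric] using yw by (intro sum.cong) (auto simp: scaleR_add_right)
  moreover have "(\<Sum>i<m. t i *\<^sub>R y i) \<in> minkowski_comb m P t" unfolding minkowski_comb_def using yw by blast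
  moreover have "0 \<le> (\<Sum>i<m. t i *\<^sub>R w i) $ l" for l
    using yw t by (auto intro!: sum_nonneg)
  ultimately show "z \<in> orth (minkowski_comb m P t)" by (auto intro!: orthI)
qed

lemma minkowski_comb_split_0:
  assumes m: "0 < m" and ne: "P 0 \<noteq> {}"
  shows "minkowski_comb m (P(0 := S)) t = {t 0 *\<^sub>R q + y | q y. q \<in> S \<and> y \<in> minkowski_comb m P (t(0 := 0))}"
proof -
  have split: "(\<Sum>i<m. f i) = f 0 + (\<Sum>i\<in>{..<m} - {0}. f i)" for f :: "nat \<Rightarrow> 'a"
    using sum.remove[of "{..<m}" 0 f] m by simp
  show ?thesis
  proof (intro equalityI subsetI)
    fix z assume "z \<in> minkowski_comb m (P(0 := S)) t"
    then obtain x where x: "\<forall>i<m. x i \<in> (P(0 := S)) i" "z = (\<Sum>i<m. t i *\<^sub>R x i)" unfolding minkowski_comb_def by blast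
    obtain p where p: "p \<in> P 0" using ne by blast
    have "(\<Sum>i<m. (t(0 := 0)) i *\<^sub>R (x(0 := p)) i) = (\<Sum>i\<in>{..<m} - {0}. t i *\<^sub>R x i)"
      unfolding split by (auto intro!: sum.cong)
    then have "z = t 0 *\<^sub>R x 0 + (\<Sum>i<m. (t(0 := 0)) i *\<^sub>R (x(0 := p)) i)"
      unfolding x(2) split[of "\<lambda>i. t i *\<^sub>R x i"] by simp
    moreover have "x 0 \<in> S" using x(1) m by auto
    moreover have "\<forall>i<m. (x(0 := p)) i \<in> P i" using x(1) p by auto
    ultimately show "z \<in> {t 0 *\<^sub>R q + y | q y. q \<in> S \<and> y \<in> minkowski_comb m P (t(0 := 0))}"
      unfolding minkowski_comb_def by blast
  next
    fix z assume "z \<in> {t 0 *\<^sub>R q + y | q y. q \<in> S \<and> y \<in> minkowski_comb m P (t(0 := 0))}"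
    then obtain q x where q: "q \<in> S" and x: "\<forall>i<m. x i \<in> P i" and z: "z = t 0 *\<^sub>R q + (\<Sum>i<m. (t(0 := 0)) i *\<^sub>R x i)"
      unfolding minkowski_comb_def by blast
    have "(\<Sum>i<m. (t(0 := 0)) i *\<^sub>R x i) = (\<Sum>i\<in>{..<m} - {0}. t i *\<^sub>R (x(0 := q)) i)"
      unfolding split by (auto intro!: sum.cong)
    then have "z = (\<Sum>i<m. t i *\<^sub>R (x(0 := q)) i)" unfolding z split[of "\<lambda>i. t i *\<^sub>R (x(0 := q)) i"] by simp
    moreover have "\<forall>i<m. (x(0 := q)) i \<in> (P(0 := S)) i" using x q by auto
    ultimately show "z \<in> minkowski_comb m (P(0 := S)) t" unfolding minkowski_comb_def by blast
  qed
qed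

context newton_system
begin

lemma finF: "i < m \<Longrightarrow> finite (F i)"
  using finV FV by (meson finite_subset)

lemma P_props: "i < m \<Longrightarrow> compact (P i) \<and> convex (P i) \<and> P i \<noteq> {}"
  using finF F_ne by (simp add: P_def finite_imp_compact_convex_hull)

lemma P_nonneg:
  assumes "q \<in> P i"
  shows "0 \<le> q $ l"
proof -
  have "convex {q :: real ^ 'n. 0 \<le> q $ l}"
    using convex_halfspace_ge[of 0 "axis l 1 :: real ^ 'n"] by (simp add: inner_axis inner_commute)
  then have "P i \<subseteq> {q. 0 \<le> q $ l}" unfolding P_def by (intro hull_minimal) auto
  then show ?thesis using assms by blast
qed

text \<open>
  A pure power is a point of an axis in \<open>P 0 + orthant\<close>; as all coordinates are nonnegative, its part
  in \<open>P 0\<close> lies on the same axis.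
\<close>

lemma P_0_meets_axes: "\<exists>\<alpha>\<ge>0. axis l \<alpha> \<in> P 0"
proof -
  let ?v = "single l (axis_bound l)"
  have "vec_of ?v \<in> orth (P 0)" unfolding P_def by (rule cover[OF m axis_bound])
  then obtain q w where qw: "vec_of ?v = q + w" "q \<in> P 0" "\<forall>l. 0 \<le> w $ l" unfolding orth_def by blast
  have "q $ l' = 0" if "l' \<noteq> l" for l'
  proof -
    have "q $ l' + w $ l' = vec_of ?v $ l'" unfolding qw(1) by simp
    also have "\<dots> = 0" using that by (simp add: lookup_single)
    finally show ?thesis using P_nonneg[OF qw(2), of l'] qw(3)[rule_format, of l'] by linarith
  qed
  then have "axis l (q $ l) = q" by (simp add: vec_eq_iff axis_def)
  then show ?thesis using qw(2) P_nonneg by metis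
qed

text \<open>
  The Newton polyhedron of \<open>I\<^sub>0\<^bsup>u 0\<^esup> \<dots> I\<^sub>m\<^sub>-\<^sub>1\<^bsup>u (m - 1)\<^esup>\<close>.
\<close>

definition NP :: "(nat \<Rightarrow> nat) \<Rightarrow> (real ^ 'n) set" where
  "NP u = orth (minkowski_comb m P (\<lambda>i. real (u i)))"

lemma convex_NP: "convex (NP u)"
  unfolding NP_def using P_props by (intro convex_orth convex_minkowski_comb) blast

lemma NP_scale: "k > 0 \<Longrightarrow> real k *\<^sub>R z \<in> NP (\<lambda>i. k * u i) \<longleftrightarrow> z \<in> NP u"
  by (auto simp: NP_def minkowski_comb_scale orth_scale image_iff)

lemma vec_of_staircase:
  assumes "x \<in> staircase m V u"
  shows "vec_of x \<in> NP u"
proof -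
  obtain y w where x: "x = y + w" "y \<in> combs m V u" using assms unfolding staircase_def by blast
  have V: "finite (V i) \<and> V i \<noteq> {}" if "i < m" for i using finV FV F_ne that by blast
  have "vec_of y \<in> minkowski_comb m (\<lambda>i. convex hull (vec_of ` V i)) (\<lambda>i. real (u i))"
    by (rule vec_of_combs_subset[of m V, OF V x(2)])
  moreover have "convex hull (vec_of ` V i) \<subseteq> orth (P i)" if "i < m" for i
    unfolding P_def using cover[OF that] by (intro hull_minimal convex_orth convex_convex_hull) auto
  then have "minkowski_comb m (\<lambda>i. convex hull (vec_of ` V i)) (\<lambda>i. real (u i)) \<subseteq> NP u"
    unfolding NP_def by (intro minkowski_comb_subset_orth) auto
  ultimately have "vec_of y \<in> NP u" by blast
  then show ?thesis unfolding x(1) vec_of_add NP_def by (rule orth_add) simp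
qed

lemma unit_cubes_staircase_subset: "unit_cubes (staircase m V u) \<subseteq> NP u"
proof
  fix z assume "z \<in> unit_cubes (staircase m V u)"
  then obtain x where x: "x \<in> staircase m V u" "\<forall>l. real (lookup x l) \<le> z $ l"
    unfolding unit_cubes_def by blast
  have "vec_of x + (z - vec_of x) \<in> NP u"
    unfolding NP_def by (rule orth_add) (use vec_of_staircase[OF x(1)] x(2) in \<open>auto simp: NP_def\<close>)
  then show "z \<in> unit_cubes (staircase m V u) \<Longrightarrow> z \<in> NP u" by simp
qed

lemma combs_mono: "combs m F u \<subseteq> combs m V u"
proof
  fix x assume "x \<in> combs m F u"
  then obtain a where a: "x = comb m F a" "a \<in> supported_on (Sigma {..<m} F)"
    "\<forall>i<m. multideg (Sigma {..<m} F) fst a i = u i" unfolding combs_def by blast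
  have sub: "Sigma {..<m} F \<subseteq> Sigma {..<m} V" using FV by auto
  have fin: "finite (Sigma {..<m} V)" using finV by auto
  have a0: "a p = 0" if "p \<notin> Sigma {..<m} F" for p using a(2) that unfolding supported_on_def by blast
  have "comb m F a = comb m V a"
    unfolding comb_def using fin sub
    by (rule sum.mono_neutral_left) (metis DiffD2 a0 lessThan_0 nat_scale_def sum.empty)
  moreover have "multideg (Sigma {..<m} V) fst a i = multideg (Sigma {..<m} F) fst a i" for i
    unfolding multideg_def using fin sub
    by (intro sum.mono_neutral_right ballI) (auto intro!: a0)
  moreover have "a \<in> supported_on (Sigma {..<m} V)" using a(2) sub unfolding supported_on_def by blast
  ultimately show "x \<in> combs m V u" using a unfolding combs_def by auto
qed

definition shift :: "real ^ 'n" where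
  "shift = (\<chi> l. real (rounding_bound m F))"

text \<open>
  Together with \<open>unit_cubes_staircase_subset\<close>, this squeezes the cubes at the points of the staircase
  between the Newton polyhedron and its translate by the constant vector \<open>shift\<close>.
\<close>

lemma NP_shift_subset:
  assumes "z - shift \<in> NP u"
  shows "z \<in> unit_cubes (staircase m V u)"
proof -
  obtain y w where yw: "z - shift = y + w" "y \<in> minkowski_comb m P (\<lambda>i. real (u i))" "\<forall>l. 0 \<le> w $ l"
    using assms unfolding NP_def orth_def by blast
  have F: "finite (F i) \<and> F i \<noteq> {}" if "i < m" for i using finF F_ne that by blast
  have "P = (\<lambda>i. convex hull (vec_of ` F i))" by (simp add: P_def fun_eq_iff)
  then obtain x where x: "x \<in> combs m F u" "\<And>l. \<bar>y $ l - vec_of x $ l\<bar> \<le> real (rounding_bound m F)"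
    using combs_approximate[of m F y u, OF F] yw(2) by auto
  have pos: "0 \<le> (z - vec_of x) $ l" for l
  proof -
    have "z $ l = y $ l + w $ l + real (rounding_bound m F)"
      using yw(1) by (simp add: shift_def vec_eq_iff) (metis add.commute add_diff_cancel_left' diff_add_cancel)
    then show ?thesis using x(2)[of l] yw(3)[rule_format, of l] by (simp add: abs_le_iff)
  qed
  obtain e where e: "\<And>l. real (lookup e l) \<le> (z - vec_of x) $ l" "\<And>l. (z - vec_of x) $ l < real (lookup e l) + 1"
    using floor_exponent[of "z - vec_of x"] pos by blast
  have "x + e \<in> staircase m V u" unfolding staircase_def using x(1) combs_mono by blast
  moreover have "real (lookup (x + e) l) \<le> z $ l \<and> z $ l < real (lookup (x + e) l) + 1" for l
    using e(1)[of l] e(2)[of l] by (simp add: lookup_add)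
  ultimately show ?thesis unfolding unit_cubes_def by blast
qed

lemma NP_difference:
  assumes "1 \<le> u 0"
  shows "NP (u(0 := 0)) - NP u = minkowski_comb m (P(0 := convex hull ({0} \<union> P 0))) (\<lambda>i. real (u i))
    - minkowski_comb m P (\<lambda>i. real (u i))"
proof -
  let ?t = "\<lambda>i. real (u i)"
  have t0: "(\<lambda>i. real ((u(0 := 0)) i)) = ?t(0 := 0)" by auto
  have ne: "P 0 \<noteq> {}" using P_props[OF m] by blast
  have Y: "compact (minkowski_comb m P (?t(0 := 0)))" "convex (minkowski_comb m P (?t(0 := 0)))"
    using P_props by (auto intro!: compact_minkowski_comb convex_minkowski_comb)
  have "minkowski_comb m P ?t = minkowski_comb m (P(0 := P 0)) ?t" by simp
  then have S: "minkowski_comb m P ?t = {real (u 0) *\<^sub>R q + y | q y. q \<in> P 0 \<and> y \<in> minkowski_comb m P (?t(0 := 0))}"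
    unfolding minkowski_comb_split_0[of m P, OF m ne] .
  show ?thesis
    unfolding NP_def t0 S minkowski_comb_split_0[of m P, OF m ne]
    by (rule orth_diff_eq_polytope_diff)
      (use P_props[OF m] Y P_nonneg P_0_meets_axes assms in auto)
qed

text \<open>
  After rescaling, the differences of staircases stay in a compact set that does not depend on \<open>k\<close>.
\<close>

lemma staircase_difference_bounded:
  assumes z: "real k *\<^sub>R z \<in> unit_cubes (staircase m V (\<lambda>i. k * (u(0 := 0)) i) - staircase m V (\<lambda>i. k * u i))"
    and k: "1 \<le> k"
  shows "z \<in> {y + b | y b. y \<in> minkowski_comb m (\<lambda>i. convex hull (vec_of ` V i)) (\<lambda>i. real ((u(0 := 0)) i)) \<and>
    b \<in> cbox 0 (\<chi> l. real (u 0 * axis_bound l) + 1)}"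
proof -
  obtain x w where x: "x \<in> combs m V (\<lambda>i. k * (u(0 := 0)) i)" "x + w \<notin> staircase m V (\<lambda>i. k * u i)"
    and zl: "\<And>l. real (lookup (x + w) l) \<le> real k * z $ l"
      "\<And>l. real k * z $ l < real (lookup (x + w) l) + 1"
    using z unfolding unit_cubes_def staircase_def[of m V "\<lambda>i. k * (u(0 := 0)) i"] by auto
  have upd: "(\<lambda>i. k * (u(0 := 0)) i) = (\<lambda>i. k * u i)(0 := 0)" "(\<lambda>i. k * u i) = (\<lambda>i. k * u i)(0 := 0 + k * u 0)" by auto
  have w: "lookup w l < (k * u 0) * axis_bound l" for l
    by (rule lookup_less_of_not_in_staircase[of x "\<lambda>i. k * u i" 0 w "k * u 0"]) (use x upd in simp_all)
  have V: "finite (V i) \<and> V i \<noteq> {}" if "i < m" for i using finV FV F_ne that by blast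
  let ?Q = "\<lambda>i. convex hull (vec_of ` V i)"
  have "vec_of x \<in> minkowski_comb m ?Q (\<lambda>i. real (k * (u(0 := 0)) i))"
    by (rule vec_of_combs_subset[of m V, OF V x(1)])
  then have "vec_of x \<in> (*\<^sub>R) (real k) ` minkowski_comb m ?Q (\<lambda>i. real ((u(0 := 0)) i))"
    unfolding of_nat_mult minkowski_comb_scale .
  then obtain y where y: "vec_of x = real k *\<^sub>R y" "y \<in> minkowski_comb m ?Q (\<lambda>i. real ((u(0 := 0)) i))" by blast
  have "z - y \<in> cbox 0 (\<chi> l. real (u 0 * axis_bound l) + 1)"
    unfolding mem_box_cart
  proof (intro allI conjI)
    fix l
    have yl: "real k * y $ l = real (lookup x l)" using y(1) by (metis vec_of_nth vector_scaleR_component real_scaleR_def)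
    have "0 \<le> real k * (z $ l - y $ l)" using zl(1)[of l] by (simp add: right_diff_distrib yl lookup_add)
    then show "(0 :: real ^ 'n) $ l \<le> (z - y) $ l" using k by (simp add: zero_le_mult_iff)
    have "real k * (z $ l - y $ l) \<le> real (lookup w l) + 1"
      using zl(2)[of l] by (simp add: right_diff_distrib yl lookup_add)
    also have "\<dots> \<le> real (k * u 0 * axis_bound l) + real k"
    proof (rule add_mono)
      show "real (lookup w l) \<le> real (k * u 0 * axis_bound l)"
        unfolding of_nat_le_iff by (rule less_imp_le) (rule w)
      show "1 \<le> real k" using k by simp
    qed
    also have "\<dots> = real k * (real (u 0 * axis_bound l) + 1)" by (simp add: algebra_simps)
    finally show "(z - y) $ l \<le> (\<chi> l. real (u 0 * axis_bound l) + 1) $ l" using k by simp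
  qed
  moreover have "z = y + (z - y)" by simp
  ultimately show ?thesis using y(2) by blast
qed

text \<open>
  The colength is the volume of the cubes between two staircases. After rescaling by \<open>k\<close>, this union
  of cubes and the region between the Newton polyhedra differ only in layers at the frontiers of the
  two convex sets, whose width is of order \<open>1 / k\<close>. By \<open>NP_difference\<close> the region is a difference of two
  polytopes.
\<close>

lemma colength_growth:
  assumes "1 \<le> u 0"
  shows "(\<lambda>k. real (colength (\<lambda>i. k * u i)) / real k ^ CARD('n)) \<longlonglongrightarrow>
    measure lebesgue (minkowski_comb m (P(0 := convex hull ({0} \<union> P 0))) (\<lambda>i. real (u i)))
    - measure lebesgue (minkowski_comb m P (\<lambda>i. real (u i)))"
proof -
  let ?B1 = "minkowski_comb m (P(0 := convex hull ({0} \<union> P 0))) (\<lambda>i. real (u i))"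
  let ?B2 = "minkowski_comb m P (\<lambda>i. real (u i))"
  let ?S0 = "NP (u(0 := 0))" and ?S1 = "NP u"
  define D where "D = ?S0 - ?S1"
  define X where "X k = staircase m V (\<lambda>i. k * (u(0 := 0)) i) - staircase m V (\<lambda>i. k * u i)" for k
  define T where "T k = (*\<^sub>R) (1 / real k) ` unit_cubes (X k)" for k
  have upd: "(\<lambda>i. k * (u(0 := 0)) i) = (\<lambda>i. k * u i)(0 := 0)" "(\<lambda>i. k * u i) = (\<lambda>i. k * u i)(0 := k * u 0)" for k by auto
  have finX: "finite (X k)" and cardX: "card (X k) = colength (\<lambda>i. k * u i)" for k
    using staircase_difference[of "\<lambda>i. k * u i" "k * u 0"]
    unfolding X_def upd(1) colength_def upd(2)[symmetric] by simp_all
  note cubes = measure_unit_cubes[OF finX]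
  have T_meas: "T k \<in> lmeasurable" "measure lebesgue (T k) = real (colength (\<lambda>i. k * u i)) / real k ^ CARD('n)" for k
  proof -
    have "linear ((*\<^sub>R) (1 / real k) :: real ^ 'n \<Rightarrow> real ^ 'n)" by (rule linear_scaleR)
    then show "T k \<in> lmeasurable" unfolding T_def
      by (rule measure_linear_sufficient[THEN conjunct1, OF _ cubes[THEN conjunct1], of _ "(1 / real k) ^ CARD('n)"])
        (use measure_lebesgue_affine[of "1 / real k" "0 :: real ^ 'n"] in simp)
    show "measure lebesgue (T k) = real (colength (\<lambda>i. k * u i)) / real k ^ CARD('n)"
      using measure_lebesgue_affine[of "1 / real k" 0 "unit_cubes (X k)"] cubes[of k]
      by (simp add: T_def cardX power_inverse divide_inverse mult.commute)
  qed
  have T_iff: "z \<in> T k \<longleftrightarrow> real k *\<^sub>R z \<in> unit_cubes (X k)" if "k \<ge> 1" for k z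
  proof
    assume "z \<in> T k"
    then show "real k *\<^sub>R z \<in> unit_cubes (X k)" using that by (auto simp: T_def)
  next
    assume "real k *\<^sub>R z \<in> unit_cubes (X k)"
    moreover have "z = (1 / real k) *\<^sub>R (real k *\<^sub>R z)" using that by simp
    ultimately show "z \<in> T k" unfolding T_def by blast
  qed
  \<comment> \<open>the limit region is a difference of two compact sets\<close>
  have D_eq: "D = ?B1 - ?B2" unfolding D_def by (rule NP_difference[of u, OF assms])
  have cB2: "compact ?B2" using P_props by (intro compact_minkowski_comb) blast
  have "compact (convex hull ({0} \<union> P 0))" using P_props[OF m] by (intro compact_convex_hull) auto
  then have cB1: "compact ?B1" using P_props by (intro compact_minkowski_comb) auto
  have B21: "?B2 \<subseteq> ?B1"
  proof
    fix z assume "z \<in> ?B2"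
    then obtain x where "\<forall>i<m. x i \<in> P i" "z = (\<Sum>i<m. real (u i) *\<^sub>R x i)" unfolding minkowski_comb_def by blast
    moreover from this have "\<forall>i<m. x i \<in> (P(0 := convex hull ({0} \<union> P 0))) i" by (auto intro: hull_inc)
    ultimately show "z \<in> ?B1" unfolding minkowski_comb_def by blast
  qed
  have lB: "?B1 \<in> lmeasurable" "?B2 \<in> lmeasurable" using cB1 cB2 lmeasurable_compact by auto
  have D_meas: "D \<in> lmeasurable" unfolding D_eq using lB by (rule fmeasurable.Diff)
  have D_vol: "measure lebesgue D = measure lebesgue ?B1 - measure lebesgue ?B2"
    unfolding D_eq using lB B21 by (intro measure_Diff) (auto simp: fmeasurable_def)
  define B where "B = D \<union> {y + b | y b. y \<in> minkowski_comb m (\<lambda>i. convex hull (vec_of ` V i)) (\<lambda>i. real ((u(0 := 0)) i)) \<and>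
    b \<in> cbox 0 (\<chi> l. real (u 0 * axis_bound l) + 1)}"
  have "bounded D" unfolding D_eq using cB1 by (meson Diff_subset bounded_subset compact_imp_bounded)
  moreover have "compact {y + b | y b. y \<in> minkowski_comb m (\<lambda>i. convex hull (vec_of ` V i)) (\<lambda>i. real ((u(0 := 0)) i)) \<and>
    b \<in> cbox 0 (\<chi> l. real (u 0 * axis_bound l) + 1)}"
    using finV by (intro compact_sums compact_minkowski_comb compact_cbox) (auto simp: finite_imp_compact_convex_hull)
  ultimately have bB: "bounded B" unfolding B_def by (simp add: compact_imp_bounded)
  have TB: "T k \<subseteq> B" if "k \<ge> 1" for k
    using staircase_difference_bounded[of k _ u] T_iff[OF that] that unfolding B_def X_def by blast
  have scale: "real k *\<^sub>R z - shift = real k *\<^sub>R (z - (1 / real k) *\<^sub>R shift)" if "k \<ge> 1" for k and z :: "real ^ 'n"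
    using that by (simp add: scaleR_diff_right)
  have out: "z - (1 / real k) *\<^sub>R shift \<notin> ?S1" "z \<in> ?S0" if k: "k \<ge> 1" and z: "z \<in> T k" for k z
  proof -
    obtain x where x: "x \<in> X k" "\<forall>l. real (lookup x l) \<le> (real k *\<^sub>R z) $ l \<and> (real k *\<^sub>R z) $ l < real (lookup x l) + 1"
      using z T_iff[OF k] unfolding unit_cubes_def by blast
    then have "real k *\<^sub>R z \<in> unit_cubes (staircase m V (\<lambda>i. k * (u(0 := 0)) i))"
      unfolding X_def unit_cubes_def by blast
    then have "real k *\<^sub>R z \<in> NP (\<lambda>i. k * (u(0 := 0)) i)" using unit_cubes_staircase_subset by blast
    then show "z \<in> ?S0" using NP_scale[of k z "u(0 := 0)"] k by simp
    have "real k *\<^sub>R z \<notin> unit_cubes (staircase m V (\<lambda>i. k * u i))"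
    proof
      assume "real k *\<^sub>R z \<in> unit_cubes (staircase m V (\<lambda>i. k * u i))"
      then obtain x' where x': "x' \<in> staircase m V (\<lambda>i. k * u i)" 
        "\<forall>l. real (lookup x' l) \<le> (real k *\<^sub>R z) $ l \<and> (real k *\<^sub>R z) $ l < real (lookup x' l) + 1"
        unfolding unit_cubes_def by blast
      then have "x' = x" using unit_cubes_unique x(2) by blast
      then show False using x(1) x'(1) by (simp add: X_def)
    qed
    then have "real k *\<^sub>R z - shift \<notin> NP (\<lambda>i. k * u i)" using NP_shift_subset by blast
    then show "z - (1 / real k) *\<^sub>R shift \<notin> ?S1"
      unfolding scale[OF k] using NP_scale[of k _ u] k by simp
  qed
  have out': "z - (1 / real k) *\<^sub>R shift \<notin> ?S0" if k: "k \<ge> 1" and z: "z \<in> D - T k" for k z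
  proof
    assume "z - (1 / real k) *\<^sub>R shift \<in> ?S0"
    then have "real k *\<^sub>R z - shift \<in> NP (\<lambda>i. k * (u(0 := 0)) i)"
      unfolding scale[OF k] using NP_scale[of k _ "u(0 := 0)"] k by simp
    then have "real k *\<^sub>R z \<in> unit_cubes (staircase m V (\<lambda>i. k * (u(0 := 0)) i))" by (rule NP_shift_subset)
    moreover have "real k *\<^sub>R z \<notin> NP (\<lambda>i. k * u i)" using z NP_scale[of k z u] k by (simp add: D_def)
    then have "real k *\<^sub>R z \<notin> unit_cubes (staircase m V (\<lambda>i. k * u i))" using unit_cubes_staircase_subset by blast
    ultimately have "real k *\<^sub>R z \<in> unit_cubes (X k)" unfolding unit_cubes_def X_def by blast
    then show False using z T_iff[OF k] by blast
  qed
  have "(\<lambda>k. measure lebesgue (T k)) \<longlonglongrightarrow> measure lebesgue D"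
  proof (rule tendstoI)
    fix e :: real assume e: "e > 0"
    obtain \<delta>0 where \<delta>0: "\<delta>0 > 0" "\<And>T a. \<lbrakk>T \<in> lmeasurable; T \<subseteq> B \<inter> ?S0; norm a < \<delta>0; \<And>y. y \<in> T \<Longrightarrow> y - a \<notin> ?S0\<rbrakk> \<Longrightarrow> measure lebesgue T < e"
      using convex_boundary_layer[OF convex_NP[of "u(0 := 0)"] bB e] by blast
    obtain \<delta>1 where \<delta>1: "\<delta>1 > 0" "\<And>T a. \<lbrakk>T \<in> lmeasurable; T \<subseteq> B \<inter> ?S1; norm a < \<delta>1; \<And>y. y \<in> T \<Longrightarrow> y - a \<notin> ?S1\<rbrakk> \<Longrightarrow> measure lebesgue T < e"
      using convex_boundary_layer[OF convex_NP[of u] bB e] by blast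
    have "(\<lambda>k. (1 / real k) *\<^sub>R shift) \<longlonglongrightarrow> 0 *\<^sub>R shift" by (intro tendsto_intros lim_1_over_n)
    then have "(\<lambda>k. norm ((1 / real k) *\<^sub>R shift)) \<longlonglongrightarrow> 0" using tendsto_norm_zero by fastforce
    then have "\<forall>\<^sub>F k in sequentially. norm ((1 / real k) *\<^sub>R shift) < min \<delta>0 \<delta>1"
      using \<delta>0(1) \<delta>1(1) by (intro order_tendstoD(2)) auto
    then show "\<forall>\<^sub>F k in sequentially. dist (measure lebesgue (T k)) (measure lebesgue D) < e"
      using eventually_ge_at_top[of 1]
    proof eventually_elim
      case (elim k)
      have lTD: "T k - D \<in> lmeasurable" "D - T k \<in> lmeasurable" using T_meas(1) D_meas by (auto intro: fmeasurable.Diff)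
      have "measure lebesgue (T k - D) < e"
        by (rule \<delta>1(2)[OF lTD(1)]) (use elim out[OF elim(2)] TB[OF elim(2)] in \<open>auto simp: D_def\<close>)
      moreover have "measure lebesgue (D - T k) < e"
        by (rule \<delta>0(2)[OF lTD(2)]) (use elim out'[OF elim(2)] in \<open>auto simp: D_def B_def\<close>)
      moreover have "measure lebesgue (T k) \<le> measure lebesgue (D \<union> (T k - D))" "measure lebesgue D \<le> measure lebesgue (T k \<union> (D - T k))"
        using T_meas(1) D_meas lTD by (auto intro!: measure_mono_fmeasurable fmeasurable.Un)
      moreover have "measure lebesgue (D \<union> (T k - D)) \<le> measure lebesgue D + measure lebesgue (T k - D)"
        "measure lebesgue (T k \<union> (D - T k)) \<le> measure lebesgue (T k) + measure lebesgue (D - T k)"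
        by (rule measure_Un_le; rule fmeasurableD; rule D_meas T_meas(1) lTD)+
      ultimately show ?case by (simp add: dist_real_def)
    qed
  qed
  then show ?thesis unfolding T_meas(2) D_vol .
qed

end

section \<open>The leading form of the Hilbert function\<close>

lemma sum_by_degree:
  assumes M: "finite M" "M \<subseteq> {n. \<forall>i\<ge>m. n i = 0}" and q: "\<And>n. n \<in> M \<Longrightarrow> D < (\<Sum>i<m. n i) \<Longrightarrow> q n = (0::real)"
  shows "(\<Sum>n\<in>M. q n * g n) = (\<Sum>k\<le>D. \<Sum>n\<in>multi_indices m k. (if n \<in> M then q n else 0) * g n)"
proof -
  have "(\<Sum>k\<le>D. \<Sum>n\<in>multi_indices m k. (if n \<in> M then q n else 0) * g n)
      = (\<Sum>n\<in>(\<Union>k\<le>D. multi_indices m k). (if n \<in> M then q n else 0) * g n)"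
    by (rule sum.UNION_disjoint[symmetric]) (auto simp: finite_multi_indices, auto simp: multi_indices_def)
  also have "\<dots> = (\<Sum>n\<in>M. q n * g n)"
  proof (rule sum.mono_neutral_cong)
    show "finite (\<Union>k\<le>D. multi_indices m k)" by (auto simp: finite_multi_indices)
    show "q n * g n = 0" if "n \<in> M - (\<Union>k\<le>D. multi_indices m k)" for n
      using q[of n] that M(2) by (cases "D < (\<Sum>i<m. n i)") (auto simp: multi_indices_def)
  qed (use M(1) in auto)
  finally show ?thesis by simp
qed

lemma power_ratio_tendsto:
  assumes "a \<le> b"
  shows "(\<lambda>k. real k ^ a / real k ^ b) \<longlonglongrightarrow> (if a = b then 1 else 0)"
  using poly_over_power_tendsto[of "monom 1 a" b] assms
  by (simp add: poly_monom degree_monom_eq)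

text \<open>
  Growth of the difference in the first variable: for a polynomial of degree \<open>d\<close> it has degree \<open>d - 1\<close>,
  and its leading form is the partial derivative of the leading form.
\<close>

lemma difference_growth:
  fixes M :: "(nat \<Rightarrow> nat) set" and u :: "nat \<Rightarrow> nat"
  assumes M: "finite M" and m: "0 < m" and d: "0 < d"
    and deg: "\<And>n. n \<in> M \<Longrightarrow> (\<Sum>i<m. n i) \<le> d"
  shows "(\<lambda>k. ((\<Sum>n\<in>M. q n * (\<Prod>i<m. real (((\<lambda>i. k * u i)(0 := k * u 0 + 1)) i) ^ n i))
      - (\<Sum>n\<in>M. q n * (\<Prod>i<m. real (k * u i) ^ n i))) / real k ^ (d - 1))
    \<longlonglongrightarrow> (\<Sum>n\<in>{n \<in> M. (\<Sum>i<m. n i) = d \<and> 0 < n 0}. q n * real (n 0) * (\<Prod>i<m. real (u i) ^ (n(0 := n 0 - 1)) i))"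
proof -
  define R where "R n = (\<Prod>i\<in>{..<m} - {0}. real (u i) ^ n i)" for n :: "nat \<Rightarrow> nat"
  define s where "s n = (\<Sum>i\<in>{..<m} - {0}. n i)" for n :: "nat \<Rightarrow> nat"
  have psplit: "(\<Prod>i<m. f i) = f 0 * (\<Prod>i\<in>{..<m} - {0}. f i)" for f :: "nat \<Rightarrow> real"
    using prod.remove[of "{..<m}" 0 f] m by simp
  have ssplit: "(\<Sum>i<m. n i) = n 0 + s n" for n :: "nat \<Rightarrow> nat"
    unfolding s_def using sum.remove[of "{..<m}" 0 n] m by simp
  have rest: "(\<Prod>i\<in>{..<m} - {0}. real (k * u i) ^ n i) = R n * real k ^ s n" for k n
    by (simp add: R_def s_def power_mult_distrib prod.distrib power_sum mult.commute)
  have rest': "(\<Prod>i\<in>{..<m} - {0}. real (((\<lambda>i. k * u i)(0 := k * u 0 + 1)) i) ^ n i) = R n * real k ^ s n" for k n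
    unfolding rest[symmetric] by (intro prod.cong) auto
  have binom: "(x + 1) ^ a - x ^ a = (\<Sum>j<a. real (a choose j) * x ^ j)" for x :: real and a
    using binomial_ring[of x 1 a] by (simp add: lessThan_Suc_atMost[symmetric])
  define T where "T k n = (\<Sum>j<n 0. q n * R n * real (n 0 choose j) * real (u 0) ^ j * (real k ^ (j + s n) / real k ^ (d - 1)))"
    for k and n :: "nat \<Rightarrow> nat"
  have eq: "((\<Sum>n\<in>M. q n * (\<Prod>i<m. real (((\<lambda>i. k * u i)(0 := k * u 0 + 1)) i) ^ n i))
      - (\<Sum>n\<in>M. q n * (\<Prod>i<m. real (k * u i) ^ n i))) / real k ^ (d - 1) = (\<Sum>n\<in>M. T k n)" for k
  proof -
    have "q n * (\<Prod>i<m. real (((\<lambda>i. k * u i)(0 := k * u 0 + 1)) i) ^ n i) - q n * (\<Prod>i<m. real (k * u i) ^ n i)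
        = q n * R n * real k ^ s n * ((real (k * u 0) + 1) ^ n 0 - real (k * u 0) ^ n 0)" for n
      unfolding psplit rest rest' by (simp add: algebra_simps)
    then have "(q n * (\<Prod>i<m. real (((\<lambda>i. k * u i)(0 := k * u 0 + 1)) i) ^ n i) - q n * (\<Prod>i<m. real (k * u i) ^ n i)) / real k ^ (d - 1) = T k n" for n
      unfolding T_def binom
      by (simp only: sum_distrib_left sum_divide_distrib) (auto intro!: sum.cong simp: power_add power_mult_distrib)
    then show ?thesis by (simp only: sum_subtractf[symmetric] sum_divide_distrib)
  qed
  define l where "l n = (if (\<Sum>i<m. n i) = d \<and> 0 < n 0 then q n * real (n 0) * (\<Prod>i<m. real (u i) ^ (n(0 := n 0 - 1)) i) else 0)" for n :: "nat \<Rightarrow> nat"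
  have "(\<lambda>k. T k n) \<longlonglongrightarrow> l n" if n: "n \<in> M" for n
  proof -
    have le: "j + s n \<le> d - 1" if "j < n 0" for j
      using deg[OF n] that unfolding ssplit by linarith
    have "(\<lambda>k. T k n) \<longlonglongrightarrow> (\<Sum>j<n 0. q n * R n * real (n 0 choose j) * real (u 0) ^ j * (if j + s n = d - 1 then 1 else 0))"
      unfolding T_def using le by (intro tendsto_sum tendsto_mult tendsto_const power_ratio_tendsto) auto
    also have "(\<Sum>j<n 0. q n * R n * real (n 0 choose j) * real (u 0) ^ j * (if j + s n = d - 1 then 1 else 0)) = l n"
    proof (cases "n 0 + s n = d \<and> 0 < n 0")
      case True
      have "(\<Sum>j<n 0. q n * R n * real (n 0 choose j) * real (u 0) ^ j * (if j + s n = d - 1 then 1 else 0))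
          = (\<Sum>j<n 0. if j = n 0 - 1 then q n * R n * real (n 0 choose j) * real (u 0) ^ j else 0)"
        using True by (intro sum.cong) auto
      also have "\<dots> = q n * R n * real (n 0 choose (n 0 - 1)) * real (u 0) ^ (n 0 - 1)"
        using True by simp
      also have "n 0 choose (n 0 - 1) = n 0"
        using True binomial_symmetric[of 1 "n 0"] by simp
      also have "q n * R n * real (n 0) * real (u 0) ^ (n 0 - 1) = l n"
        using True by (simp add: l_def ssplit psplit R_def)
      finally show ?thesis .
    next
      case False
      then have "j + s n \<noteq> d - 1" if "j < n 0" for j
        using that deg[OF n] unfolding ssplit by linarith
      then show ?thesis using False by (auto simp: l_def ssplit)
    qed
    finally show ?thesis .
  qed
  then have "(\<lambda>k. \<Sum>n\<in>M. T k n) \<longlonglongrightarrow> (\<Sum>n\<in>M. l n)" by (rule tendsto_sum)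
  also have "(\<Sum>n\<in>M. l n) = (\<Sum>n\<in>{n \<in> M. (\<Sum>i<m. n i) = d \<and> 0 < n 0}. q n * real (n 0) * (\<Prod>i<m. real (u i) ^ (n(0 := n 0 - 1)) i))"
    unfolding l_def by (rule sum.inter_filter[OF M, symmetric])
  finally show ?thesis unfolding eq .
qed

lemma homogeneous_coefficients_unique:
  assumes M: "finite M" "M \<subseteq> {n. \<forall>i\<ge>m. n i = 0}" and N: "finite N" "N \<subseteq> {n. \<forall>i\<ge>m. n i = 0}"
    and eq: "\<forall>u::nat \<Rightarrow> nat. (\<forall>i<m. U \<le> u i) \<longrightarrow>
      (\<Sum>n\<in>M. q n * (\<Prod>i<m. real (u i) ^ n i)) = (\<Sum>n\<in>N. p n * (\<Prod>i<m. real (u i) ^ n i))"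
  shows "(if n \<in> M then q n else 0) = (if n \<in> N then p n else (0::real))"
proof -
  let ?c = "\<lambda>n. (if n \<in> M then q n else 0) - (if n \<in> N then p n else 0)"
  have "\<forall>n\<in>M \<union> N. ?c n = 0"
  proof (rule monomial_sum_eq_0[where m = m and U = U])
    show "finite (M \<union> N)" "M \<union> N \<subseteq> {n. \<forall>i\<ge>m. n i = 0}" using M N by auto
    show "\<forall>u. (\<forall>i<m. U \<le> u i) \<longrightarrow> (\<Sum>n\<in>M \<union> N. ?c n * (\<Prod>i<m. real (u i) ^ n i)) = 0"
    proof (intro allI impI)
      fix u :: "nat \<Rightarrow> nat" assume u: "\<forall>i<m. U \<le> u i"
      have "(\<Sum>n\<in>M \<union> N. (if n \<in> M then q n else 0) * (\<Prod>i<m. real (u i) ^ n i)) = (\<Sum>n\<in>M. q n * (\<Prod>i<m. real (u i) ^ n i))"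
        using M(1) N(1) by (intro sum.mono_neutral_cong_right) auto
      moreover have "(\<Sum>n\<in>M \<union> N. (if n \<in> N then p n else 0) * (\<Prod>i<m. real (u i) ^ n i)) = (\<Sum>n\<in>N. p n * (\<Prod>i<m. real (u i) ^ n i))"
        using M(1) N(1) by (intro sum.mono_neutral_cong_right) auto
      ultimately show "(\<Sum>n\<in>M \<union> N. ?c n * (\<Prod>i<m. real (u i) ^ n i)) = 0"
        using eq u by (simp only: left_diff_distrib sum_subtractf)
    qed
  qed
  then show ?thesis by (cases "n \<in> M \<union> N") auto
qed

text \<open>
  The leading form of the colength is \<open>\<Sum>\<^sub>N d! / (\<Prod>\<^sub>i N\<^sub>i!) (VA N - VB N) u\<^sup>N\<close>. Its derivative in \<open>u 0\<close> is the leading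
  form of the Hilbert function. At \<open>u\<^sup>n\<close> it has the coefficient with \<open>N = n + e\<^sub>0\<close>, multiplied by
  \<open>n 0 + 1\<close>, and this factor turns \<open>(n 0 + 1)!\<close> into \<open>(n 0)!\<close>.
\<close>

lemma (in newton_system) hilbert_eventually_polynomial:
  assumes VA: "has_mixed_volumes m (P(0 := convex hull ({0} \<union> P 0))) VA" and VB: "has_mixed_volumes m P VB"
  shows "\<exists>q U. \<forall>u. (\<forall>i<m. U \<le> u i) \<longrightarrow> real (hilbert u) =
    (\<Sum>n\<in>multi_indices m (CARD('n) - 1). fact CARD('n) * (VA (n(0 := n 0 + 1)) - VB (n(0 := n 0 + 1)))
        / (\<Prod>i<m. fact (n i)) * (\<Prod>i<m. real (u i) ^ n i))
    + (\<Sum>k<CARD('n) - 1. \<Sum>n\<in>multi_indices m k. q n * (\<Prod>i<m. real (u i) ^ n i))"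
proof -
  let ?d = "CARD('n)"
  have d: "0 < ?d" by (simp add: card_gt_0_iff)
  define c where "c n = fact ?d / (\<Prod>i<m. fact (n i)) * (VA n - VB n)" for n
  from sep_poly_eventually_polynomial[OF sep_poly_colength] obtain M q U where MqU:
    "finite M \<and> M \<subseteq> {n. \<forall>i\<ge>m. n i = 0} \<and>
      (\<forall>u. (\<forall>i<m. U \<le> u i) \<longrightarrow> real (colength u) = (\<Sum>n\<in>M. q n * (\<Prod>i<m. real (u i) ^ n i)))"
    by (elim exE) (rule that)
  then have M: "finite M" "M \<subseteq> {n. \<forall>i\<ge>m. n i = 0}"
    and Lpoly: "\<forall>u. (\<forall>i<m. U \<le> u i) \<longrightarrow> real (colength u) = (\<Sum>n\<in>M. q n * (\<Prod>i<m. real (u i) ^ n i))"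
    by blast+
  define G where "G u = (\<Sum>n\<in>multi_indices m ?d. c n * (\<Prod>i<m. real (u i) ^ n i))" for u :: "nat \<Rightarrow> nat"
  have limL: "(\<lambda>k. real (colength (\<lambda>i. k * u i)) / real k ^ ?d) \<longlonglongrightarrow> G u" if u: "\<And>i. i < m \<Longrightarrow> 1 \<le> u i" for u
  proof -
    have "G u = measure lebesgue (minkowski_comb m (P(0 := convex hull ({0} \<union> P 0))) (\<lambda>i. real (u i)))
        - measure lebesgue (minkowski_comb m P (\<lambda>i. real (u i)))"
      using VA[unfolded has_mixed_volumes_def, rule_format, of "\<lambda>i. real (u i)"]
        VB[unfolded has_mixed_volumes_def, rule_format, of "\<lambda>i. real (u i)"]
      by (simp add: G_def c_def sum_subtractf[symmetric] algebra_simps diff_divide_distrib)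
    then show ?thesis using colength_growth[of u] u[OF m] by simp
  qed
  have q0: "q n = 0" if "n \<in> M" "?d < (\<Sum>i<m. n i)" for n
    by (rule leading_form_from_growth(1)[OF M, of U "\<lambda>u. real (colength u)" q ?d G]) (use Lpoly limL that in auto)
  have Gq: "G u = (\<Sum>n\<in>{n \<in> M. (\<Sum>i<m. n i) = ?d}. q n * (\<Prod>i<m. real (u i) ^ n i))" if "\<And>i. i < m \<Longrightarrow> 1 \<le> u i" for u
    by (rule leading_form_from_growth(2)[OF M, of U "\<lambda>u. real (colength u)" q ?d G]) (use Lpoly limL that in auto)
  have qc: "(if n \<in> {n \<in> M. (\<Sum>i<m. n i) = ?d} then q n else 0) = (if n \<in> multi_indices m ?d then c n else 0)" for n
    by (rule homogeneous_coefficients_unique[where m = m and U = 1])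
      (use M Gq in \<open>auto simp: finite_multi_indices G_def\<close>, auto simp: multi_indices_def)
  define M' where "M' = {n \<in> M. (\<Sum>i<m. n i) \<le> ?d}"
  have Lpoly': "real (colength u) = (\<Sum>n\<in>M'. q n * (\<Prod>i<m. real (u i) ^ n i))" if "\<forall>i<m. U \<le> u i" for u
  proof -
    have "(\<Sum>n\<in>M. q n * (\<Prod>i<m. real (u i) ^ n i)) = (\<Sum>n\<in>M'. q n * (\<Prod>i<m. real (u i) ^ n i))"
      using M(1) q0 by (intro sum.mono_neutral_right) (auto simp: M'_def not_le)
    then show ?thesis using Lpoly that by simp
  qed
  define G' where "G' u = (\<Sum>n\<in>multi_indices m (?d - 1). real (n 0 + 1) * c (n(0 := n 0 + 1)) * (\<Prod>i<m. real (u i) ^ n i))"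
    for u :: "nat \<Rightarrow> nat"
  have G'_eq: "(\<Sum>n\<in>{n \<in> M'. (\<Sum>i<m. n i) = ?d \<and> 0 < n 0}. q n * real (n 0) * (\<Prod>i<m. real (u i) ^ (n(0 := n 0 - 1)) i)) = G' u" for u
  proof -
    let ?N = "{n \<in> multi_indices m ?d. 0 < n 0}"
    have "(\<Sum>n\<in>{n \<in> M'. (\<Sum>i<m. n i) = ?d \<and> 0 < n 0}. q n * real (n 0) * (\<Prod>i<m. real (u i) ^ (n(0 := n 0 - 1)) i))
        = (\<Sum>n\<in>?N. c n * real (n 0) * (\<Prod>i<m. real (u i) ^ (n(0 := n 0 - 1)) i))"
    proof (rule sum.mono_neutral_cong_left)
      show "finite ?N" using finite_multi_indices by simp
      show "{n \<in> M'. (\<Sum>i<m. n i) = ?d \<and> 0 < n 0} \<subseteq> ?N" using M(2) by (auto simp: M'_def multi_indices_def)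
      show "\<forall>n\<in>?N - {n \<in> M'. (\<Sum>i<m. n i) = ?d \<and> 0 < n 0}. c n * real (n 0) * (\<Prod>i<m. real (u i) ^ (n(0 := n 0 - 1)) i) = 0"
      proof
        fix n assume n: "n \<in> ?N - {n \<in> M'. (\<Sum>i<m. n i) = ?d \<and> 0 < n 0}"
        then have "n \<notin> {n \<in> M. (\<Sum>i<m. n i) = ?d}" by (auto simp: M'_def)
        moreover have "n \<in> multi_indices m ?d" using n by blast
        ultimately have "c n = 0" using qc[of n] by presburger
        then show "c n * real (n 0) * (\<Prod>i<m. real (u i) ^ (n(0 := n 0 - 1)) i) = 0" by simp
      qed
      fix n assume n: "n \<in> {n \<in> M'. (\<Sum>i<m. n i) = ?d \<and> 0 < n 0}"
      then have "n \<in> multi_indices m ?d" "n \<in> {n \<in> M. (\<Sum>i<m. n i) = ?d}" using M(2) by (auto simp: M'_def multi_indices_def)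
      then have "q n = c n" using qc[of n] by simp
      then show "q n * real (n 0) * (\<Prod>i<m. real (u i) ^ (n(0 := n 0 - 1)) i) = c n * real (n 0) * (\<Prod>i<m. real (u i) ^ (n(0 := n 0 - 1)) i)" by simp
    qed
    also have "\<dots> = G' u"
      unfolding G'_def
    proof (rule sum.reindex_bij_witness[of _ "\<lambda>n. n(0 := n 0 + 1)" "\<lambda>n. n(0 := n 0 - 1)"])
      have deg: "(\<Sum>i<m. n i) = n 0 + (\<Sum>i\<in>{..<m} - {0}. n i)" for n :: "nat \<Rightarrow> nat"
        using sum.remove[of "{..<m}" 0 n] m by simp
      show "n(0 := n 0 - 1) \<in> multi_indices m (?d - 1)" if "n \<in> ?N" for n
        using that unfolding multi_indices_def mem_Collect_eq deg by auto
      show "n(0 := n 0 + 1) \<in> ?N" if "n \<in> multi_indices m (?d - 1)" for n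
        using that m d unfolding multi_indices_def mem_Collect_eq deg by auto
    qed (auto simp: fun_upd_idem)
    finally show ?thesis .
  qed
  \<comment> \<open>the Hilbert function is polynomial on its own account; only its top degree part is compared with \<open>G'\<close>\<close>
  from sep_poly_eventually_polynomial[OF sep_poly_hilbert] obtain M2 q2 U2 where MqU2:
    "finite M2 \<and> M2 \<subseteq> {n. \<forall>i\<ge>m. n i = 0} \<and>
      (\<forall>u. (\<forall>i<m. U2 \<le> u i) \<longrightarrow> real (hilbert u) = (\<Sum>n\<in>M2. q2 n * (\<Prod>i<m. real (u i) ^ n i)))"
    by (elim exE) (rule that)
  then have M2: "finite M2" "M2 \<subseteq> {n. \<forall>i\<ge>m. n i = 0}"
    and Hpoly: "\<forall>u. (\<forall>i<m. U2 \<le> u i) \<longrightarrow> real (hilbert u) = (\<Sum>n\<in>M2. q2 n * (\<Prod>i<m. real (u i) ^ n i))"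
    by blast+
  have limH: "(\<lambda>k. real (hilbert (\<lambda>i. k * u i)) / real k ^ (?d - 1)) \<longlonglongrightarrow> G' u" if u: "\<And>i. i < m \<Longrightarrow> 1 \<le> u i" for u
  proof -
    have "\<forall>\<^sub>F k in sequentially. ((\<Sum>n\<in>M'. q n * (\<Prod>i<m. real (((\<lambda>i. k * u i)(0 := k * u 0 + 1)) i) ^ n i))
        - (\<Sum>n\<in>M'. q n * (\<Prod>i<m. real (k * u i) ^ n i))) / real k ^ (?d - 1) = real (hilbert (\<lambda>i. k * u i)) / real k ^ (?d - 1)"
      using eventually_ge_at_top[of U]
    proof eventually_elim
      case (elim k)
      have ge: "\<forall>i<m. U \<le> k * u i"
        using elim u by (metis dual_order.trans mult.right_neutral mult_le_mono2)
      then have ge': "\<forall>i<m. U \<le> ((\<lambda>i. k * u i)(0 := k * u 0 + 1)) i" using m by auto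
      have "real (hilbert (\<lambda>i. k * u i)) = real (colength ((\<lambda>i. k * u i)(0 := k * u 0 + 1))) - real (colength (\<lambda>i. k * u i))"
        by (rule hilbert_eq_difference_colength)
      then show ?case unfolding Lpoly'[OF ge] Lpoly'[OF ge'] by simp
    qed
    moreover have "(\<lambda>k. ((\<Sum>n\<in>M'. q n * (\<Prod>i<m. real (((\<lambda>i. k * u i)(0 := k * u 0 + 1)) i) ^ n i))
        - (\<Sum>n\<in>M'. q n * (\<Prod>i<m. real (k * u i) ^ n i))) / real k ^ (?d - 1)) \<longlonglongrightarrow> G' u"
      unfolding G'_eq[symmetric] using M(1) by (intro difference_growth m d) (auto simp: M'_def)
    ultimately show ?thesis by (rule Lim_transform_eventually[rotated])
  qed
  have q20: "q2 n = 0" if "n \<in> M2" "?d - 1 < (\<Sum>i<m. n i)" for n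
    by (rule leading_form_from_growth(1)[OF M2, of U2 "\<lambda>u. real (hilbert u)" q2 "?d - 1" G']) (use Hpoly limH that in auto)
  have Gq2: "G' u = (\<Sum>n\<in>{n \<in> M2. (\<Sum>i<m. n i) = ?d - 1}. q2 n * (\<Prod>i<m. real (u i) ^ n i))" if "\<And>i. i < m \<Longrightarrow> 1 \<le> u i" for u
    by (rule leading_form_from_growth(2)[OF M2, of U2 "\<lambda>u. real (hilbert u)" q2 "?d - 1" G']) (use Hpoly limH that in auto)
  have q2c: "(if n \<in> {n \<in> M2. (\<Sum>i<m. n i) = ?d - 1} then q2 n else 0)
      = (if n \<in> multi_indices m (?d - 1) then real (n 0 + 1) * c (n(0 := n 0 + 1)) else 0)" for n
  proof (rule homogeneous_coefficients_unique[where m = m and U = 1])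
    show "\<forall>u. (\<forall>i<m. 1 \<le> u i) \<longrightarrow>
        (\<Sum>n\<in>{n \<in> M2. (\<Sum>i<m. n i) = ?d - 1}. q2 n * (\<Prod>i<m. real (u i) ^ n i))
        = (\<Sum>n\<in>multi_indices m (?d - 1). real (n 0 + 1) * c (n(0 := n 0 + 1)) * (\<Prod>i<m. real (u i) ^ n i))"
    proof (intro allI impI)
      fix u :: "nat \<Rightarrow> nat" assume "\<forall>i<m. 1 \<le> u i"
      then have "G' u = (\<Sum>n\<in>{n \<in> M2. (\<Sum>i<m. n i) = ?d - 1}. q2 n * (\<Prod>i<m. real (u i) ^ n i))"
        by (intro Gq2) blast
      then show "(\<Sum>n\<in>{n \<in> M2. (\<Sum>i<m. n i) = ?d - 1}. q2 n * (\<Prod>i<m. real (u i) ^ n i))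
          = (\<Sum>n\<in>multi_indices m (?d - 1). real (n 0 + 1) * c (n(0 := n 0 + 1)) * (\<Prod>i<m. real (u i) ^ n i))"
        unfolding G'_def by (rule sym)
    qed
    show "multi_indices m (?d - 1) \<subseteq> {n. \<forall>i\<ge>m. n i = 0}" by (auto simp: multi_indices_def)
  qed (use M2 in \<open>auto simp: finite_multi_indices\<close>)
  define q' where "q' n = (if n \<in> M2 then q2 n else 0)" for n
  have top: "q' n = fact ?d * (VA (n(0 := n 0 + 1)) - VB (n(0 := n 0 + 1))) / (\<Prod>i<m. fact (n i))"
    if n: "n \<in> multi_indices m (?d - 1)" for n
  proof -
    have "q' n = real (n 0 + 1) * c (n(0 := n 0 + 1))"
      using q2c[of n] n by (auto simp: q'_def multi_indices_def)
    moreover have "(\<Prod>i<m. fact ((n(0 := n 0 + 1)) i)) = real (n 0 + 1) * (\<Prod>i<m. fact (n i))"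
    proof -
      have psplit: "(\<Prod>i<m. f i) = f 0 * (\<Prod>i\<in>{..<m} - {0}. f i)" for f :: "nat \<Rightarrow> real"
        using prod.remove[of "{..<m}" 0 f] m by simp
      have "(\<Prod>i\<in>{..<m} - {0}. fact ((n(0 := n 0 + 1)) i)) = (\<Prod>i\<in>{..<m} - {0}. (fact (n i) :: real))"
        by (intro prod.cong) auto
      then show ?thesis unfolding psplit by simp
    qed
    ultimately show ?thesis by (simp add: c_def del: of_nat_add fun_upd_apply)
  qed
  have "real (hilbert u) = (\<Sum>n\<in>multi_indices m (?d - 1). fact ?d * (VA (n(0 := n 0 + 1)) - VB (n(0 := n 0 + 1)))
        / (\<Prod>i<m. fact (n i)) * (\<Prod>i<m. real (u i) ^ n i))
      + (\<Sum>k<?d - 1. \<Sum>n\<in>multi_indices m k. q' n * (\<Prod>i<m. real (u i) ^ n i))" if "\<forall>i<m. U2 \<le> u i" for u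
  proof -
    have "real (hilbert u) = (\<Sum>k\<le>?d - 1. \<Sum>n\<in>multi_indices m k. q' n * (\<Prod>i<m. real (u i) ^ n i))"
      using Hpoly that sum_by_degree[OF M2, of "?d - 1" q2 "\<lambda>n. \<Prod>i<m. real (u i) ^ n i"] q20 by (simp add: q'_def)
    also have "\<dots> = (\<Sum>k<?d - 1. \<Sum>n\<in>multi_indices m k. q' n * (\<Prod>i<m. real (u i) ^ n i))
        + (\<Sum>n\<in>multi_indices m (?d - 1). q' n * (\<Prod>i<m. real (u i) ^ n i))"
      by (simp only: lessThan_Suc_atMost[symmetric] sum.lessThan_Suc)
    finally show ?thesis using top by simp
  qed
  then show ?thesis by blast
qed

section \<open>Monomial ideals in the local ring at the origin\<close>

text \<open>
  At an exponent above no other exponent of \<open>f\<close>, only the constant term of \<open>g\<close> contributes.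
\<close>

lemma lookup_mult_of_minimal:
  fixes f g :: "('n \<Rightarrow>\<^sub>0 nat) \<Rightarrow>\<^sub>0 'k::field"
  assumes min: "\<And>l q. v = l + q \<Longrightarrow> q \<noteq> 0 \<Longrightarrow> lookup f l = 0"
  shows "lookup (f * g) v = lookup f v * lookup g 0"
proof -
  have "lookup f l * Sum_any (\<lambda>q. lookup g q when v = l + q)
      = (lookup f v * lookup g 0 when l = v)" for l
  proof (cases "lookup f l = 0")
    case True
    then show ?thesis by (cases "l = v") simp_all
  next
    case False
    then have "(v = l + q) \<longleftrightarrow> l = v \<and> q = 0" for q using False min[of l q] by (metis add.right_neutral)
    then show ?thesis by (cases "l = v") simp_all
  qed
  then show ?thesis by (simp add: lookup_mult)
qed

lemma lookup_mult_0:
  fixes f g :: "('n \<Rightarrow>\<^sub>0 nat) \<Rightarrow>\<^sub>0 'k::field"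
  shows "lookup (f * g) 0 = lookup f 0 * lookup g 0"
proof (rule lookup_mult_of_minimal)
  fix l q :: "'n \<Rightarrow>\<^sub>0 nat" assume "0 = l + q" "q \<noteq> 0"
  then have "lookup q i = 0" for i
    by (metis add_is_0 lookup_add lookup_zero)
  then have "q = 0" by (intro poly_mapping_eqI) simp
  with \<open>q \<noteq> 0\<close> show "lookup f l = 0" by simp
qed

lemma sum_single_keys: "(\<Sum>v\<in>keys f. single v (lookup f v)) = f"
proof (rule poly_mapping_eqI)
  fix w
  have "(\<Sum>v\<in>keys f. lookup (single v (lookup f v)) w)
      = (\<Sum>v\<in>keys f. if v = w then lookup f w else 0)"
    by (intro sum.cong) (auto simp: lookup_single when_def)
  then show "lookup (\<Sum>v\<in>keys f. single v (lookup f v)) w = lookup f w"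
    by (simp add: lookup_sum in_keys_iff)
qed

lemma origin_ideal_iff:
  fixes f :: "('n::finite, 'k::field) mpol"
  shows "f \<in> origin_ideal \<longleftrightarrow> lookup f 0 = 0"
proof
  assume "f \<in> origin_ideal"
  then obtain h where "f = (\<Sum>i\<in>UNIV. h i * var_pol i)" unfolding origin_ideal_def by blast
  moreover have "(single i 1 :: 'n \<Rightarrow>\<^sub>0 nat) \<noteq> 0" for i
    by (metis lookup_single_eq lookup_zero zero_neq_one)
  ultimately show "lookup f 0 = 0"
    by (simp add: lookup_sum lookup_mult_0 var_pol_def mono_pol_def lookup_single)
next
  assume 0: "lookup f 0 = 0"
  have "\<exists>i. 1 \<le> lookup v i" if "v \<in> keys f" for v
  proof (rule ccontr)
    assume "\<not> ?thesis"
    then have "v = 0" by (intro poly_mapping_eqI) (simp add: not_le)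
    then show False using that 0 by (simp add: in_keys_iff)
  qed
  then obtain i where i: "\<And>v. v \<in> keys f \<Longrightarrow> 1 \<le> lookup v (i v)" by metis
  define h where "h j = (\<Sum>v\<in>{v \<in> keys f. i v = j}.
    single (v - single j 1) (lookup f v))" for j
  have "h j * var_pol j = (\<Sum>v\<in>{v \<in> keys f. i v = j}. single v (lookup f v))" for j
  proof -
    have "v - single j 1 + single j 1 = v" if "v \<in> keys f" "i v = j" for v
      using i[OF that(1)] that(2) by (intro poly_mapping_eqI) (auto simp: lookup_add lookup_minus lookup_single when_def)
    then show ?thesis
      unfolding h_def var_pol_def mono_pol_def sum_distrib_right by (intro sum.cong) (auto simp: mult_single)
  qed
  then have "(\<Sum>j\<in>UNIV. h j * var_pol j) = f"
    using sum.group[of "keys f" UNIV i "\<lambda>v. single v (lookup f v)"]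
    by (simp add: sum_single_keys)
  then show "f \<in> origin_ideal" unfolding origin_ideal_def by blast
qed

definition upset :: "('n \<Rightarrow>\<^sub>0 nat) set \<Rightarrow> bool" where
  "upset E \<longleftrightarrow> (\<forall>e\<in>E. \<forall>w. e + w \<in> E)"

text \<open>
  For an up-closed set \<open>E\<close> of exponents, the ideal of the local ring generated by the monomials with
  exponents in \<open>E\<close>; here it is described by numerators supported on \<open>E\<close>.
\<close>

definition mono_ideal :: "('n \<Rightarrow>\<^sub>0 nat) set \<Rightarrow> ('n::{finite,linorder}, 'k::field) mpol fract set" where
  "mono_ideal E = {Fract f g | f g. keys f \<subseteq> E \<and> lookup g 0 \<noteq> 0}"

lemma keys_mult_upset:
  fixes f g :: "('n::{finite,linorder}, 'k::field) mpol"
  assumes "upset E" "keys f \<subseteq> E"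
  shows "keys (f * g) \<subseteq> E"
  using keys_mult[of f g] assms unfolding upset_def by blast

text \<open>
  This makes membership in a monomial ideal independent of the chosen fraction. An exponent of \<open>f\<close>
  outside of \<open>E\<close> of least total degree survives in \<open>f g\<close>.
\<close>

lemma keys_subset_of_mult:
  fixes f g :: "('n::{finite,linorder}, 'k::field) mpol"
  assumes E: "upset E" and fg: "keys (f * g) \<subseteq> E" and g: "lookup g 0 \<noteq> 0"
  shows "keys f \<subseteq> E"
proof (rule ccontr)
  assume "\<not> ?thesis"
  then obtain v0 where v0: "v0 \<in> keys f - E" by blast
  obtain v where v: "v \<in> keys f - E" and least: "\<And>w. w \<in> keys f - E \<Longrightarrow> total_degree v \<le> total_degree w"
    using ex_has_least_nat[of "\<lambda>v. v \<in> keys f - E" v0 total_degree] v0 by blast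
  have "lookup (f * g) v = lookup f v * lookup g 0"
  proof (rule lookup_mult_of_minimal)
    fix l q assume lq: "v = l + q" "q \<noteq> 0"
    have "total_degree v = total_degree l + total_degree q" by (simp add: lq(1) total_degree_add)
    moreover have "total_degree q \<noteq> 0" using lq(2) by (simp add: total_degree_eq_0_iff)
    ultimately have "\<not> total_degree v \<le> total_degree l" by simp
    then have "l \<notin> keys f - E" using least by blast
    moreover have "l \<notin> E" using E v lq(1) unfolding upset_def by blast
    ultimately show "lookup f l = 0" by (simp add: in_keys_iff)
  qed
  then have "v \<in> keys (f * g)" using v g by (simp add: in_keys_iff)
  then show False using fg v by blast
qed

lemma Fract_in_mono_ideal_iff:
  fixes f g :: "('n::{finite,linorder}, 'k::field) mpol"
  assumes E: "upset E" and g: "lookup g 0 \<noteq> 0"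
  shows "Fract f g \<in> mono_ideal E \<longleftrightarrow> keys f \<subseteq> E"
proof
  assume "Fract f g \<in> mono_ideal E"
  then obtain f' g' where *: "Fract f g = Fract f' g'" "keys f' \<subseteq> E" "lookup g' 0 \<noteq> 0"
    unfolding mono_ideal_def by blast
  have "g \<noteq> 0" "g' \<noteq> 0" using g *(3) by auto
  then have "f * g' = f' * g" using *(1) by (simp add: eq_fract)
  then have "keys (f * g') \<subseteq> E" using keys_mult_upset[OF E *(2), of g] by simp
  then show "keys f \<subseteq> E" using keys_subset_of_mult[OF E _ *(3)] by blast
qed (use g in \<open>auto simp: mono_ideal_def\<close>)

lemma loc_mono_in_mono_ideal_iff:
  "loc_mono v \<in> (mono_ideal E :: ('n::{finite,linorder}, 'k::field) mpol fract set) \<longleftrightarrow> v \<in> E" if "upset E"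
  unfolding loc_mono_def using that by (subst Fract_in_mono_ideal_iff) (auto simp: mono_pol_def)

lemma carrier_loc_ring: "carrier (loc_ring :: ('n::{finite,linorder}, 'k::field) mpol fract ring) = mono_ideal UNIV"
  by (auto simp: loc_ring_def mono_ideal_def origin_ideal_iff)

lemma loc_ring_simps:
  "mult loc_ring = (*)" "one loc_ring = 1" "zero loc_ring = 0" "add loc_ring = (+)"
  by (simp_all add: loc_ring_def)

lemma mono_ideal_0: "0 \<in> mono_ideal E"
proof -
  have "0 = Fract 0 1 \<and> keys 0 \<subseteq> E \<and> lookup 1 0 \<noteq> 0" by (simp add: Zero_fract_def)
  then show ?thesis unfolding mono_ideal_def by blast
qed

lemma mono_ideal_add:
  fixes x y :: "('n::{finite,linorder}, 'k::field) mpol fract"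
  assumes E: "upset E" and "x \<in> mono_ideal E" "y \<in> mono_ideal E"
  shows "x + y \<in> mono_ideal E"
proof -
  obtain f g where x: "x = Fract f g" "keys f \<subseteq> E" "lookup g 0 \<noteq> 0"
    using assms(2) unfolding mono_ideal_def by blast
  obtain f' g' where y: "y = Fract f' g'" "keys f' \<subseteq> E" "lookup g' 0 \<noteq> 0"
    using assms(3) unfolding mono_ideal_def by blast
  have "g \<noteq> 0" "g' \<noteq> 0" using x y by auto
  then have "x + y = Fract (f * g' + f' * g) (g * g')" using x y by simp
  moreover have "keys (f * g' + f' * g) \<subseteq> E"
    using keys_add[of "f * g'" "f' * g"] keys_mult_upset[OF E x(2), of g'] keys_mult_upset[OF E y(2), of g] by blast
  moreover have "lookup (g * g') 0 \<noteq> 0" using x(3) y(3) by (simp add: lookup_mult_0)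
  ultimately show ?thesis unfolding mono_ideal_def by blast
qed

lemma mono_ideal_mult:
  fixes x y :: "('n::{finite,linorder}, 'k::field) mpol fract"
  assumes "x \<in> mono_ideal E" "y \<in> mono_ideal E'"
  shows "x * y \<in> mono_ideal {a + b | a b. a \<in> E \<and> b \<in> E'}"
proof -
  obtain f g where x: "x = Fract f g" "keys f \<subseteq> E" "lookup g 0 \<noteq> 0"
    using assms(1) unfolding mono_ideal_def by blast
  obtain f' g' where y: "y = Fract f' g'" "keys f' \<subseteq> E'" "lookup g' 0 \<noteq> 0"
    using assms(2) unfolding mono_ideal_def by blast
  have "x * y = Fract (f * f') (g * g')" using x y by simp
  moreover have "keys (f * f') \<subseteq> {a + b | a b. a \<in> E \<and> b \<in> E'}"
    using keys_mult[of f f'] x(2) y(2) by blast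
  moreover have "lookup (g * g') 0 \<noteq> 0" using x(3) y(3) by (simp add: lookup_mult_0)
  ultimately show ?thesis unfolding mono_ideal_def by blast
qed

lemma mono_ideal_mono: "E \<subseteq> E' \<Longrightarrow> mono_ideal E \<subseteq> mono_ideal E'"
  unfolding mono_ideal_def by blast

lemma mono_ideal_smult:
  assumes "upset E" "a \<in> mono_ideal UNIV" "x \<in> mono_ideal E"
  shows "a * x \<in> mono_ideal E"
proof -
  have "{e + w | e w. e \<in> E \<and> w \<in> UNIV} \<subseteq> E" using assms(1) unfolding upset_def by blast
  from mono_ideal_mono[OF this] have "x * a \<in> mono_ideal E" using mono_ideal_mult[OF assms(3,2)] by (rule subsetD)
  then show ?thesis by (simp only: mult.commute)
qed

lemma upset_UNIV: "upset UNIV" by (simp add: upset_def)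

lemma one_in_mono_ideal: "1 \<in> mono_ideal UNIV"
proof -
  have "1 = Fract 1 1 \<and> keys 1 \<subseteq> UNIV \<and> lookup 1 0 \<noteq> 0" by (simp add: One_fract_def)
  then show ?thesis unfolding mono_ideal_def by blast
qed

lemma mono_ideal_uminus:
  assumes "x \<in> mono_ideal E"
  shows "- x \<in> mono_ideal E"
proof -
  obtain f g where "x = Fract f g" "keys f \<subseteq> E" "lookup g 0 \<noteq> 0"
    using assms unfolding mono_ideal_def by blast
  then show ?thesis unfolding mono_ideal_def
    by (intro CollectI exI[of _ "- f"] exI[of _ g]) (auto simp: in_keys_iff)
qed

lemma cring_loc_ring: "cring (loc_ring :: ('n::{finite,linorder}, 'k::field) mpol fract ring)"
proof (rule cringI)
  show "abelian_group (loc_ring :: ('n, 'k) mpol fract ring)"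
  proof (rule abelian_groupI)
    show "\<exists>y\<in>carrier loc_ring. y \<oplus>\<^bsub>loc_ring\<^esub> x = \<zero>\<^bsub>loc_ring\<^esub>" if "x \<in> carrier loc_ring" for x :: "('n, 'k) mpol fract"
      using that mono_ideal_uminus by (intro bexI[of _ "- x"]) (auto simp: loc_ring_simps carrier_loc_ring)
  qed (auto simp: loc_ring_simps carrier_loc_ring mono_ideal_add[OF upset_UNIV] mono_ideal_0 ac_simps)
  show "comm_monoid (loc_ring :: ('n, 'k) mpol fract ring)"
    by (rule comm_monoidI)
      (auto simp: loc_ring_simps carrier_loc_ring mono_ideal_smult[OF upset_UNIV] one_in_mono_ideal ac_simps)
qed (simp add: loc_ring_simps distrib_right)

lemma ideal_mono_ideal:
  assumes E: "upset E"
  shows "ideal (mono_ideal E :: ('n::{finite,linorder}, 'k::field) mpol fract set) loc_ring"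
proof -
  interpret cring "loc_ring :: ('n, 'k) mpol fract ring" by (rule cring_loc_ring)
  have inv: "\<ominus>\<^bsub>loc_ring\<^esub> x = - x" if "x \<in> carrier loc_ring" for x :: "('n, 'k) mpol fract"
  proof (rule minus_equality)
    show "- x \<oplus>\<^bsub>loc_ring\<^esub> x = \<zero>\<^bsub>loc_ring\<^esub>" by (simp add: loc_ring_simps)
    show "x \<in> carrier loc_ring" by (rule that)
    show "- x \<in> carrier loc_ring" using that mono_ideal_uminus by (simp add: carrier_loc_ring)
  qed
  have sub: "mono_ideal E \<subseteq> carrier (loc_ring :: ('n, 'k) mpol fract ring)"
    unfolding carrier_loc_ring by (rule mono_ideal_mono) simp
  show ?thesis
  proof (rule idealI)
    show "ring (loc_ring :: ('n, 'k) mpol fract ring)" by (rule ring_axioms)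
    show "subgroup (mono_ideal E) (add_monoid (loc_ring :: ('n, 'k) mpol fract ring))"
    proof (rule subgroup.intro)
      show "mono_ideal E \<subseteq> carrier (add_monoid (loc_ring :: ('n, 'k) mpol fract ring))" using sub by simp
      show "inv\<^bsub>add_monoid loc_ring\<^esub> x \<in> mono_ideal E" if "x \<in> mono_ideal E" for x :: "('n, 'k) mpol fract"
      proof -
        have "inv\<^bsub>add_monoid loc_ring\<^esub> x = - x" using inv[of x] that sub unfolding a_inv_def by blast
        then show ?thesis using mono_ideal_uminus[OF that] by simp
      qed
    qed (auto simp: loc_ring_simps mono_ideal_add[OF E] mono_ideal_0)
  next
    fix a x :: "('n, 'k) mpol fract" assume "a \<in> mono_ideal E" "x \<in> carrier loc_ring"
    then have "x * a \<in> mono_ideal E" by (intro mono_ideal_smult[OF E]) (simp_all add: carrier_loc_ring)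
    then show "x \<otimes>\<^bsub>loc_ring\<^esub> a \<in> mono_ideal E" "a \<otimes>\<^bsub>loc_ring\<^esub> x \<in> mono_ideal E"
      by (simp_all add: loc_ring_simps mult.commute)
  qed
qed

lemma mono_ideal_eq_genideal:
  fixes A :: "('n::{finite,linorder} \<Rightarrow>\<^sub>0 nat) set"
  shows "mono_ideal {a + w | a w. a \<in> A} = Idl\<^bsub>loc_ring\<^esub> ((loc_mono :: _ \<Rightarrow> ('n, 'k::field) mpol fract) ` A)"
proof -
  interpret cring "loc_ring :: ('n, 'k) mpol fract ring" by (rule cring_loc_ring)
  let ?E = "{a + w | a w. a \<in> A}"
  have E: "upset ?E" unfolding upset_def by (auto simp: add.assoc) (metis add.assoc)
  have mono: "(loc_mono :: _ \<Rightarrow> ('n, 'k) mpol fract) ` A \<subseteq> mono_ideal ?E"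
  proof (rule image_subsetI)
    fix a assume "a \<in> A"
    then have "a + 0 \<in> ?E" by blast
    then show "loc_mono a \<in> mono_ideal ?E" by (simp only: loc_mono_in_mono_ideal_iff[OF E] add_0_right)
  qed
  have carr: "(loc_mono :: _ \<Rightarrow> ('n, 'k) mpol fract) ` A \<subseteq> carrier loc_ring"
    using loc_mono_in_mono_ideal_iff[OF upset_UNIV] by (auto simp: carrier_loc_ring)
  show ?thesis
  proof
    show "Idl\<^bsub>loc_ring\<^esub> ((loc_mono :: _ \<Rightarrow> ('n, 'k) mpol fract) ` A) \<subseteq> mono_ideal ?E"
      by (rule genideal_minimal[OF ideal_mono_ideal[OF E] mono])
    let ?K = "Idl\<^bsub>loc_ring\<^esub> ((loc_mono :: _ \<Rightarrow> ('n, 'k) mpol fract) ` A)"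
    have K: "ideal ?K loc_ring" by (rule genideal_ideal[OF carr])
    have K_add: "x + y \<in> ?K" if "x \<in> ?K" "y \<in> ?K" for x y
      using additive_subgroup.a_closed[OF ideal.axioms(1)[OF K] that] by (simp add: loc_ring_simps)
    have K_0: "0 \<in> ?K" using additive_subgroup.zero_closed[OF ideal.axioms(1)[OF K]] by (simp add: loc_ring_simps)
    have K_mult: "a * x \<in> ?K" if "a \<in> mono_ideal UNIV" "x \<in> ?K" for a x
      using ideal.I_l_closed[OF K that(2), of a] that(1) by (simp add: loc_ring_simps carrier_loc_ring)
    have poly: "Fract (\<Sum>v\<in>X. single v (c v)) 1 \<in> ?K" if "finite X" "X \<subseteq> ?E" for X and c :: "_ \<Rightarrow> 'k"
      using that
    proof induction
      case empty
      then show ?case using K_0 by (simp add: Zero_fract_def)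
    next
      case (insert v X)
      obtain a w where v: "v = a + w" "a \<in> A" using insert.prems by blast
      have "Fract (single v (c v)) 1 = Fract (single w (c v)) 1 * loc_mono a"
        by (simp add: loc_mono_def mono_pol_def mult_single v(1) add.commute)
      moreover have "Fract (single w (c v)) 1 \<in> mono_ideal UNIV"
        by (subst Fract_in_mono_ideal_iff[OF upset_UNIV]) simp_all
      moreover have "loc_mono a \<in> ?K" using genideal_self[OF carr] v(2) by blast
      ultimately have "Fract (single v (c v)) 1 \<in> ?K" using K_mult by simp
      moreover have "Fract (\<Sum>v\<in>insert v X. single v (c v)) 1
          = Fract (single v (c v)) 1 + Fract (\<Sum>v\<in>X. single v (c v)) 1"
        using insert.hyps by simp
      moreover have "Fract (\<Sum>v\<in>X. single v (c v)) 1 \<in> ?K" using insert by blast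
      ultimately show ?case using K_add by metis
    qed
    show "mono_ideal ?E \<subseteq> ?K"
    proof
      fix x :: "('n, 'k) mpol fract" assume "x \<in> mono_ideal ?E"
      then obtain f g where x: "x = Fract f g" "keys f \<subseteq> ?E" "lookup g 0 \<noteq> 0"
        unfolding mono_ideal_def by blast
      have "Fract f 1 \<in> ?K"
        using poly[of "keys f" "lookup f"] x(2) by (simp add: sum_single_keys)
      moreover have "Fract 1 g \<in> mono_ideal UNIV" using x(3) unfolding mono_ideal_def by blast
      ultimately have "Fract 1 g * Fract f 1 \<in> ?K" using K_mult by blast
      then show "x \<in> ?K" using x(1) by simp
    qed
  qed
qed

section \<open>Length of quotients of monomial ideals\<close>

text \<open>
  The submodules of the field of fractions over the local ring. Those between \<open>N\<close> and \<open>I\<close> correspond to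
  the submodules of \<open>I / N\<close>, and on them the ring operations are those of the field.
\<close>

definition submod :: "('n::{finite,linorder}, 'k::field) mpol fract set \<Rightarrow> bool" where
  "submod D \<longleftrightarrow> 0 \<in> D \<and> (\<forall>x\<in>D. \<forall>y\<in>D. x + y \<in> D) \<and> (\<forall>a\<in>carrier loc_ring. \<forall>x\<in>D. a * x \<in> D)"

lemma submod_uminus: "submod D \<Longrightarrow> x \<in> D \<Longrightarrow> - x \<in> D"
proof -
  assume D: "submod D" and x: "x \<in> D"
  have "- 1 \<in> carrier loc_ring" unfolding carrier_loc_ring by (rule mono_ideal_uminus[OF one_in_mono_ideal])
  then have "(- 1) * x \<in> D" using D x unfolding submod_def by blast
  then show ?thesis by simp
qed

lemma submod_diff: "submod D \<Longrightarrow> x \<in> D \<Longrightarrow> y \<in> D \<Longrightarrow> x - y \<in> D"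
  using submod_uminus[of D y] unfolding submod_def diff_conv_add_uminus by blast

lemma submod_mono_ideal: "upset E \<Longrightarrow> submod (mono_ideal E)"
  unfolding submod_def carrier_loc_ring using mono_ideal_0 mono_ideal_add mono_ideal_smult by blast

definition residue_class :: "'a::ab_group_add set \<Rightarrow> 'a \<Rightarrow> 'a set" where
  "residue_class N x = {y. y - x \<in> N}"

abbreviation quot :: "('n::{finite,linorder}, 'k::field) mpol fract set \<Rightarrow> ('n, 'k) mpol fract set \<Rightarrow>
    (('n, 'k) mpol fract, ('n, 'k) mpol fract set) module" where
  "quot I N \<equiv> quot_module (ideal_module loc_ring I) N"

lemma coset_eq_residue_class: "N +>\<^bsub>ideal_module loc_ring I\<^esub> x = residue_class N x"
proof -
  have "(\<Union>h\<in>N. {h + x}) = residue_class N x"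
    unfolding residue_class_def by (auto intro: bexI[of _ "_ - x"])
  then show ?thesis
    by (simp add: a_r_coset_def r_coset_def ideal_module_def loc_ring_simps)
qed

lemma quot_simps:
  "carrier (quot I N) = residue_class N ` I"
  "zero (quot I N) = N"
  "add (quot I N) A B = {a + b | a b. a \<in> A \<and> b \<in> B}"
  "smult (quot I N) c X = (\<Union>x\<in>X. residue_class N (c * x))"
proof -
  have "a_rcosets\<^bsub>ideal_module loc_ring I\<^esub> N = (\<Union>x\<in>I. {N +>\<^bsub>ideal_module loc_ring I\<^esub> x})"
    unfolding A_RCOSETS_def RCOSETS_def a_r_coset_def by (simp add: ideal_module_def)
  then show "carrier (quot I N) = residue_class N ` I"
    unfolding quot_module_def coset_eq_residue_class by auto
  show "zero (quot I N) = N" by (simp add: quot_module_def)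
  show "add (quot I N) A B = {a + b | a b. a \<in> A \<and> b \<in> B}"
    unfolding quot_module_def by (auto simp: set_add_def set_mult_def ideal_module_def loc_ring_simps)
  show "smult (quot I N) c X = (\<Union>x\<in>X. residue_class N (c * x))"
    unfolding quot_module_def coset_eq_residue_class by (simp add: ideal_module_def loc_ring_simps)
qed

lemma residue_class_self: "submod N \<Longrightarrow> x \<in> residue_class N x"
  by (simp add: residue_class_def submod_def)

lemma residue_class_eq: 
  assumes N: "submod N" and y: "y \<in> residue_class N x"
  shows "residue_class N y = residue_class N x"
proof -
  have yx: "y - x \<in> N" using y by (simp add: residue_class_def)
  have "z - y \<in> N \<longleftrightarrow> z - x \<in> N" for z
  proof
    assume "z - y \<in> N"
    then have "(z - y) + (y - x) \<in> N" using N yx unfolding submod_def by blast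
    then show "z - x \<in> N" by simp
  next
    assume "z - x \<in> N"
    then have "(z - x) - (y - x) \<in> N" using submod_diff[OF N] yx by blast
    then show "z - y \<in> N" by simp
  qed
  then show ?thesis by (simp add: residue_class_def)
qed

lemma residue_class_add:
  assumes N: "submod N"
  shows "{a + b | a b. a \<in> residue_class N x \<and> b \<in> residue_class N y} = residue_class N (x + y)"
proof (intro equalityI subsetI)
  fix z assume "z \<in> {a + b | a b. a \<in> residue_class N x \<and> b \<in> residue_class N y}"
  then obtain a b where ab: "z = a + b" "a - x \<in> N" "b - y \<in> N" by (auto simp: residue_class_def)
  have "z - (x + y) = (a - x) + (b - y)" unfolding ab(1) by (simp add: algebra_simps)
  moreover have "(a - x) + (b - y) \<in> N" using ab N unfolding submod_def by blast
  ultimately show "z \<in> residue_class N (x + y)" unfolding residue_class_def mem_Collect_eq by (simp only:)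
next
  fix z assume z: "z \<in> residue_class N (x + y)"
  then have "z - y \<in> residue_class N x" by (simp add: residue_class_def algebra_simps)
  moreover have "z = (z - y) + y" by simp
  ultimately show "z \<in> {a + b | a b. a \<in> residue_class N x \<and> b \<in> residue_class N y}"
    using residue_class_self[OF N] by blast
qed

lemma residue_class_smult:
  assumes N: "submod N" and c: "c \<in> carrier loc_ring"
  shows "(\<Union>z\<in>residue_class N x. residue_class N (c * z)) = residue_class N (c * x)"
proof -
  have "residue_class N (c * z) = residue_class N (c * x)" if "z \<in> residue_class N x" for z
  proof (rule residue_class_eq[OF N])
    have "c * (z - x) \<in> N" using that N c unfolding residue_class_def submod_def by blast
    then show "c * z \<in> residue_class N (c * x)" by (simp add: residue_class_def right_diff_distrib)
  qed
  then show ?thesis using residue_class_self[OF N, of x] by blast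
qed

lemma residue_class_0: "submod N \<Longrightarrow> residue_class N 0 = N"
  by (simp add: residue_class_def)

lemma submodule_of_submod:
  assumes N: "submod N" and D: "submod D" "D \<subseteq> I"
  shows "submodule (residue_class N ` D) loc_ring (quot I N)"
proof (rule submodule.intro)
  show "subgroup (residue_class N ` D) (add_monoid (quot I N))"
  proof (rule subgroup.intro)
    show "residue_class N ` D \<subseteq> carrier (add_monoid (quot I N))"
      using D(2) by (auto simp: quot_simps)
    show "X \<otimes>\<^bsub>add_monoid (quot I N)\<^esub> Y \<in> residue_class N ` D"
      if "X \<in> residue_class N ` D" "Y \<in> residue_class N ` D" for X Y
      using that D(1) residue_class_add[OF N] unfolding submod_def by (auto simp: quot_simps)
    show "\<one>\<^bsub>add_monoid (quot I N)\<^esub> \<in> residue_class N ` D"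
      using residue_class_0[OF N] D(1) unfolding submod_def by (auto simp: quot_simps intro!: image_eqI[of _ _ 0])
    show "inv\<^bsub>add_monoid (quot I N)\<^esub> X \<in> residue_class N ` D" if "X \<in> residue_class N ` D" for X
    proof -
      obtain x where x: "x \<in> D" "X = residue_class N x" using \<open>X \<in> residue_class N ` D\<close> by blast
      have mx: "- x \<in> D" by (rule submod_uminus[OF D(1) x(1)])
      have "inv\<^bsub>add_monoid (quot I N)\<^esub> X = residue_class N (- x)"
        unfolding m_inv_def
      proof (rule the_equality)
        show "residue_class N (- x) \<in> carrier (add_monoid (quot I N)) \<and>
            X \<otimes>\<^bsub>add_monoid (quot I N)\<^esub> residue_class N (- x) = \<one>\<^bsub>add_monoid (quot I N)\<^esub> \<and>
            residue_class N (- x) \<otimes>\<^bsub>add_monoid (quot I N)\<^esub> X = \<one>\<^bsub>add_monoid (quot I N)\<^esub>"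
          using mx D(2) residue_class_add[OF N, of x "- x"] residue_class_add[OF N, of "- x" x] residue_class_0[OF N]
          by (auto simp: quot_simps x(2))
        fix Y assume Y: "Y \<in> carrier (add_monoid (quot I N)) \<and>
            X \<otimes>\<^bsub>add_monoid (quot I N)\<^esub> Y = \<one>\<^bsub>add_monoid (quot I N)\<^esub> \<and> Y \<otimes>\<^bsub>add_monoid (quot I N)\<^esub> X = \<one>\<^bsub>add_monoid (quot I N)\<^esub>"
        then obtain y where y: "Y = residue_class N y" by (auto simp: quot_simps)
        have "residue_class N (x + y) = N"
          using Y residue_class_add[OF N, of x y] by (simp add: quot_simps x(2) y)
        then have "x + y \<in> N" using residue_class_self[OF N] by blast
        then have "y \<in> residue_class N (- x)" by (simp add: residue_class_def add.commute)
        then show "Y = residue_class N (- x)" unfolding y by (rule residue_class_eq[OF N])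
      qed
      then show ?thesis using mx by blast
    qed
  qed
  show "submodule_axioms (residue_class N ` D) loc_ring (quot I N)"
    unfolding submodule_axioms_def using D(1) residue_class_smult[OF N] unfolding submod_def by (auto simp: quot_simps)
qed

lemma submod_of_submodule:
  assumes N: "submod N" and I: "submod I" "N \<subseteq> I" and C: "submodule C loc_ring (quot I N)"
  shows "submod (\<Union>C)" "N \<subseteq> \<Union>C" "\<Union>C \<subseteq> I" "C = residue_class N ` (\<Union>C)"
proof -
  have sub: "C \<subseteq> residue_class N ` I" and C_add: "\<And>X Y. X \<in> C \<Longrightarrow> Y \<in> C \<Longrightarrow> {a + b | a b. a \<in> X \<and> b \<in> Y} \<in> C"
    and C0: "N \<in> C"
    using submodule.axioms(1)[OF C] by (auto simp: subgroup_def quot_simps)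
  have C_mult: "(\<Union>x\<in>X. residue_class N (c * x)) \<in> C" if "c \<in> carrier loc_ring" "X \<in> C" for c X
    using submodule.smult_closed[OF C that] by (simp add: quot_simps)
  show "N \<subseteq> \<Union>C" using C0 by blast
  show "submod (\<Union>C)"
    unfolding submod_def
  proof (intro conjI ballI)
    show "0 \<in> \<Union>C" using C0 N unfolding submod_def by blast
    fix x assume x: "x \<in> \<Union>C"
    then obtain X where X: "x \<in> X" "X \<in> C" by blast
    show "x + y \<in> \<Union>C" if "y \<in> \<Union>C" for y
    proof -
      obtain Y where "y \<in> Y" "Y \<in> C" using \<open>y \<in> \<Union>C\<close> by blast
      then show ?thesis using C_add[OF X(2)] X(1) by blast
    qed
    show "c * x \<in> \<Union>C" if "c \<in> carrier loc_ring" for c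
      using C_mult[OF that X(2)] X(1) residue_class_self[OF N, of "c * x"] by blast
  qed
  show "\<Union>C \<subseteq> I"
  proof
    fix y assume "y \<in> \<Union>C"
    then obtain x where "x \<in> I" "y - x \<in> N" using sub by (auto simp: residue_class_def)
    then have "x + (y - x) \<in> I" using I unfolding submod_def by blast
    then show "y \<in> I" by simp
  qed
  have cls: "X = residue_class N x" if "X \<in> C" "x \<in> X" for X x
  proof -
    obtain y where "X = residue_class N y" using sub \<open>X \<in> C\<close> by blast
    then show ?thesis using residue_class_eq[OF N] \<open>x \<in> X\<close> by blast
  qed
  show "C = residue_class N ` (\<Union>C)"
  proof (intro equalityI subsetI)
    fix X assume X: "X \<in> C"
    then obtain x where "X = residue_class N x" using sub by blast
    then have "x \<in> X" using residue_class_self[OF N] by blast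
    then show "X \<in> residue_class N ` (\<Union>C)" using cls[OF X] X by blast
  next
    fix X assume "X \<in> residue_class N ` (\<Union>C)"
    then obtain x Y where "X = residue_class N x" "x \<in> Y" "Y \<in> C" by blast
    then show "X \<in> C" using cls by blast
  qed
qed

text \<open>
  The argument of Jordan and Hoelder. For a submodule \<open>D\<close>, consider the steps \<open>k\<close> at which \<open>D \<inter> G (k + 1)\<close> is
  not contained in \<open>G k\<close>. Since the factors are simple, a strictly larger submodule has strictly more
  such steps, so a chain has at most as many inclusions as there are steps. The assumption on
  \<open>x - c y\<close> states that \<open>G (k + 1) / G k\<close> is generated by each of its nonzero elements.
\<close>

lemma module_length_eq_composition_series:
  fixes G :: "nat \<Rightarrow> ('n::{finite,linorder}, 'k::field) mpol fract set"
  assumes G: "\<And>k. k \<le> l \<Longrightarrow> submod (G k)" and strict: "\<And>k. k < l \<Longrightarrow> G k \<subset> G (Suc k)"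
    and simple: "\<And>k x y. k < l \<Longrightarrow> x \<in> G (Suc k) \<Longrightarrow> y \<in> G (Suc k) \<Longrightarrow> y \<notin> G k \<Longrightarrow>
      \<exists>c\<in>carrier loc_ring. x - c * y \<in> G k"
  shows "module_length loc_ring (quot (G l) (G 0)) = enat l"
proof -
  have G_mono: "G i \<subseteq> G j" if "i \<le> j" "j \<le> l" for i j
    using that by (induction rule: dec_induct) (use strict in \<open>auto dest: Suc_le_lessD\<close>)
  have N: "submod (G 0)" and I: "submod (G l)" "G 0 \<subseteq> G l" using G G_mono by auto
  let ?Q = "quot (G l) (G 0)"
  have "enat l \<in> {enat l | l. \<exists>C. (\<forall>i\<le>l. submodule (C i) loc_ring ?Q) \<and> (\<forall>i<l. C i \<subset> C (Suc i))}"
  proof (intro CollectI exI[of _ l] exI[of _ "\<lambda>i. residue_class (G 0) ` G i"] conjI allI impI refl)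
    show "submodule (residue_class (G 0) ` G i) loc_ring ?Q" if "i \<le> l" for i
      using that by (intro submodule_of_submod N G G_mono) auto
    show "residue_class (G 0) ` G i \<subset> residue_class (G 0) ` G (Suc i)" if i: "i < l" for i
    proof
      show "residue_class (G 0) ` G i \<subseteq> residue_class (G 0) ` G (Suc i)" using strict[OF i] by blast
      obtain x where x: "x \<in> G (Suc i)" "x \<notin> G i" using strict[OF i] by blast
      have "residue_class (G 0) x \<notin> residue_class (G 0) ` G i"
      proof
        assume "residue_class (G 0) x \<in> residue_class (G 0) ` G i"
        then obtain y where y: "y \<in> G i" "residue_class (G 0) x = residue_class (G 0) y" by blast
        then have "x - y \<in> G 0" using residue_class_self[OF N, of x] by (simp add: residue_class_def)
        then have "x - y \<in> G i" using G_mono[of 0 i] i by auto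
        moreover have "submod (G i)" using G i by simp
        ultimately have "y + (x - y) \<in> G i" using y(1) unfolding submod_def by blast
        then show False using x(2) by simp
      qed
      then show "residue_class (G 0) ` G i \<noteq> residue_class (G 0) ` G (Suc i)" using x(1) by blast
    qed
  qed
  moreover have "l' \<le> l" if C: "\<forall>i\<le>l'. submodule (C i) loc_ring ?Q" "\<forall>i<l'. C i \<subset> C (Suc i)" for C l'
  proof -
    define D where "D i = \<Union>(C i)" for i
    note sm = submod_of_submodule[OF N I]
    have D: "submod (D i)" "G 0 \<subseteq> D i" "D i \<subseteq> G l" "C i = residue_class (G 0) ` D i" if "i \<le> l'" for i
      unfolding D_def using sm[of "C i"] C(1)[rule_format, OF that] by simp_all
    define jumps where "jumps D = {k. k < l \<and> \<not> D \<inter> G (Suc k) \<subseteq> G k}" for D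
    have fin: "finite (jumps D)" and jl: "card (jumps D) \<le> l" for D
    proof -
      have "jumps D \<subseteq> {..<l}" by (auto simp: jumps_def)
      then show "finite (jumps D)" "card (jumps D) \<le> l"
        using finite_subset card_mono[of "{..<l}" "jumps D"] by auto
    qed
    have less: "card (jumps (D i)) < card (jumps (D (Suc i)))" if i: "i < l'" for i
    proof -
      have DD: "D i \<subseteq> D (Suc i)" using C(2) i unfolding D_def by blast
      then have sub: "jumps (D i) \<subseteq> jumps (D (Suc i))" unfolding jumps_def by blast
      have "jumps (D i) \<noteq> jumps (D (Suc i))"
      proof
        assume eq: "jumps (D i) = jumps (D (Suc i))"
        have "D (Suc i) \<inter> G k \<subseteq> D i" if "k \<le> l" for k
          using that
        proof (induction k)
          case 0
          then show ?case using D(2)[of i] i by auto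
        next
          case (Suc k)
          show ?case
          proof
            fix x assume x: "x \<in> D (Suc i) \<inter> G (Suc k)"
            show "x \<in> D i"
            proof (cases "x \<in> G k")
              case True
              then show ?thesis using Suc x by auto
            next
              case False
              then have "k \<in> jumps (D (Suc i))" using x Suc.prems by (auto simp: jumps_def)
              then have "k \<in> jumps (D i)" using eq by simp
              then obtain y where y: "y \<in> D i" "y \<in> G (Suc k)" "y \<notin> G k" by (auto simp: jumps_def)
              obtain c where c: "c \<in> carrier loc_ring" "x - c * y \<in> G k"
                using simple[of k x y] Suc.prems x y by auto
              have cy: "c * y \<in> D i" using D(1)[of i] i c(1) y(1) unfolding submod_def by auto
              then have "x - c * y \<in> D (Suc i)" using submod_diff[OF D(1)[of "Suc i"]] x DD i by auto
              then have "x - c * y \<in> D i" using Suc c(2) by auto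
              moreover have "submod (D i)" using D(1) i by simp
              ultimately have "x - c * y + c * y \<in> D i" using cy unfolding submod_def by blast
              then show ?thesis by simp
            qed
          qed
        qed
        then have "D (Suc i) \<subseteq> D i" using D(3)[of "Suc i"] i by auto
        then have "D (Suc i) = D i" using DD by blast
        then have "C (Suc i) = C i" using D(4)[of i] D(4)[of "Suc i"] i by auto
        then show False using C(2) i by blast
      qed
      then show ?thesis using sub fin by (meson psubsetI psubset_card_mono)
    qed
    have "i \<le> card (jumps (D i))" if "i \<le> l'" for i
      using that
    proof (induction i)
      case (Suc i)
      then show ?case using less[of i] by auto
    qed simp
    then show ?thesis using jl[of "D l'"] by (meson le_refl le_trans)
  qed
  ultimately show ?thesis
    unfolding module_length_def by (intro Sup_eqI) auto
qed

text \<open>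
  Adding to the smaller set an exponent of maximal total degree in the difference keeps it
  up-closed.
\<close>

lemma ex_upset_chain:
  assumes "upset E" "upset E'" "E' \<subseteq> E" "finite (E - E')"
  shows "\<exists>G :: nat \<Rightarrow> ('n::finite \<Rightarrow>\<^sub>0 nat) set. G 0 = E' \<and> G (card (E - E')) = E \<and>
    (\<forall>k\<le>card (E - E'). upset (G k)) \<and> (\<forall>k<card (E - E'). \<exists>v. v \<notin> G k \<and> G (Suc k) = insert v (G k))"
  using assms
proof (induction "card (E - E')" arbitrary: E')
  case 0
  then have "E = E'" by auto
  then show ?case using 0 by (intro exI[of _ "\<lambda>_. E'"]) auto
next
  case (Suc l)
  have ne: "E - E' \<noteq> {}"
  proof
    assume "E - E' = {}"
    then show False using Suc.hyps(2) by (simp only: card.empty)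
  qed
  have "Max (total_degree ` (E - E')) \<in> total_degree ` (E - E')" using Suc.prems(4) ne by (intro Max_in) auto
  then obtain v where v: "v \<in> E - E'" "total_degree v = Max (total_degree ` (E - E'))" by auto
  have v_max: "total_degree w \<le> total_degree v" if "w \<in> E - E'" for w using that Suc.prems(4) v(2) by simp
  have "v + w \<in> insert v E'" for w
  proof (cases "w = 0")
    case False
    then have "total_degree w \<noteq> 0" by (simp add: total_degree_eq_0_iff)
    moreover have "total_degree (v + w) = total_degree v + total_degree w" by (rule total_degree_add)
    ultimately have "v + w \<notin> E - E'" using v_max[of "v + w"] by auto
    moreover have "v + w \<in> E" using Suc.prems(1) v(1) unfolding upset_def by blast
    ultimately show ?thesis by blast
  qed simp
  then have up: "upset (insert v E')" using Suc.prems(2) unfolding upset_def by blast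
  have eq: "E - insert v E' = (E - E') - {v}" by blast
  then have card: "l = card (E - insert v E')" using Suc.hyps(2) v(1) Suc.prems(4) by simp
  obtain G where G: "G 0 = insert v E'" "G l = E" "\<forall>k\<le>l. upset (G k)" "\<forall>k<l. \<exists>v. v \<notin> G k \<and> G (Suc k) = insert v (G k)"
    using Suc.hyps(1)[OF card Suc.prems(1) up] Suc.prems(3,4) v(1) card by auto
  show ?case
    unfolding Suc.hyps(2)[symmetric]
  proof (intro exI[of _ "case_nat E' G"] conjI allI impI)
    fix k
    show "upset (case_nat E' G k)" if "k \<le> Suc l" using that G(3) Suc.prems(2) by (cases k) auto
    show "\<exists>v. v \<notin> case_nat E' G k \<and> case_nat E' G (Suc k) = insert v (case_nat E' G k)" if "k < Suc l"
      using that G(1,4) v(1) by (cases k) auto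
  qed (use G in auto)
qed

text \<open>
  The quotient is spanned by the single monomial with exponent \<open>v\<close>. If \<open>a\<close> and \<open>b\<close> are the
  coefficients at \<open>v\<close> of the numerators of \<open>y\<close> and \<open>x\<close>, then \<open>a f - b f'\<close> has no term at \<open>v\<close>.
\<close>

lemma mono_ideal_insert_simple:
  fixes x y :: "('n::{finite,linorder}, 'k::field) mpol fract"
  assumes E: "upset E" "upset (insert v E)" and x: "x \<in> mono_ideal (insert v E)"
    and y: "y \<in> mono_ideal (insert v E)" "y \<notin> mono_ideal E"
  shows "\<exists>c\<in>carrier loc_ring. x - c * y \<in> mono_ideal E"
proof -
  obtain f g where x': "x = Fract f g" "keys f \<subseteq> insert v E" "lookup g 0 \<noteq> 0"
    using x unfolding mono_ideal_def by blast
  obtain f' g' where y': "y = Fract f' g'" "keys f' \<subseteq> insert v E" "lookup g' 0 \<noteq> 0"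
    using y(1) unfolding mono_ideal_def by blast
  define a b where "a = lookup f' v" and "b = lookup f v"
  have a: "a \<noteq> 0"
  proof
    assume "a = 0"
    then have "keys f' \<subseteq> E" using y'(2) by (auto simp: a_def in_keys_iff)
    then show False using y(2) y' unfolding mono_ideal_def by blast
  qed
  define sa sb :: "('n, 'k) mpol" where "sa = single 0 a" and "sb = single 0 b"
  have scale: "lookup (single 0 t * h) w = t * lookup h w" for t and h :: "('n, 'k) mpol" and w
    by (simp add: mult_map_scale_conv_mult[symmetric] map.rep_eq when_def)
  \<comment> \<open>the quotient of the leading coefficients of \<open>x\<close> and \<open>y\<close> at \<open>v\<close>, as an element of the local ring\<close>
  define c where "c = Fract (g' * sb) (g * sa)"
  have den: "lookup (g * sa) 0 \<noteq> 0" using x'(3) a by (simp add: lookup_mult_0 sa_def)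
  have nz: "g \<noteq> 0" "g' \<noteq> 0" "sa \<noteq> 0" using x'(3) y'(3) den by auto
  have "c * y = Fract (sb * f') (g * sa)"
  proof -
    have "c * y = Fract (g' * sb * f') (g * sa * g')" by (simp add: c_def y'(1))
    also have "\<dots> = Fract (sb * f') (g * sa)" using nz by (simp add: eq_fract algebra_simps)
    finally show ?thesis .
  qed
  moreover have "x = Fract (sa * f) (g * sa)" using nz by (simp add: x'(1) eq_fract algebra_simps)
  ultimately have "x - c * y = Fract (sa * f - sb * f') (g * sa)"
    using nz by (simp add: eq_fract algebra_simps)
  moreover have "keys (sa * f - sb * f') \<subseteq> E"
  proof
    fix w assume "w \<in> keys (sa * f - sb * f')"
    then have w: "a * lookup f w - b * lookup f' w \<noteq> 0"
      by (simp add: in_keys_iff lookup_minus scale sa_def sb_def)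
    then have "w \<noteq> v" by (auto simp: a_def b_def)
    moreover have "w \<in> keys f \<or> w \<in> keys f'" using w by (auto simp: in_keys_iff)
    ultimately show "w \<in> E" using x'(2) y'(2) by blast
  qed
  ultimately have "x - c * y \<in> mono_ideal E" using den unfolding mono_ideal_def by blast
  moreover have "c \<in> carrier loc_ring" unfolding c_def carrier_loc_ring mono_ideal_def using den by blast
  ultimately show ?thesis by blast
qed

text \<open>
  Adding the missing monomials one at a time gives a composition series.
\<close>

theorem module_length_mono_ideal_quotient:
  fixes E E' :: "('n::{finite,linorder} \<Rightarrow>\<^sub>0 nat) set"
  assumes E: "upset E" "upset E'" "E' \<subseteq> E" "finite (E - E')"
  shows "module_length loc_ring (quot (mono_ideal E :: ('n, 'k::field) mpol fract set) (mono_ideal E')) = enat (card (E - E'))"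
proof -
  obtain G where G: "G 0 = E'" "G (card (E - E')) = E" "\<forall>k\<le>card (E - E'). upset (G k)"
      "\<forall>k<card (E - E'). \<exists>v. v \<notin> G k \<and> G (Suc k) = insert v (G k)"
    using ex_upset_chain[OF E] by blast
  have "module_length loc_ring (quot (mono_ideal (G (card (E - E'))) :: ('n, 'k) mpol fract set) (mono_ideal (G 0))) = enat (card (E - E'))"
  proof (rule module_length_eq_composition_series[where G = "\<lambda>k. mono_ideal (G k)"])
    show "submod (mono_ideal (G k))" if "k \<le> card (E - E')" for k using G(3) that submod_mono_ideal by blast
    fix k assume k: "k < card (E - E')"
    then obtain v where v: "v \<notin> G k" "G (Suc k) = insert v (G k)" using G(4) by blast
    have up: "upset (G k)" "upset (insert v (G k))" using G(3) k v(2) by (metis less_imp_le, metis Suc_leI)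
    show "mono_ideal (G k) \<subset> (mono_ideal (G (Suc k)) :: ('n, 'k) mpol fract set)"
    proof
      show "mono_ideal (G k) \<subseteq> (mono_ideal (G (Suc k)) :: ('n, 'k) mpol fract set)" unfolding v(2) by (rule mono_ideal_mono) blast
      have "loc_mono v \<in> (mono_ideal (G (Suc k)) :: ('n, 'k) mpol fract set)" "loc_mono v \<notin> (mono_ideal (G k) :: ('n, 'k) mpol fract set)"
        using v up by (simp_all add: loc_mono_in_mono_ideal_iff)
      then show "mono_ideal (G k) \<noteq> (mono_ideal (G (Suc k)) :: ('n, 'k) mpol fract set)" by blast
    qed
    show "\<exists>c\<in>carrier loc_ring. x - c * y \<in> mono_ideal (G k)"
      if "x \<in> mono_ideal (G (Suc k))" "y \<in> mono_ideal (G (Suc k))" "y \<notin> mono_ideal (G k)" for x y :: "('n, 'k) mpol fract"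
      using that up unfolding v(2) by (intro mono_ideal_insert_simple[where v = v]) auto
  qed
  then show ?thesis unfolding G(1,2) .
qed

section \<open>Powers and products of monomial ideals\<close>

lemma upset_staircase: "upset (staircase m V u)"
  unfolding upset_def using staircase_add_exponent by blast

lemma upset_generated: "upset {v + w | v w. v \<in> A}"
proof -
  have "v + w + w' = v + (w + w')" for v w w' :: "'a \<Rightarrow>\<^sub>0 nat" by (rule add.assoc)
  then show ?thesis unfolding upset_def by blast
qed

text \<open>
  The product ideal contains the products of monomials, and these generate the ideal on the right.
\<close>

lemma ideal_prod_mono_ideal:
  assumes E: "upset E" and E': "upset E'"
  shows "(mono_ideal E :: ('n::{finite,linorder}, 'k::field) mpol fract set) \<cdot>\<^bsub>loc_ring\<^esub> mono_ideal E'
    = mono_ideal {a + b | a b. a \<in> E \<and> b \<in> E'}" (is "?I \<cdot>\<^bsub>loc_ring\<^esub> ?I' = mono_ideal ?S")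
proof
  interpret cring "loc_ring :: ('n, 'k) mpol fract ring" by (rule cring_loc_ring)
  have S: "upset ?S"
  proof -
    have "a + b + w = a + (b + w)" for a b w :: "'n \<Rightarrow>\<^sub>0 nat" by (rule add.assoc)
    then show ?thesis using E' unfolding upset_def by blast
  qed
  show "?I \<cdot>\<^bsub>loc_ring\<^esub> ?I' \<subseteq> mono_ideal ?S"
  proof
    fix x assume "x \<in> ?I \<cdot>\<^bsub>loc_ring\<^esub> ?I'"
    then show "x \<in> mono_ideal ?S"
    proof induction
      case (prod i j)
      then show ?case using mono_ideal_mult by (simp add: loc_ring_simps)
    next
      case (sum s t)
      then show ?case using mono_ideal_add[OF S] by (simp add: loc_ring_simps)
    qed
  qed
  have "{s + w | s w. s \<in> ?S} = ?S"
  proof (intro equalityI subsetI)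
    fix x assume "x \<in> ?S"
    moreover have "x = x + 0" by simp
    ultimately show "x \<in> {s + w | s w. s \<in> ?S}" by blast
  qed (use S in \<open>unfold upset_def, blast\<close>)
  then have "(mono_ideal ?S :: ('n, 'k) mpol fract set) = Idl\<^bsub>loc_ring\<^esub> (loc_mono ` ?S)"
    using mono_ideal_eq_genideal[of ?S] by simp
  also have "\<dots> \<subseteq> ?I \<cdot>\<^bsub>loc_ring\<^esub> ?I'"
  proof (rule genideal_minimal)
    show "ideal (?I \<cdot>\<^bsub>loc_ring\<^esub> ?I') loc_ring"
      by (rule ideal_prod_is_ideal[OF ideal_mono_ideal[OF E] ideal_mono_ideal[OF E']])
    show "loc_mono ` ?S \<subseteq> ?I \<cdot>\<^bsub>loc_ring\<^esub> ?I'"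
    proof (rule image_subsetI)
      fix x assume "x \<in> ?S"
      then obtain a b where x: "x = a + b" "a \<in> E" "b \<in> E'" by blast
      have "loc_mono x = loc_mono a \<otimes>\<^bsub>loc_ring\<^esub> (loc_mono b :: ('n, 'k) mpol fract)"
        by (simp add: x(1) loc_ring_simps loc_mono_def mono_pol_def mult_single)
      moreover have "loc_mono a \<in> ?I" "loc_mono b \<in> ?I'"
        using x E E' by (simp_all add: loc_mono_in_mono_ideal_iff)
      ultimately show "loc_mono x \<in> ?I \<cdot>\<^bsub>loc_ring\<^esub> ?I'" by (metis ideal_prod.prod)
    qed
  qed
  finally show "mono_ideal ?S \<subseteq> ?I \<cdot>\<^bsub>loc_ring\<^esub> ?I'" .
qed

lemma staircase_plus_generated:
  assumes "\<forall>i<m. finite (V i)" "i < m"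
  shows "{a + b | a b. a \<in> staircase m V u \<and> b \<in> {v + w | v w. v \<in> V i}} = staircase m V (u(i := Suc (u i)))"
proof -
  have "staircase m V (u(i := Suc (u i))) = {x + v | x v. x \<in> staircase m V u \<and> v \<in> V i}"
    using staircase_Suc[OF assms, of u "u i"] by simp
  also have "\<dots> = {a + b | a b. a \<in> staircase m V u \<and> b \<in> {v + w | v w. v \<in> V i}}"
  proof (intro equalityI subsetI)
    fix z assume "z \<in> {x + v | x v. x \<in> staircase m V u \<and> v \<in> V i}"
    then obtain x v where "z = x + v" "x \<in> staircase m V u" "v \<in> V i" by blast
    moreover have "v = v + 0" for v :: "'a \<Rightarrow>\<^sub>0 nat" by simp
    ultimately show "z \<in> {a + b | a b. a \<in> staircase m V u \<and> b \<in> {v + w | v w. v \<in> V i}}" by blast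
  next
    fix z assume "z \<in> {a + b | a b. a \<in> staircase m V u \<and> b \<in> {v + w | v w. v \<in> V i}}"
    then obtain a v w where "z = a + (v + w)" "a \<in> staircase m V u" "v \<in> V i" by blast
    moreover from this have "z = (a + w) + v" by (simp add: ac_simps)
    ultimately show "z \<in> {x + v | x v. x \<in> staircase m V u \<and> v \<in> V i}" using staircase_add_exponent by blast
  qed
  finally show ?thesis by simp
qed

lemma mono_ideal_staircase_times_power:
  fixes u :: "nat \<Rightarrow> nat"
  assumes V: "\<forall>i<m. finite (V i)" and i: "i < m"
    and K: "K = (mono_ideal {v + w | v w. v \<in> V i} :: ('n::{finite,linorder}, 'k::field) mpol fract set)"
  shows "mono_ideal (staircase m V u) \<otimes>\<^bsub>ideals_set loc_ring\<^esub> (K [^]\<^bsub>ideals_set loc_ring\<^esub> k)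
    = mono_ideal (staircase m V (u(i := u i + k)))"
proof -
  interpret cring "loc_ring :: ('n, 'k) mpol fract ring" by (rule cring_loc_ring)
  interpret M: comm_monoid "ideals_set (loc_ring :: ('n, 'k) mpol fract ring)" by (rule ideals_set_is_comm_monoid)
  have Kc: "K \<in> carrier (ideals_set loc_ring)"
    using ideal_mono_ideal[OF upset_generated] by (simp add: K ideals_set_def)
  have Sc: "mono_ideal (staircase m V u) \<in> carrier (ideals_set (loc_ring :: ('n, 'k) mpol fract ring))" for u
    using ideal_mono_ideal[OF upset_staircase] by (simp add: ideals_set_def)
  show ?thesis
  proof (induction k)
    case 0
    then show ?case using Sc by simp
  next
    case (Suc k)
    have "mono_ideal (staircase m V u) \<otimes>\<^bsub>ideals_set loc_ring\<^esub> (K [^]\<^bsub>ideals_set loc_ring\<^esub> Suc k)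
        = mono_ideal (staircase m V (u(i := u i + k))) \<otimes>\<^bsub>ideals_set loc_ring\<^esub> K"
      unfolding Suc.IH[symmetric] using Sc Kc by (simp add: M.m_assoc)
    also have "\<dots> = mono_ideal (staircase m V ((u(i := u i + k))(i := Suc ((u(i := u i + k)) i))))"
      unfolding staircase_plus_generated[OF V i, symmetric] K
      using ideal_prod_mono_ideal[OF upset_staircase upset_generated] by (simp add: ideals_set_def)
    also have "(u(i := u i + k))(i := Suc ((u(i := u i + k)) i)) = u(i := u i + Suc k)" by simp
    finally show ?case .
  qed
qed

lemma staircase_0: "\<forall>i<m. finite (V i) \<Longrightarrow> staircase m V (\<lambda>_. 0) = UNIV"
  unfolding staircase_def using combs_0[of m V "\<lambda>_. 0"] by auto

lemma ideal_power_prod_eq_staircase: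
  fixes J :: "('n::{finite,linorder}, 'k::field) mpol fract set"
  assumes V: "\<forall>i<r + 1. finite (V i)" and J: "J = mono_ideal {v + w | v w. v \<in> V 0}"
    and I: "\<And>i. i \<in> {1..r} \<Longrightarrow> I i = mono_ideal {v + w | v w. v \<in> V i}"
  shows "ideal_power_prod loc_ring J I r u = mono_ideal (staircase (r + 1) V u)"
proof -
  interpret cring "loc_ring :: ('n, 'k) mpol fract ring" by (rule cring_loc_ring)
  interpret M: comm_monoid "ideals_set (loc_ring :: ('n, 'k) mpol fract ring)" by (rule ideals_set_is_comm_monoid)
  have c: "mono_ideal {v + w | v w. v \<in> V i} \<in> carrier (ideals_set (loc_ring :: ('n, 'k) mpol fract ring))" for i
    using ideal_mono_ideal[OF upset_generated] by (simp add: ideals_set_def)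
  have Sc: "mono_ideal (staircase (r + 1) V u) \<in> carrier (ideals_set (loc_ring :: ('n, 'k) mpol fract ring))" for u
    using ideal_mono_ideal[OF upset_staircase] by (simp add: ideals_set_def)
  define ut where "ut s i = (if 1 \<le> i \<and> i \<le> s then u i else 0)" for s i
  have "(\<Otimes>\<^bsub>ideals_set loc_ring\<^esub>i\<in>{1..s}. I i [^]\<^bsub>ideals_set loc_ring\<^esub> u i) = mono_ideal (staircase (r + 1) V (ut s))" if "s \<le> r" for s
    using that
  proof (induction s)
    case 0
    have "ut 0 = (\<lambda>_. 0)" by (auto simp: ut_def)
    have "one (ideals_set (loc_ring :: ('n, 'k) mpol fract ring)) = mono_ideal UNIV"
      by (simp add: ideals_set_def carrier_loc_ring)
    then show ?case using staircase_0[OF V] \<open>ut 0 = (\<lambda>_. 0)\<close> by simp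
  next
    case (Suc s)
    have step: "{1..Suc s} = insert (Suc s) {1..s}" by auto
    have "(\<Otimes>\<^bsub>ideals_set loc_ring\<^esub>i\<in>{1..Suc s}. I i [^]\<^bsub>ideals_set loc_ring\<^esub> u i)
        = (I (Suc s) [^]\<^bsub>ideals_set loc_ring\<^esub> u (Suc s)) \<otimes>\<^bsub>ideals_set loc_ring\<^esub> mono_ideal (staircase (r + 1) V (ut s))"
      unfolding step using Suc c I by (subst M.finprod_insert) auto
    also have "\<dots> = mono_ideal (staircase (r + 1) V (ut s)) \<otimes>\<^bsub>ideals_set loc_ring\<^esub> (I (Suc s) [^]\<^bsub>ideals_set loc_ring\<^esub> u (Suc s))"
    proof (rule M.m_comm)
      show "I (Suc s) [^]\<^bsub>ideals_set loc_ring\<^esub> u (Suc s) \<in> carrier (ideals_set loc_ring)"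
        using Suc.prems c I by (intro M.nat_pow_closed) auto
    qed (rule Sc)
    also have "\<dots> = mono_ideal (staircase (r + 1) V ((ut s)(Suc s := ut s (Suc s) + u (Suc s))))"
      using Suc.prems by (intro mono_ideal_staircase_times_power V I) auto
    also have "(ut s)(Suc s := ut s (Suc s) + u (Suc s)) = ut (Suc s)" by (auto simp: ut_def)
    finally show ?case .
  qed
  then have "ideal_power_prod loc_ring J I r u
      = (J [^]\<^bsub>ideals_set loc_ring\<^esub> u 0) \<otimes>\<^bsub>ideals_set loc_ring\<^esub> mono_ideal (staircase (r + 1) V (ut r))"
    unfolding ideal_power_prod_def by (simp add: ideals_set_def)
  also have "\<dots> = mono_ideal (staircase (r + 1) V (ut r)) \<otimes>\<^bsub>ideals_set loc_ring\<^esub> (J [^]\<^bsub>ideals_set loc_ring\<^esub> u 0)"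
    unfolding J by (intro M.m_comm M.nat_pow_closed c Sc)
  also have "\<dots> = mono_ideal (staircase (r + 1) V ((ut r)(0 := ut r 0 + u 0)))"
    by (intro mono_ideal_staircase_times_power V J) simp
  also have "staircase (r + 1) V ((ut r)(0 := ut r 0 + u 0)) = staircase (r + 1) V u"
    by (intro staircase_cong) (auto simp: ut_def)
  finally show ?thesis .
qed

section \<open>Mixed multiplicities\<close>

lemma mixed_multiplicities_unique:
  assumes e: "has_mixed_multiplicities R d J I r e" and e': "has_mixed_multiplicities R d J I r e'"
    and n: "n \<in> multi_indices (r + 1) (d - 1)"
  shows "e n = e' n"
proof -
  let ?m = "r + 1" and ?D = "d - 1"
  let ?x = "\<lambda>(u :: nat \<Rightarrow> nat) n. \<Prod>i<?m. real (u i) ^ n i"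
  obtain q U where q: "\<forall>u. (\<forall>i\<le>r. U \<le> u i) \<longrightarrow> ereal_of_enat (mixed_hilbert R J I r u) =
      ereal ((\<Sum>n\<in>multi_indices ?m ?D. e n / (\<Prod>i\<le>r. fact (n i)) * (\<Prod>i\<le>r. real (u i) ^ n i))
        + (\<Sum>k<?D. \<Sum>n\<in>multi_indices ?m k. q n * (\<Prod>i\<le>r. real (u i) ^ n i)))"
    using e unfolding has_mixed_multiplicities_def by blast
  obtain q' U' where q': "\<forall>u. (\<forall>i\<le>r. U' \<le> u i) \<longrightarrow> ereal_of_enat (mixed_hilbert R J I r u) =
      ereal ((\<Sum>n\<in>multi_indices ?m ?D. e' n / (\<Prod>i\<le>r. fact (n i)) * (\<Prod>i\<le>r. real (u i) ^ n i))
        + (\<Sum>k<?D. \<Sum>n\<in>multi_indices ?m k. q' n * (\<Prod>i\<le>r. real (u i) ^ n i)))"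
    using e' unfolding has_mixed_multiplicities_def by blast
  define M where "M = (\<Union>k\<le>?D. multi_indices ?m k)"
  define c where "c n = (if (\<Sum>i<?m. n i) = ?D then (e n - e' n) / (\<Prod>i\<le>r. fact (n i)) else q n - q' n)" for n
  have atMost: "{..r} = {..<?m}" by auto
  have M: "finite M" "M \<subseteq> {n. \<forall>i\<ge>?m. n i = 0}" by (auto simp: M_def finite_multi_indices) (auto simp: multi_indices_def)
  have small: "(\<Sum>i<?m. n i) \<le> ?D" if "n \<in> M" for n using that by (auto simp: M_def multi_indices_def)
  have "(\<Sum>n\<in>M. c n * ?x u n) = 0" if u: "\<forall>i<?m. max U U' \<le> u i" for u
  proof -
    have eq: "(\<Sum>n\<in>multi_indices ?m ?D. e n / (\<Prod>i\<le>r. fact (n i)) * ?x u n) + (\<Sum>k<?D. \<Sum>n\<in>multi_indices ?m k. q n * ?x u n)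
        = (\<Sum>n\<in>multi_indices ?m ?D. e' n / (\<Prod>i\<le>r. fact (n i)) * ?x u n) + (\<Sum>k<?D. \<Sum>n\<in>multi_indices ?m k. q' n * ?x u n)"
      using q[rule_format, of u] q'[rule_format, of u] u unfolding atMost by (auto simp: less_Suc_eq_le)
    have "(\<Sum>n\<in>M. c n * ?x u n) = (\<Sum>k\<le>?D. \<Sum>n\<in>multi_indices ?m k. (if n \<in> M then c n else 0) * ?x u n)"
      using small by (intro sum_by_degree[OF M]) (meson not_le)
    also have "\<dots> = (\<Sum>k\<le>?D. \<Sum>n\<in>multi_indices ?m k. c n * ?x u n)"
      by (intro sum.cong refl) (auto simp: M_def)
    also have "\<dots> = (\<Sum>k<?D. \<Sum>n\<in>multi_indices ?m k. c n * ?x u n) + (\<Sum>n\<in>multi_indices ?m ?D. c n * ?x u n)"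
      by (simp only: lessThan_Suc_atMost[symmetric] sum.lessThan_Suc)
    also have "(\<Sum>n\<in>multi_indices ?m ?D. c n * ?x u n)
        = (\<Sum>n\<in>multi_indices ?m ?D. e n / (\<Prod>i\<le>r. fact (n i)) * ?x u n) - (\<Sum>n\<in>multi_indices ?m ?D. e' n / (\<Prod>i\<le>r. fact (n i)) * ?x u n)"
      unfolding sum_subtractf[symmetric]
      by (intro sum.cong refl) (auto simp: c_def multi_indices_def diff_divide_distrib left_diff_distrib)
    also have "(\<Sum>k<?D. \<Sum>n\<in>multi_indices ?m k. c n * ?x u n)
        = (\<Sum>k<?D. \<Sum>n\<in>multi_indices ?m k. q n * ?x u n) - (\<Sum>k<?D. \<Sum>n\<in>multi_indices ?m k. q' n * ?x u n)"
      unfolding sum_subtractf[symmetric]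
      by (intro sum.cong refl) (auto simp: c_def multi_indices_def left_diff_distrib)
    finally show ?thesis using eq by simp
  qed
  then have "\<forall>n\<in>M. c n = 0" by (intro monomial_sum_eq_0[OF M, of "max U U'"]) blast
  moreover have "n \<in> M" using n by (auto simp: M_def)
  ultimately show ?thesis using n by (auto simp: c_def multi_indices_def)
qed

lemma mixed_multiplicity_eqI:
  assumes "has_mixed_multiplicities R d J I r e" and "n \<in> multi_indices (r + 1) (d - 1)"
  shows "mixed_multiplicity R d J I r n = e n"
  unfolding mixed_multiplicity_def using assms mixed_multiplicities_unique by (intro the_equality) blast+

lemma has_mixed_volumes_cong:
  assumes "\<forall>i<m. Q i = Q' i"
  shows "has_mixed_volumes m Q V \<longleftrightarrow> has_mixed_volumes m Q' V"
proof -
  have "minkowski_comb m Q t = minkowski_comb m Q' t" for t using assms by (intro minkowski_comb_cong) auto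
  then show ?thesis by (simp add: has_mixed_volumes_def)
qed

lemma monomial_ideal_generators:
  fixes K :: "('n::{finite,linorder}, 'k::field) mpol fract set"
  assumes "monomial_ideal K" "K \<noteq> {0}"
  obtains V where "finite V" "V \<noteq> {}" "K = mono_ideal {v + w | v w. v \<in> V}"
proof -
  obtain A where A: "K = mono_ideal {a + w | a w. a \<in> A}"
    using assms(1) unfolding monomial_ideal_def mono_ideal_eq_genideal[symmetric] by blast
  obtain V where V: "finite V" "V \<subseteq> A" "\<And>a. a \<in> A \<Longrightarrow> \<exists>v\<in>V. \<exists>w. a = v + w"
    using finite_generating_exponents[of A] by blast
  have "{a + w | a w. a \<in> A} \<subseteq> {v + w | v w. v \<in> V}"
  proof
    fix x assume "x \<in> {a + w | a w. a \<in> A}"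
    then obtain v w w' where "x = v + w + w'" "v \<in> V" using V(3) by blast
    then have "x = v + (w + w')" by (simp add: add.assoc)
    then show "x \<in> {v + w | v w. v \<in> V}" using \<open>v \<in> V\<close> by blast
  qed
  then have eq: "{a + w | a w. a \<in> A} = {v + w | v w. v \<in> V}" using V(2) by blast
  have "V \<noteq> {}"
  proof
    assume "V = {}"
    then have "K = {Fract f g | f g. keys f \<subseteq> {} \<and> lookup g 0 \<noteq> 0}"
      unfolding A eq mono_ideal_def by simp
    also have "\<dots> \<subseteq> {0}"
    proof
      fix x :: "('n, 'k) mpol fract" assume "x \<in> {Fract f g | f g. keys f \<subseteq> {} \<and> lookup g 0 \<noteq> 0}"
      then obtain f g :: "('n, 'k) mpol" where x: "x = Fract f g" "keys f = {}" by blast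
      have "f = 0" by (rule poly_mapping_eqI) (metis x(2) empty_iff in_keys_iff lookup_zero)
      then show "x \<in> {0}" unfolding x(1) by (cases "g = 0") (simp_all add: Zero_fract_def eq_fract)
    qed
    finally have "K \<subseteq> {0}" .
    then show False using assms(2) mono_ideal_0 A by blast
  qed
  then show ?thesis using that[of V] V(1) A unfolding eq by blast
qed

lemma newton_vertex_hull_mono_ideal:
  fixes V :: "('n::{finite,linorder} \<Rightarrow>\<^sub>0 nat) set"
  assumes "finite V" "V \<noteq> {}"
  obtains F where "F \<subseteq> V" "F \<noteq> {}" "\<And>v. v \<in> V \<Longrightarrow> vec_of v \<in> orth (convex hull (vec_of ` F))"
    "newton_vertex_hull (mono_ideal {v + w | v w. v \<in> V} :: ('n, 'k::field) mpol fract set) = convex hull (vec_of ` F)"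
proof -
  have "newton_polyhedron (mono_ideal {v + w | v w. v \<in> V} :: ('n, 'k) mpol fract set) = convex hull (vec_of ` {v + w | v w. v \<in> V})"
    unfolding newton_polyhedron_def loc_mono_in_mono_ideal_iff[OF upset_generated] vec_of_def[symmetric]
    by (rule arg_cong[of _ _ "\<lambda>S. convex hull S"]) blast
  then have ext: "newton_vertex_hull (mono_ideal {v + w | v w. v \<in> V} :: ('n, 'k) mpol fract set)
      = convex hull {x. x extreme_point_of convex hull (vec_of ` {v + w | v w. v \<in> V})}"
    unfolding newton_vertex_hull_def by (rule arg_cong)
  obtain F where F: "F \<subseteq> V" "F \<noteq> {}"
      "{x. x extreme_point_of convex hull (vec_of ` {v + w | v w. v \<in> V})} = vec_of ` F"
      "\<And>v. v \<in> V \<Longrightarrow> vec_of v \<in> orth (convex hull (vec_of ` F))"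
    using extreme_points_of_newton_polyhedron[OF assms] by blast
  show ?thesis by (rule that[OF F(1,2,4)]) (simp_all only: ext F(3))
qed

text \<open>
  Each variable lies in the radical of \<open>J\<close>, so some power of it is a multiple of a generator, which is
  then itself a power of that variable.
\<close>

lemma primary_contains_pure_powers:
  assumes J: "is_primary_to loc_max J loc_ring" and eq: "J = (mono_ideal {v + w | v w. v \<in> V} :: ('n::{finite,linorder}, 'k::field) mpol fract set)"
  shows "\<exists>v\<in>V. \<forall>l'. l' \<noteq> l \<longrightarrow> lookup v l' = 0"
proof -
  let ?x = "loc_mono (single l 1) :: ('n, 'k) mpol fract"
  have "single l 1 \<noteq> (0 :: 'n \<Rightarrow>\<^sub>0 nat)" by (metis lookup_single_eq lookup_zero zero_neq_one)
  then have "mono_pol (single l 1) \<in> (origin_ideal :: ('n, 'k) mpol set)" "1 \<notin> (origin_ideal :: ('n, 'k) mpol set)"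
    by (simp_all add: origin_ideal_iff mono_pol_def lookup_single)
  then have "?x \<in> loc_max" unfolding loc_max_def loc_mono_def by blast
  then have "?x \<in> radical_of loc_ring J" using J unfolding is_primary_to_def by simp
  then obtain n :: nat where "?x [^]\<^bsub>loc_ring\<^esub> n \<in> J" unfolding radical_of_def by blast
  moreover have "?x [^]\<^bsub>loc_ring\<^esub> n = loc_mono (single l n)"
  proof (induction n)
    case 0
    then show ?case by (simp add: nat_pow_def loc_ring_simps loc_mono_def mono_pol_def One_fract_def)
  next
    case (Suc n)
    have "?x [^]\<^bsub>loc_ring\<^esub> Suc n = ?x [^]\<^bsub>loc_ring\<^esub> n * ?x" by (simp add: nat_pow_def loc_ring_simps)
    also have "\<dots> = loc_mono (single l n + single l 1)"
      unfolding Suc.IH by (simp add: loc_mono_def mono_pol_def mult_single)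
    also have "single l n + single l 1 = single l (Suc n)"
      by (simp add: single_add[symmetric])
    finally show ?case .
  qed
  ultimately have "loc_mono (single l n) \<in> J" by metis
  then obtain v w where vw: "single l n = v + w" "v \<in> V"
    unfolding eq loc_mono_in_mono_ideal_iff[OF upset_generated] by blast
  have "lookup v l' = 0" if "l' \<noteq> l" for l'
  proof -
    have "lookup v l' + lookup w l' = lookup (single l n) l'"
      unfolding vw(1) by (simp add: lookup_add)
    then show ?thesis using that by (simp add: lookup_single when_def)
  qed
  then show ?thesis using vw(2) by blast
qed

lemma convex_hull_insert_convex_hull: "convex hull ({a} \<union> convex hull S) = convex hull (insert a S)"
proof
  have "{a} \<union> convex hull S \<subseteq> convex hull (insert a S)"
    using hull_mono[of S "insert a S" convex] by (auto intro: hull_inc)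
  then show "convex hull ({a} \<union> convex hull S) \<subseteq> convex hull (insert a S)" by (intro hull_minimal convex_convex_hull)
  have "insert a S \<subseteq> {a} \<union> convex hull S" using hull_subset[of S convex] by blast
  then show "convex hull (insert a S) \<subseteq> convex hull ({a} \<union> convex hull S)" by (rule hull_mono)
qed

theorem theorem6p1:
  fixes J :: "('n::{finite,linorder}, 'k::field) mpol fract set"
    and I :: "nat \<Rightarrow> ('n, 'k) mpol fract set"
    and r :: nat
    and n :: "nat \<Rightarrow> nat"
    and Q :: "(real, 'n) vec set"
    and P :: "nat \<Rightarrow> (real, 'n) vec set"
  assumes "monomial_ideal J" and "J \<noteq> {0}" and "is_primary_to loc_max J loc_ring"
    and "\<And>i. i \<in> {1..r} \<Longrightarrow> monomial_ideal (I i) \<and> I i \<noteq> {0}"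
    and "Q = newton_vertex_hull J"
    and "\<And>i. i \<in> {1..r} \<Longrightarrow> P i = newton_vertex_hull (I i)"
    and "n \<in> multi_indices (r + 1) (CARD('n) - 1)"
  shows "mixed_multiplicity loc_ring CARD('n) J I r n =
    fact CARD('n) *
      (mixed_volume (r + 1) (P(0 := convex hull ({0} \<union> Q))) (n(0 := n 0 + 1))
       - mixed_volume (r + 1) (P(0 := Q)) (n(0 := n 0 + 1)))"
proof -
  let ?m = "r + 1" and ?d = "CARD('n)"
  let ?K = "I(0 := J)"
  have K: "monomial_ideal (?K i) \<and> ?K i \<noteq> {0}" if "i < ?m" for i
    using assms(1,2) assms(4)[of i] that by (cases "i = 0") auto
  have "\<forall>i. \<exists>V. i < ?m \<longrightarrow> finite V \<and> V \<noteq> {} \<and> ?K i = mono_ideal {v + w | v w. v \<in> V}"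
  proof
    fix i
    show "\<exists>V. i < ?m \<longrightarrow> finite V \<and> V \<noteq> {} \<and> ?K i = mono_ideal {v + w | v w. v \<in> V}"
    proof (cases "i < ?m")
      case True
      obtain V where "finite V" "V \<noteq> {}" "?K i = mono_ideal {v + w | v w. v \<in> V}"
        using monomial_ideal_generators[of "?K i"] K[OF True] by blast
      then show ?thesis by blast
    qed blast
  qed
  from choice[OF this] obtain V where V: "\<forall>i. i < ?m \<longrightarrow> finite (V i) \<and> V i \<noteq> {} \<and> ?K i = mono_ideal {v + w | v w. v \<in> V i}"
    by (elim exE) (rule that)
  have "\<forall>i. \<exists>F. i < ?m \<longrightarrow> F \<subseteq> V i \<and> F \<noteq> {} \<and> (\<forall>v\<in>V i. vec_of v \<in> orth (convex hull (vec_of ` F))) \<and>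
      newton_vertex_hull (?K i) = convex hull (vec_of ` F)"
  proof
    fix i
    show "\<exists>F. i < ?m \<longrightarrow> F \<subseteq> V i \<and> F \<noteq> {} \<and> (\<forall>v\<in>V i. vec_of v \<in> orth (convex hull (vec_of ` F))) \<and>
      newton_vertex_hull (?K i) = convex hull (vec_of ` F)"
    proof (cases "i < ?m")
      case True
      then have Vi: "finite (V i)" "V i \<noteq> {}" "?K i = mono_ideal {v + w | v w. v \<in> V i}" using V by blast+
      obtain F where "F \<subseteq> V i" "F \<noteq> {}" "\<And>v. v \<in> V i \<Longrightarrow> vec_of v \<in> orth (convex hull (vec_of ` F))"
        "newton_vertex_hull (mono_ideal {v + w | v w. v \<in> V i} :: ('n, 'k) mpol fract set) = convex hull (vec_of ` F)"
        using newton_vertex_hull_mono_ideal[OF Vi(1,2)] by blast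
      then show ?thesis unfolding Vi(3) by blast
    qed blast
  qed
  from choice[OF this] obtain F where F: "\<forall>i. i < ?m \<longrightarrow> F i \<subseteq> V i \<and> F i \<noteq> {} \<and> (\<forall>v\<in>V i. vec_of v \<in> orth (convex hull (vec_of ` F i))) \<and>
      newton_vertex_hull (?K i) = convex hull (vec_of ` F i)"
    by (elim exE) (rule that)
  have J: "J = mono_ideal {v + w | v w. v \<in> V 0}" using V[rule_format, of 0] by simp
  have I: "I i = mono_ideal {v + w | v w. v \<in> V i}" if "i \<in> {1..r}" for i using V[rule_format, of i] that by simp
  have finV: "\<forall>i<?m. finite (V i)" using V by blast
  interpret newton_system ?m V F
    by (unfold_locales) (use V F primary_contains_pure_powers[OF assms(3) J] in auto)
  have NP: "newton_vertex_hull (?K i) = newton_system.P F i" if "i < ?m" for i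
    using F that by (simp add: P_def)
  have P_eq: "\<forall>i<?m. (P(0 := S)) i = ((newton_system.P F)(0 := S)) i" for S
  proof (intro allI impI)
    fix i assume "i < ?m"
    then show "(P(0 := S)) i = ((newton_system.P F)(0 := S)) i"
      using NP[of i] assms(6)[of i] by (cases "i = 0") auto
  qed
  have Q_eq: "Q = newton_system.P F 0" using NP[of 0] assms(5) by simp
  let ?A = "(newton_system.P F)(0 := convex hull ({0} \<union> newton_system.P F 0))"
  obtain VB where VB: "has_mixed_volumes ?m (newton_system.P F) VB"
    using ex_mixed_volumes_lattice_polytopes[of ?m F] F finF unfolding P_def[abs_def] by blast
  have "\<exists>V. has_mixed_volumes ?m (\<lambda>i. convex hull (vec_of ` (F(0 := insert 0 (F 0))) i)) V"
    using F finF by (intro ex_mixed_volumes_lattice_polytopes) auto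
  moreover have "convex hull (vec_of ` (F(0 := insert 0 (F 0))) i) = ?A i" for i
  proof -
    have "vec_of (0 :: 'n \<Rightarrow>\<^sub>0 nat) = 0" by (simp add: vec_eq_iff)
    then show ?thesis by (simp add: P_def convex_hull_insert_convex_hull[simplified])
  qed
  ultimately have "\<exists>V. has_mixed_volumes ?m ?A V" by (simp only:)
  then obtain VA where VA: "has_mixed_volumes ?m ?A VA" by blast
  have prod: "ideal_power_prod loc_ring J I r u = mono_ideal (staircase ?m V u)" for u
    by (rule ideal_power_prod_eq_staircase[OF finV J]) (rule I)
  have hilbert: "mixed_hilbert loc_ring J I r u = enat (hilbert u)" for u
  proof -
    have "staircase ?m V (u(0 := u 0 + 1)) \<subseteq> staircase ?m V u"
      using staircase_antimono_0[OF finV, of 0 "u 0" "u 0 + 1" u] by simp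
    then show ?thesis
      unfolding mixed_hilbert_def prod hilbert_def
      by (intro module_length_mono_ideal_quotient upset_staircase finite_staircase_step)
  qed
  define e where "e n = fact ?d * (VA (n(0 := n 0 + 1)) - VB (n(0 := n 0 + 1)))" for n
  have atMost: "{..r} = {..<?m}" by auto
  have "has_mixed_multiplicities loc_ring ?d J I r e"
  proof -
    obtain q U where qU: "\<forall>u. (\<forall>i<?m. U \<le> u i) \<longrightarrow> real (hilbert u) =
      (\<Sum>n\<in>multi_indices ?m (?d - 1). e n / (\<Prod>i<?m. fact (n i)) * (\<Prod>i<?m. real (u i) ^ n i))
      + (\<Sum>k<?d - 1. \<Sum>n\<in>multi_indices ?m k. q n * (\<Prod>i<?m. real (u i) ^ n i))"
      using hilbert_eventually_polynomial[OF VA VB] unfolding e_def by blast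
    show ?thesis
      unfolding has_mixed_multiplicities_def hilbert atMost
    proof (intro exI allI impI)
      fix u assume "\<forall>i\<le>r. U \<le> u i"
      then have "\<forall>i<?m. U \<le> u i" by simp
      then show "ereal_of_enat (enat (hilbert u)) = ereal ((\<Sum>n\<in>multi_indices ?m (?d - 1). e n / (\<Prod>i<?m. fact (n i)) * (\<Prod>i<?m. real (u i) ^ n i))
        + (\<Sum>k<?d - 1. \<Sum>n\<in>multi_indices ?m k. q n * (\<Prod>i<?m. real (u i) ^ n i)))"
        using qU by simp
    qed
  qed
  then have mult: "mixed_multiplicity loc_ring ?d J I r n = e n"
    using assms(7) by (rule mixed_multiplicity_eqI)
  have n1: "n(0 := n 0 + 1) \<in> multi_indices ?m ?d"
  proof -
    have "(\<Sum>i<?m. f i) = f 0 + (\<Sum>i\<in>{..<?m} - {0}. f i)" for f :: "nat \<Rightarrow> nat"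
      using sum.remove[of "{..<?m}" 0 f] by simp
    moreover have "0 < ?d" by (simp add: card_gt_0_iff)
    ultimately show ?thesis using assms(7) by (auto simp: multi_indices_def)
  qed
  have "has_mixed_volumes ?m (P(0 := convex hull ({0} \<union> Q))) VA"
    using VA unfolding has_mixed_volumes_cong[OF P_eq] Q_eq .
  moreover have "has_mixed_volumes ?m (P(0 := Q)) VB"
    using VB unfolding has_mixed_volumes_cong[OF P_eq] Q_eq by simp
  ultimately show ?thesis
    using mult n1 by (simp add: mixed_volume_eqI e_def)
qed

end
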